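(* Let $\mathcal A_1$ and $\mathcal A_2$ be $C^*$-algebras over the fields $\mathbb F_1\in\{\mathbb R,\mathbb C\}$ and $\mathbb F_2\in\{\mathbb R,\mathbb C\}$, respectively, and suppose that $\mathcal A_1$ and $\mathcal A_2$ are BJ isomorphic. If $\mathcal A_1$ is a finite-dimensional pseudo-abelian $C^*$-algebra with $\dim_{\mathbb F_1}\mathcal A_1\ge 2$, then: (1) $\mathbb F_1=\mathbb F_2$; (2) $\mathcal A_1$ and $\mathcal A_2$ are isomorphic as $C^*$-algebras (i.e. isometrically $*$-isomorphic); in particular, $\mathcal A_2$ is pseudo-abelian and $\dim\mathcal A_1=\dim\mathcal A_2$.
   Context: Birkhoff–James (BJ) orthogonality: for vectors $v,w$ in a normed space $V$ over $\mathbb F\in\{\mathbb R,\mathbb C\}$, $v\perp w$ means $\|v\|\le\|v+\lambda w\|$ for all $\lambda\in\mathbb F$. A BJ isomorphism between normed spaces $V$ and $V'$ (possibly over different fields, with orthogonality in each taken over its own field) is a bijective map $\phi\colon V\to V'$ (not assumed linear or continuous) with $v\perp w\iff\phi(v)\perp\phi(w)$ for all $v,w\in V$; $V$ and $V'$ are BJ isomorphic if such a map exists. $C^*$-algebras may be real or complex. A finite-dimensional complex $C^*$-algebra is $*$-isomorphic to $\mathcal M_{n_1}(\mathbb C)\oplus\dots\oplus\mathcal M_{n_\ell}(\mathbb C)$, and a finite-dimensional real $C^*$-algebra is $*$-isomorphic to $\mathcal M_{n_1}(\mathbb K_1)\oplus\dots\oplus\mathcal M_{n_\ell}(\mathbb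 K_\ell)$ with $\mathbb K_i\in\{\mathbb R,\mathbb C,\mathbb H\}$ (matrix block decomposition; involution is conjugate transpose, norm is the maximum of the operator norms of the blocks). The minimal two-sided ideals are exactly the individual blocks. The pseudo-abelian summand of a finite-dimensional $C^*$-algebra is the sum of those minimal ideals which are skew-fields, i.e. the sum of all blocks of size one; the algebra is pseudo-abelian if it equals its pseudo-abelian summand, i.e. all blocks in its matrix block decomposition have size one. *)

theory Defs
  imports Complex_Main
begin

text \<open>
  The base field is one of the two subfields \<^term>\<open>\<real>\<close>, \<^term>\<open>UNIV\<close> of the complex numbers, kept as
  data so that algebras over different fields can be compared.  Ring structure, real scaling and
  complete submultiplicative norm come from the type classes of the element type; no unit is
  required.  Over the reals, values of \<open>smul\<close> at non-real arguments are irrelevant.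
\<close>

record 'a cstar_structure =
  scalars :: "complex set"
  smul :: "complex \<Rightarrow> 'a \<Rightarrow> 'a"
  star :: "'a \<Rightarrow> 'a"

text \<open>
  For a real algebra the C*-identity alone is not enough (the complex numbers with the identity as
  involution satisfy it), so \<open>1 + x\<^sup>* x\<close> is required to be invertible in the unitization.  Such an
  inverse is necessarily \<open>1 + y\<close> with \<open>y\<close> in the algebra, which gives the unit-free axiom
  \<open>symmetric\<close>.  Over the complex numbers this property is a theorem and is not assumed.
\<close>

locale cstar_algebra =
  fixes A :: "'a::{real_normed_algebra, banach} cstar_structure"
  assumes scalars: "scalars A = \<real> \<or> scalars A = UNIV"
    and smul_of_real: "smul A (of_real r) x = r *\<^sub>R x"
    and smul_add_right: "c \<in> scalars A \<Longrightarrow> smul A c (x + y) = smul A c x + smul A c y"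
    and smul_add_left: "c \<in> scalars A \<Longrightarrow> d \<in> scalars A \<Longrightarrow> smul A (c + d) x = smul A c x + smul A d x"
    and smul_smul: "c \<in> scalars A \<Longrightarrow> d \<in> scalars A \<Longrightarrow> smul A c (smul A d x) = smul A (c * d) x"
    and smul_mult_left: "c \<in> scalars A \<Longrightarrow> smul A c x * y = smul A c (x * y)"
    and smul_mult_right: "c \<in> scalars A \<Longrightarrow> x * smul A c y = smul A c (x * y)"
    and norm_smul: "c \<in> scalars A \<Longrightarrow> norm (smul A c x) = cmod c * norm x"
    and star_star: "star A (star A x) = x"
    and star_add: "star A (x + y) = star A x + star A y"
    and star_smul: "c \<in> scalars A \<Longrightarrow> star A (smul A c x) = smul A (cnj c) (star A x)"
    and star_mult: "star A (x * y) = star A y * star A x"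
    and cstar_identity: "norm (star A x * x) = (norm x)\<^sup>2"
    and symmetric: "scalars A = \<real> \<Longrightarrow>
      \<exists>y. star A x * x + y + star A x * x * y = 0 \<and> star A x * x + y + y * (star A x * x) = 0"

lemma (in cstar_algebra) vector_space_smul:
  assumes "scalars A = UNIV"
  shows "vector_space (smul A)"
proof
  show "smul A 1 x = x" for x
    using smul_of_real[of 1 x] by simp
qed (simp_all add: assms smul_add_right smul_add_left smul_smul)

definition finite_dimensional :: "'a::{real_normed_algebra, banach} cstar_structure \<Rightarrow> bool" where
  "finite_dimensional A \<longleftrightarrow>
     (\<exists>B. finite B \<and> (if scalars A = \<real> then span B else module.span (smul A) B) = UNIV)"

definition cstar_dim :: "'a::{real_normed_algebra, banach} cstar_structure \<Rightarrow> nat" where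
  "cstar_dim A =
     (if scalars A = \<real> then dim (UNIV :: 'a set) else vector_space.dim (smul A) UNIV)"

definition bj_orth :: "'a::{real_normed_algebra, banach} cstar_structure \<Rightarrow> 'a \<Rightarrow> 'a \<Rightarrow> bool" where
  "bj_orth A v w \<longleftrightarrow> (\<forall>c\<in>scalars A. norm v \<le> norm (v + smul A c w))"

definition bj_isomorphic ::
  "'a::{real_normed_algebra, banach} cstar_structure \<Rightarrow>
   'b::{real_normed_algebra, banach} cstar_structure \<Rightarrow> bool" where
  "bj_isomorphic A B \<longleftrightarrow>
     (\<exists>\<phi> :: 'a \<Rightarrow> 'b. bij \<phi> \<and> (\<forall>v w. bj_orth A v w \<longleftrightarrow> bj_orth B (\<phi> v) (\<phi> w)))"

definition two_sided_ideal :: "'a::{real_normed_algebra, banach} cstar_structure \<Rightarrow> 'a set \<Rightarrow> bool" where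
  "two_sided_ideal A I \<longleftrightarrow>
     0 \<in> I \<and> (\<forall>x\<in>I. \<forall>y\<in>I. x + y \<in> I) \<and> (\<forall>c\<in>scalars A. \<forall>x\<in>I. smul A c x \<in> I) \<and>
     (\<forall>a. \<forall>x\<in>I. a * x \<in> I \<and> x * a \<in> I)"

definition minimal_ideal :: "'a::{real_normed_algebra, banach} cstar_structure \<Rightarrow> 'a set \<Rightarrow> bool" where
  "minimal_ideal A I \<longleftrightarrow>
     two_sided_ideal A I \<and> I \<noteq> {0} \<and>
     (\<forall>J. two_sided_ideal A J \<and> J \<subseteq> I \<longrightarrow> J = {0} \<or> J = I)"

text \<open>For an ideal \<open>I\<close>: the ring \<open>I\<close> is a skew-field, with its own unit \<open>e\<close>.\<close>

definition skew_field :: "'a::ring set \<Rightarrow> bool" where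
  "skew_field I \<longleftrightarrow>
     (\<exists>e\<in>I. e \<noteq> 0 \<and> (\<forall>x\<in>I. e * x = x \<and> x * e = x) \<and>
       (\<forall>x\<in>I. x \<noteq> 0 \<longrightarrow> (\<exists>y\<in>I. x * y = e \<and> y * x = e)))"

definition pseudo_abelian_summand :: "'a::{real_normed_algebra, banach} cstar_structure \<Rightarrow> 'a set" where
  "pseudo_abelian_summand A =
     {\<Sum>I\<in>S. f I | S f. finite S \<and> (\<forall>I\<in>S. minimal_ideal A I \<and> skew_field I \<and> f I \<in> I)}"

definition pseudo_abelian :: "'a::{real_normed_algebra, banach} cstar_structure \<Rightarrow> bool" where
  "pseudo_abelian A \<longleftrightarrow> pseudo_abelian_summand A = UNIV"

definition cstar_isomorphic ::
  "'a::{real_normed_algebra, banach} cstar_structure \<Rightarrow>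
   'b::{real_normed_algebra, banach} cstar_structure \<Rightarrow> bool" where
  "cstar_isomorphic A B \<longleftrightarrow>
     scalars A = scalars B \<and>
     (\<exists>\<psi> :: 'a \<Rightarrow> 'b. bij \<psi> \<and>
       (\<forall>x y. \<psi> (x + y) = \<psi> x + \<psi> y) \<and>
       (\<forall>c\<in>scalars A. \<forall>x. \<psi> (smul A c x) = smul B c (\<psi> x)) \<and>
       (\<forall>x y. \<psi> (x * y) = \<psi> x * \<psi> y) \<and>
       (\<forall>x. \<psi> (star A x) = star B (\<psi> x)) \<and>
       (\<forall>x. norm (\<psi> x) = norm x))"

end

theory Submission
  imports Defs "HOL-Computational_Algebra.Fundamental_Theorem_Algebra"
begin

text \<open>
  Let \<open>O(v)\<close> (below \<open>orth_set\<close>) be the set of all \<open>w\<close> to which \<open>v\<close> is Birkhoff--James orthogonal.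
  A map that preserves orthogonality in both directions carries the inclusion order between the sets
  \<open>O(v)\<close> from \<open>A1\<close> to \<open>A2\<close>, and the proof recovers the algebra from this order.

  Finite dimension.  A supporting functional at \<open>v \<noteq> 0\<close> shows that \<open>O(v)\<close> contains a hyperplane.  So if
  finitely many nonzero vectors \<open>v\<close> have \<open>\<Inter> O(v) = {0}\<close>, then the dimension is finite
  (\<open>finite_span_if_orth_separated\<close>).  Such vectors exist in \<open>A1\<close>, hence in \<open>A2\<close>.

  Blocks of size one.  Call \<open>v \<noteq> 0\<close> smooth if \<open>O(v)\<close> is minimal, and call \<open>v\<close> linked to \<open>w\<close> if the
  truth of \<open>v \<bottom> w'\<close> is the same for all \<open>w'\<close> with \<open>O(w') = O(w)\<close>.  For a minimal projection \<open>p\<close> the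
  column \<open>A p\<close> is a Hilbert space, and for a nonzero \<open>x\<close> in it \<open>O(x)\<close> consists of the \<open>w\<close> for which
  \<open>w p\<close> is orthogonal to \<open>x\<close> in that Hilbert space; such an \<open>x\<close> is smooth (\<open>column_bj_orth_iff\<close>,
  \<open>column_smooth\<close>).  If all blocks have size one, then every smooth vector lives, as far as \<open>O\<close> is
  concerned, in a single block, and smooth vectors are linked exactly if their blocks agree
  (\<open>linked_iff\<close>), so being linked is transitive.  A larger block contains matrix units
  \<open>p = e\<^sub>1\<^sub>1\<close>, \<open>u = e\<^sub>2\<^sub>1\<close>, \<open>q = e\<^sub>2\<^sub>2\<close> for which \<open>p\<close> is linked to \<open>u\<close> and \<open>u\<close> to \<open>q\<close>, but not \<open>p\<close> to \<open>q\<close>: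
  the vector \<open>q + p/2\<close> has the same set \<open>O\<close> as \<open>q\<close>, and \<open>p \<bottom> q\<close>, but not \<open>p \<bottom> q + p/2\<close>
  (\<open>non_central_projection_breaks_transitivity\<close>).  Therefore all blocks of \<open>A2\<close> have size one, and the
  classes of linked smooth vectors match its blocks with those of \<open>A1\<close> (\<open>bj_map_blocks\<close>).

  The field.  If \<open>p\<close> and \<open>q\<close> are two blocks over the complex numbers, the circle of vectors
  \<open>p + \<lambda> q\<close> with \<open>\<bar>\<lambda>\<bar> = 1\<close> has pairwise different sets \<open>O\<close>, whereas two blocks over the reals leave room for
  two relative signs only (\<open>not_bj_map_complex_real\<close>).

  The blocks.  A block of size one is a skew-field; over the complex numbers it is one-dimensional.
  Over the reals it is \<open>\<real>\<close>, \<open>\<complex>\<close> or the quaternions by Frobenius' theorem, and the three cases differ in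
  whether the block contains two or three pairwise orthogonal smooth vectors
  (\<open>bj_map_block_isomorphism\<close>).  Isomorphic blocks add up to isomorphic algebras.
\<close>

section \<open>Supporting functionals\<close>

text \<open>
  The Hahn--Banach theorem at a single vector.  A supporting functional is determined by its kernel, and
  the kernels are the maximal subspaces of vectors to which \<open>v\<close> is orthogonal; so Zorn's lemma is applied
  to such subspaces instead of to partial functionals.
\<close>

lemma supporting_functional:
  fixes v :: "'a::real_normed_vector"
  assumes "v \<noteq> 0"
  obtains f :: "'a \<Rightarrow> real" where "linear f" "f v = norm v" "\<And>x. \<bar>f x\<bar> \<le> norm x"
proof -
  define N where "N = norm v"
  have N: "N > 0" using assms by (simp add: N_def)
  define C where "C = {H. subspace H \<and> (\<forall>h\<in>H. N \<le> norm (v + h))}"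
  have "\<exists>M\<in>C. \<forall>X\<in>C. M \<subseteq> X \<longrightarrow> X = M"
  proof (rule subset_Zorn_nonempty)
    have "{0} \<in> C" by (auto simp: C_def N_def subspace_def)
    then show "C \<noteq> {}" by blast
  next
    fix S assume S: "S \<noteq> {}" "subset.chain C S"
    have sub: "subspace H" if "H \<in> S" for H using S that by (auto simp: C_def subset_chain_def)
    have lin: "X \<subseteq> Y \<or> Y \<subseteq> X" if "X \<in> S" "Y \<in> S" for X Y
      using S that by (auto simp: subset_chain_def)
    have "subspace (\<Union>S)"
      unfolding subspace_def
    proof (intro conjI ballI allI)
      show "0 \<in> \<Union>S" using S sub subspace_0 by blast
      fix x y assume "x \<in> \<Union>S" "y \<in> \<Union>S"
      then obtain X Y where "X \<in> S" "Y \<in> S" "x \<in> X" "y \<in> Y" by blast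
      then show "x + y \<in> \<Union>S" using lin[of X Y] sub subspace_add by blast
    next
      fix c :: real and x assume "x \<in> \<Union>S"
      then show "c *\<^sub>R x \<in> \<Union>S" using sub subspace_scale by blast
    qed
    moreover have "\<forall>h\<in>\<Union>S. N \<le> norm (v + h)" using S by (auto simp: C_def subset_chain_def)
    ultimately show "\<Union>S \<in> C" by (auto simp: C_def)
  qed
  then obtain H where H: "subspace H" "\<And>h. h \<in> H \<Longrightarrow> N \<le> norm (v + h)"
    and max: "\<And>X. X \<in> C \<Longrightarrow> H \<subseteq> X \<Longrightarrow> X = H" by (auto simp: C_def)
  have scaled: "\<bar>t\<bar> * N \<le> norm (t *\<^sub>R v + h)" if "h \<in> H" for t h
  proof (cases "t = 0")
    case False
    have "N \<le> norm (v + (1/t) *\<^sub>R h)" using H that by (simp add: subspace_scale)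
    moreover have "norm (t *\<^sub>R v + h) = \<bar>t\<bar> * norm (v + (1/t) *\<^sub>R h)"
      using False by (simp flip: norm_scaleR add: scaleR_add_right)
    ultimately show ?thesis by (simp add: mult_left_mono)
  qed simp
  have split: "\<exists>t. z - t *\<^sub>R v \<in> H" for z
  proof -
    \<comment> \<open>Adjoining \<open>z - l v\<close> to \<open>H\<close> is possible for every \<open>l\<close> between the elements of \<open>L\<close> and their
      counterparts with a plus sign before the norm.\<close>
    define L where "L = (\<lambda>(s, h). - norm (s *\<^sub>R v + z + h) / N - s) ` (UNIV \<times> H)"
    define l where "l = Sup L"
    have up: "a \<le> norm (s *\<^sub>R v + z + h) / N - s" if "a \<in> L" "h \<in> H" for a s h
    proof -
      obtain s' h' where a: "a = - norm (s' *\<^sub>R v + z + h') / N - s'" "h' \<in> H"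
        using \<open>a \<in> L\<close> by (auto simp: L_def)
      have "\<bar>s - s'\<bar> * N \<le> norm ((s - s') *\<^sub>R v + (h - h'))"
        using scaled H(1) a(2) that(2) by (simp add: subspace_diff)
      also have "(s - s') *\<^sub>R v + (h - h') = (s *\<^sub>R v + z + h) - (s' *\<^sub>R v + z + h')"
        by (simp add: algebra_simps)
      also have "norm \<dots> \<le> norm (s *\<^sub>R v + z + h) + norm (s' *\<^sub>R v + z + h')"
        by (rule norm_triangle_ineq4)
      finally have "(s - s') * N \<le> norm (s *\<^sub>R v + z + h) + norm (s' *\<^sub>R v + z + h')"
        using N by (smt (verit) mult_right_mono)
      then have "s - s' \<le> (norm (s *\<^sub>R v + z + h) + norm (s' *\<^sub>R v + z + h')) / N"
        using N by (simp add: pos_le_divide_eq)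
      then show ?thesis by (simp add: a add_divide_distrib)
    qed
    have "0 \<in> H" using H(1) by (rule subspace_0)
    have ne: "L \<noteq> {}" using \<open>0 \<in> H\<close> by (auto simp: L_def)
    have bdd: "bdd_above L" using up[OF _ \<open>0 \<in> H\<close>] by (auto simp: bdd_above_def)
    have l_le: "l \<le> norm (s *\<^sub>R v + z + h) / N - s" if "h \<in> H" for s h
      unfolding l_def using ne up that by (blast intro: cSup_least)
    have l_ge: "- norm (s *\<^sub>R v + z + h) / N - s \<le> l" if "h \<in> H" for s h
      unfolding l_def using bdd that by (intro cSup_upper) (auto simp: L_def)
    have key: "\<bar>s + l\<bar> * N \<le> norm (s *\<^sub>R v + z + h)" if "h \<in> H" for s h
    proof -
      have "(s + l) * N \<le> norm (s *\<^sub>R v + z + h)" "- (s + l) * N \<le> norm (s *\<^sub>R v + z + h)"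
        using l_le[OF that, of s] l_ge[OF that, of s] N by (simp_all add: field_simps)
      then show ?thesis by (auto simp: abs_if)
    qed
    define X where "X = {c *\<^sub>R (z - l *\<^sub>R v) + h | c h. h \<in> H}"
    have "subspace X"
      unfolding subspace_def
    proof (intro conjI ballI allI)
      show "0 \<in> X" unfolding X_def using \<open>0 \<in> H\<close>
        by (intro CollectI exI[of _ "0::real"] exI[of _ "0::'a"]) simp
    next
      fix x y assume "x \<in> X" "y \<in> X"
      then obtain c h d k where "x = c *\<^sub>R (z - l *\<^sub>R v) + h" "y = d *\<^sub>R (z - l *\<^sub>R v) + k"
        "h \<in> H" "k \<in> H" unfolding X_def by blast
      then have "x + y = (c + d) *\<^sub>R (z - l *\<^sub>R v) + (h + k)" "h + k \<in> H"
        using H(1) by (simp_all add: scaleR_add_left add_ac subspace_add)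
      then show "x + y \<in> X" unfolding X_def by blast
    next
      fix r :: real and x assume "x \<in> X"
      then obtain c h where "x = c *\<^sub>R (z - l *\<^sub>R v) + h" "h \<in> H" unfolding X_def by blast
      then have "r *\<^sub>R x = (r * c) *\<^sub>R (z - l *\<^sub>R v) + r *\<^sub>R h" "r *\<^sub>R h \<in> H"
        using H(1) by (simp_all add: scaleR_add_right subspace_scale)
      then show "r *\<^sub>R x \<in> X" unfolding X_def by blast
    qed
    moreover have "N \<le> norm (v + x)" if "x \<in> X" for x
    proof -
      obtain c h where x: "x = c *\<^sub>R (z - l *\<^sub>R v) + h" "h \<in> H" using \<open>x \<in> X\<close> unfolding X_def by blast
      show ?thesis
      proof (cases "c = 0")
        case False
        have "\<bar>c\<bar> * (\<bar>(1/c - l) + l\<bar> * N) \<le> \<bar>c\<bar> * norm ((1/c - l) *\<^sub>R v + z + (1/c) *\<^sub>R h)"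
          using x(2) H(1) by (intro mult_left_mono key) (simp_all add: subspace_scale)
        also have "\<dots> = norm (c *\<^sub>R ((1/c - l) *\<^sub>R v + z + (1/c) *\<^sub>R h))" by simp
        also have "c *\<^sub>R ((1/c - l) *\<^sub>R v + z + (1/c) *\<^sub>R h) = v + x"
          using False by (simp add: x(1) algebra_simps)
        finally show ?thesis using False by (simp add: abs_if split: if_splits)
      qed (use x H in simp)
    qed
    ultimately have "X \<in> C" by (simp add: C_def)
    moreover have "H \<subseteq> X"
    proof
      fix h assume "h \<in> H"
      then show "h \<in> X" unfolding X_def by (intro CollectI exI[of _ "0::real"] exI[of _ h]) simp
    qed
    ultimately have "X = H" by (rule max)
    moreover have "z - l *\<^sub>R v \<in> X"
      unfolding X_def using \<open>0 \<in> H\<close>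
      by (intro CollectI exI[of _ "1::real"] exI[of _ "0::'a"]) simp
    ultimately show ?thesis by blast
  qed
  have uniq: "t = s" if "z - t *\<^sub>R v \<in> H" "z - s *\<^sub>R v \<in> H" for z t s
  proof -
    have "(s - t) *\<^sub>R v \<in> H" using subspace_diff[OF H(1) that] by (simp add: algebra_simps)
    from scaled[OF this, of "t - s"] show "t = s"
      using N by (simp add: mult_le_0_iff flip: scaleR_add_left)
  qed
  define T where "T z = (SOME t. z - t *\<^sub>R v \<in> H)" for z
  have T: "z - T z *\<^sub>R v \<in> H" for z unfolding T_def using split by (rule someI_ex)
  have T_eq: "T z = t" if "z - t *\<^sub>R v \<in> H" for z t using uniq T that by blast
  show ?thesis
  proof (rule that[of "\<lambda>z. T z * N"])
    show "linear (\<lambda>z. T z * N)"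
    proof (rule linearI)
      fix x y :: 'a and r :: real
      have "(x - T x *\<^sub>R v) + (y - T y *\<^sub>R v) \<in> H" using T H(1) by (simp add: subspace_add)
      then have "T (x + y) = T x + T y" by (intro T_eq) (simp add: algebra_simps)
      then show "T (x + y) * N = T x * N + T y * N" by (simp add: algebra_simps)
      have "r *\<^sub>R (x - T x *\<^sub>R v) \<in> H" using T H(1) by (simp add: subspace_scale)
      then have "T (r *\<^sub>R x) = r * T x" by (intro T_eq) (simp add: algebra_simps)
      then show "T (r *\<^sub>R x) * N = r *\<^sub>R (T x * N)" by simp
    qed
    have "T v = 1" using subspace_0[OF H(1)] by (intro T_eq) simp
    then show "T v * N = norm v" by (simp add: N_def)
    show "\<bar>T x * N\<bar> \<le> norm x" for x
      using scaled[OF T, of "T x" x] N by (simp add: abs_mult)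
  qed
qed

section \<open>Elementary facts about C*-algebras\<close>

context cstar_algebra
begin

abbreviation scal (infixr "\<cdot>" 75) where "c \<cdot> x \<equiv> smul A c x"
abbreviation adj ("_\<^sup>\<star>" [1000] 999) where "x\<^sup>\<star> \<equiv> star A x"

lemma of_real_scalar [simp]: "complex_of_real r \<in> scalars A"
  using scalars by (elim disjE) simp_all

lemma zero_scalar [simp]: "0 \<in> scalars A" using of_real_scalar[of 0] by simp
lemma one_scalar [simp]: "1 \<in> scalars A" using of_real_scalar[of 1] by simp
lemma uminus_scalar [simp]: "c \<in> scalars A \<Longrightarrow> - c \<in> scalars A" using scalars by (elim disjE) simp_all
lemma mult_scalar [simp]: "c \<in> scalars A \<Longrightarrow> d \<in> scalars A \<Longrightarrow> c * d \<in> scalars A"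
  using scalars by (elim disjE) simp_all
lemma divide_scalar [simp]: "c \<in> scalars A \<Longrightarrow> d \<in> scalars A \<Longrightarrow> c / d \<in> scalars A"
  using scalars by (elim disjE) simp_all
lemma cnj_scalar [simp]: "c \<in> scalars A \<Longrightarrow> cnj c \<in> scalars A"
  using scalars by (metis Reals_cnj_iff UNIV_I)

lemma scalar_cases:
  obtains (real) "scalars A = \<real>" "\<i> \<notin> scalars A" | (complex) "scalars A = UNIV"
  using scalars by (metis i_not_in_Reals)

lemma scal_one [simp]: "1 \<cdot> x = x" using smul_of_real[of 1 x] by simp
lemma scal_zero_left [simp]: "0 \<cdot> x = 0" using smul_of_real[of 0 x] by simp
lemma scal_uminus_one: "(-1) \<cdot> x = - x" using smul_of_real[of "-1" x] by simp
lemma scal_minus_left: "c \<in> scalars A \<Longrightarrow> (- c) \<cdot> x = - (c \<cdot> x)"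
  using smul_smul[of "-1" c x] by (simp add: scal_uminus_one)
lemma scal_minus_right: "c \<in> scalars A \<Longrightarrow> c \<cdot> (- x) = - (c \<cdot> x)"
  using smul_smul[of c "-1" x] by (simp add: scal_uminus_one scal_minus_left)
lemma scal_zero_right [simp]: "c \<in> scalars A \<Longrightarrow> c \<cdot> 0 = 0"
  using smul_add_right[of c 0 0] by simp
lemma scal_diff_right: "c \<in> scalars A \<Longrightarrow> c \<cdot> (x - y) = c \<cdot> x - c \<cdot> y"
  using smul_add_right[of c x "- y"] by (simp add: scal_minus_right)
lemma scal_scaleR: "c \<in> scalars A \<Longrightarrow> c \<cdot> (r *\<^sub>R x) = r *\<^sub>R (c \<cdot> x)"
  using smul_smul[of c "of_real r" x] smul_smul[of "of_real r" c x]
  by (simp add: smul_of_real mult.commute)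
lemma scal_linear: "c \<in> scalars A \<Longrightarrow> linear (\<lambda>x. c \<cdot> x)"
  by (rule linearI) (simp_all add: smul_add_right scal_scaleR)
lemma scal_eq_0: "c \<in> scalars A \<Longrightarrow> c \<cdot> x = 0 \<longleftrightarrow> c = 0 \<or> x = 0"
  using norm_smul[of c x] by (metis mult_eq_0_iff norm_eq_zero)
lemma scal_Complex: "scalars A = UNIV \<Longrightarrow> c \<cdot> x = Re c *\<^sub>R x + Im c *\<^sub>R (\<i> \<cdot> x)"
  using smul_add_left[of "of_real (Re c)" "of_real (Im c) * \<i>" x]
    smul_smul[of "of_real (Im c)" \<i> x] complex_eq[of c]
  by (simp add: smul_of_real mult.commute)
lemma scal_real: "scalars A = \<real> \<Longrightarrow> c \<in> scalars A \<Longrightarrow> c \<cdot> x = Re c *\<^sub>R x"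
  using smul_of_real by (auto elim: Reals_cases)

lemma adj_scaleR [simp]: "(r *\<^sub>R x)\<^sup>\<star> = r *\<^sub>R x\<^sup>\<star>"
  using star_smul[of "of_real r" x] by (simp add: smul_of_real)
lemma adj_0 [simp]: "0\<^sup>\<star> = 0" using adj_scaleR[of 0 0] by simp
lemma adj_minus [simp]: "(- x)\<^sup>\<star> = - x\<^sup>\<star>" using adj_scaleR[of "-1" x] by simp
lemma adj_diff: "(x - y)\<^sup>\<star> = x\<^sup>\<star> - y\<^sup>\<star>" using star_add[of x "- y"] by simp
lemma adj_eq_0 [simp]: "x\<^sup>\<star> = 0 \<longleftrightarrow> x = 0" by (metis adj_0 star_star)

lemma norm_adj [simp]: "norm (x\<^sup>\<star>) = norm x"
proof -
  have le: "norm x \<le> norm (x\<^sup>\<star>)" for x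
  proof (cases "x = 0")
    case False
    have "norm x * norm x \<le> norm (x\<^sup>\<star>) * norm x"
      using norm_mult_ineq[of "x\<^sup>\<star>" x] by (simp add: cstar_identity power2_eq_square)
    then show ?thesis using False by simp
  qed simp
  show ?thesis using le[of x] le[of "x\<^sup>\<star>"] by (simp add: star_star)
qed

lemma cstar_identity': "norm (x * x\<^sup>\<star>) = (norm x)\<^sup>2"
  using cstar_identity[of "x\<^sup>\<star>"] by (simp add: star_star)

lemma adj_mult_self_eq_0: "x\<^sup>\<star> * x = 0 \<longleftrightarrow> x = 0"
  by (metis cstar_identity norm_eq_zero power2_eq_square mult_eq_0_iff mult_zero_right)

lemma mult_adj_self_eq_0: "x * x\<^sup>\<star> = 0 \<longleftrightarrow> x = 0"
  using adj_mult_self_eq_0[of "x\<^sup>\<star>"] by (simp add: star_star)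

end

section \<open>Notions defined by orthogonality alone\<close>

definition orth_set :: "'a::{real_normed_algebra, banach} cstar_structure \<Rightarrow> 'a \<Rightarrow> 'a set" where
  "orth_set A v = {w. bj_orth A v w}"

text \<open>
  Minimality of \<open>O(v)\<close> is a property of the orthogonality relation alone, and it replaces the uniqueness
  of the supporting functional.
\<close>

definition smooth :: "'a::{real_normed_algebra, banach} cstar_structure \<Rightarrow> 'a \<Rightarrow> bool" where
  "smooth A v \<longleftrightarrow> v \<noteq> 0 \<and>
     (\<forall>u. u \<noteq> 0 \<longrightarrow> orth_set A u \<subseteq> orth_set A v \<longrightarrow> orth_set A u = orth_set A v)"

text \<open>
  In a sum of skew-fields this relation tells the blocks apart, see \<open>linked_iff\<close>.
\<close>

definition linked :: "'a::{real_normed_algebra, banach} cstar_structure \<Rightarrow> 'a \<Rightarrow> 'a \<Rightarrow> bool" where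
  "linked A v w \<longleftrightarrow>
     (\<forall>w'. orth_set A w' = orth_set A w \<longrightarrow> (bj_orth A v w' \<longleftrightarrow> bj_orth A v w))"

definition projection :: "'a::{real_normed_algebra, banach} cstar_structure \<Rightarrow> 'a \<Rightarrow> bool" where
  "projection A p \<longleftrightarrow> star A p = p \<and> p * p = p"

text \<open>
  The last condition expresses minimality in the form in which it is used: the column \<open>A p\<close> is a Hilbert
  space, with norms computed in \<open>\<real> p\<close>.
\<close>

definition minimal_projection ::
  "'a::{real_normed_algebra, banach} cstar_structure \<Rightarrow> 'a \<Rightarrow> bool" where
  "minimal_projection A p \<longleftrightarrow> projection A p \<and> p \<noteq> 0 \<and>
     (\<forall>x. star A (x * p) * (x * p) = (norm (x * p))\<^sup>2 *\<^sub>R p)"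

text \<open>
  The real inner product on the column \<open>A p\<close>, obtained from the norm by polarization.
\<close>

definition column_inner :: "'a::real_normed_algebra \<Rightarrow> 'a \<Rightarrow> 'a \<Rightarrow> real" where
  "column_inner p x y = ((norm ((x + y) * p))\<^sup>2 - (norm (x * p))\<^sup>2 - (norm (y * p))\<^sup>2) / 2"

lemma zero_if_quadratic_nonneg:
  fixes s C :: real
  assumes "\<And>t. 0 \<le> 2 * t * s + t\<^sup>2 * C" "C \<ge> 0"
  shows "s = 0"
proof (rule ccontr)
  assume "s \<noteq> 0"
  then have s: "s\<^sup>2 > 0" by simp
  have "0 \<le> 2 * (- s / (C + 1)) * s + (- s / (C + 1))\<^sup>2 * C" by (rule assms(1))
  also have "\<dots> = - s\<^sup>2 * (C + 2) / (C + 1)\<^sup>2"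
    using assms(2) by (simp add: divide_simps power2_eq_square) (simp add: algebra_simps)
  also have "\<dots> < 0" using s assms(2) by (simp add: divide_neg_pos mult_neg_pos)
  finally show False by simp
qed

context cstar_algebra
begin

lemma bj_orthD: "bj_orth A v w \<Longrightarrow> c \<in> scalars A \<Longrightarrow> norm v \<le> norm (v + c \<cdot> w)"
  by (simp add: bj_orth_def)

lemma bj_orth_self: "bj_orth A v v \<longleftrightarrow> v = 0"
proof
  assume "bj_orth A v v"
  from bj_orthD[OF this, of "-1"] show "v = 0" by (simp add: scal_uminus_one)
qed (simp add: bj_orth_def)

lemma bj_orth_zero_left: "bj_orth A 0 w" by (simp add: bj_orth_def)

lemma orth_set_zero_eq_UNIV: "orth_set A v = UNIV \<longleftrightarrow> v = 0"
  using bj_orth_self[of v] bj_orth_zero_left by (auto simp: orth_set_def)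

lemma orth_set_scal:
  assumes c: "c \<in> scalars A" "c \<noteq> 0"
  shows "orth_set A (c \<cdot> v) = orth_set A v"
proof -
  have norm_eq: "norm (c \<cdot> v + d \<cdot> w) = cmod c * norm (v + (d / c) \<cdot> w)" if "d \<in> scalars A" for d w
    using that c norm_smul[of c "v + (d / c) \<cdot> w"] by (simp add: smul_add_right smul_smul)
  have "bj_orth A (c \<cdot> v) w \<longleftrightarrow> bj_orth A v w" for w
  proof
    assume l: "bj_orth A (c \<cdot> v) w"
    show "bj_orth A v w" unfolding bj_orth_def
    proof
      fix d assume d: "d \<in> scalars A"
      have "cmod c * norm v \<le> norm (c \<cdot> v + (c * d) \<cdot> w)"
        using bj_orthD[OF l, of "c * d"] d c by (simp add: norm_smul)
      also have "\<dots> = cmod c * norm (v + d \<cdot> w)" using norm_eq[of "c * d" w] c d by simp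
      finally show "norm v \<le> norm (v + d \<cdot> w)" using c by simp
    qed
  next
    assume r: "bj_orth A v w"
    show "bj_orth A (c \<cdot> v) w" unfolding bj_orth_def
    proof
      fix d assume d: "d \<in> scalars A"
      show "norm (c \<cdot> v) \<le> norm (c \<cdot> v + d \<cdot> w)"
        using bj_orthD[OF r, of "d / c"] d c norm_eq[OF d, of w]
        by (simp add: norm_smul mult_left_mono)
    qed
  qed
  then show ?thesis by (simp add: orth_set_def)
qed

lemma bj_orth_adj: "bj_orth A (v\<^sup>\<star>) (w\<^sup>\<star>) \<longleftrightarrow> bj_orth A v w"
proof -
  have imp: "bj_orth A (v\<^sup>\<star>) (w\<^sup>\<star>)" if "bj_orth A v w" for v w
    unfolding bj_orth_def
  proof
    fix c assume c: "c \<in> scalars A"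
    have "v\<^sup>\<star> + c \<cdot> w\<^sup>\<star> = (v + cnj c \<cdot> w)\<^sup>\<star>" using c by (simp add: star_add star_smul)
    then have "norm (v\<^sup>\<star> + c \<cdot> w\<^sup>\<star>) = norm (v + cnj c \<cdot> w)" by simp
    then show "norm (v\<^sup>\<star>) \<le> norm (v\<^sup>\<star> + c \<cdot> w\<^sup>\<star>)"
      using bj_orthD[OF that, of "cnj c"] c by simp
  qed
  show ?thesis using imp[of v w] imp[of "v\<^sup>\<star>" "w\<^sup>\<star>"] by (auto simp: star_star)
qed

lemma orth_set_adj_eq:
  assumes "orth_set A v = orth_set A w"
  shows "orth_set A (v\<^sup>\<star>) = orth_set A (w\<^sup>\<star>)"
proof -
  have "bj_orth A (v\<^sup>\<star>) x \<longleftrightarrow> bj_orth A (w\<^sup>\<star>) x" for x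
    using assms bj_orth_adj[of v "x\<^sup>\<star>"] bj_orth_adj[of w "x\<^sup>\<star>"]
    by (simp add: star_star orth_set_def set_eq_iff)
  then show ?thesis by (simp add: orth_set_def)
qed

text \<open>
  A functional that supports the ball at the midpoint of a segment supports it at both ends; for
  orthogonality this comes down to the triangle inequality.
\<close>

lemma orth_set_midpoint_subset:
  assumes m: "2 *\<^sub>R m = v + w" and "norm v \<le> norm m" "norm w \<le> norm m"
  shows "orth_set A m \<subseteq> orth_set A v"
proof
  fix x assume "x \<in> orth_set A m"
  then have x: "bj_orth A m x" by (simp add: orth_set_def)
  have "norm v \<le> norm (v + c \<cdot> x)" if c: "c \<in> scalars A" for c
  proof -
    have "2 * norm m \<le> 2 * norm (m + (c / 2) \<cdot> x)"
      using bj_orthD[OF x, of "c / 2"] c of_real_scalar[of 2] by simp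
    also have "\<dots> = norm (2 *\<^sub>R (m + (c / 2) \<cdot> x))" by simp
    also have "2 *\<^sub>R (m + (c / 2) \<cdot> x) = (v + c \<cdot> x) + w"
      using c of_real_scalar[of 2] smul_smul[of "of_real 2" "c / 2" x]
      by (simp add: scaleR_add_right m smul_of_real flip: smul_of_real[of 2 "(c / 2) \<cdot> x"])
    also have "norm \<dots> \<le> norm (v + c \<cdot> x) + norm w" by (rule norm_triangle_ineq)
    finally show ?thesis using assms by simp
  qed
  then show "x \<in> orth_set A v" by (simp add: orth_set_def bj_orth_def)
qed

text \<open>
  Over the complex numbers \<open>f\<close> is the real part of the complex-linear functional
  \<open>F x = f x - \<i> f (\<i> x)\<close>, and \<open>c = F w / F u\<close>; the hypothesis on \<open>\<i> u\<close> makes \<open>F u\<close> real.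
\<close>

lemma kernel_decompose:
  assumes f: "linear f" "f u \<noteq> 0" "\<i> \<in> scalars A \<Longrightarrow> f (\<i> \<cdot> u) = (0::real)"
  shows "\<exists>c\<in>scalars A. \<forall>d\<in>scalars A. f (d \<cdot> (w - c \<cdot> u)) = 0"
proof (cases rule: scalar_cases)
  case real
  let ?c = "f w / f u"
  have "f (d \<cdot> (w - of_real ?c \<cdot> u)) = 0" if "d \<in> scalars A" for d
    using that f(2) by (simp add: scal_real[OF real(1)] smul_of_real linear_scale[OF f(1)]
        linear_diff[OF f(1)])
  then show ?thesis by (intro bexI[of _ "of_real ?c"]) auto
next
  case complex
  define c where "c = Complex (f w / f u) (- f (\<i> \<cdot> w) / f u)"
  have fscal: "f (d \<cdot> x) = Re d * f x + Im d * f (\<i> \<cdot> x)" for d x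
    by (subst scal_Complex[OF complex]) (simp add: linear_add[OF f(1)] linear_scale[OF f(1)])
  have fu: "f (d \<cdot> u) = Re d * f u" for d
    using f(3) complex by (subst fscal) simp
  have "f (w - c \<cdot> u) = 0" using f(2) by (simp add: linear_diff[OF f(1)] fu c_def)
  moreover have "f (\<i> \<cdot> (w - c \<cdot> u)) = 0"
    using f(2) complex
    by (simp add: scal_diff_right smul_smul linear_diff[OF f(1)] fu) (simp add: c_def)
  ultimately have "f (d \<cdot> (w - c \<cdot> u)) = 0" for d by (subst fscal) simp
  then show ?thesis using complex by auto
qed

lemma bj_orth_if_functional:
  assumes f: "linear f" "f u = norm u" "\<And>x. \<bar>f x\<bar> \<le> norm x"
    and w: "\<And>d. d \<in> scalars A \<Longrightarrow> f (d \<cdot> w) = 0"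
  shows "bj_orth A u w"
  unfolding bj_orth_def
proof
  fix c assume c: "c \<in> scalars A"
  have "norm u = f (u + c \<cdot> w)" using f w[OF c] by (simp add: linear_add)
  also have "\<dots> \<le> norm (u + c \<cdot> w)" using f(3)[of "u + c \<cdot> w"] by simp
  finally show "norm u \<le> norm (u + c \<cdot> w)" .
qed

text \<open>
  Otherwise \<open>f\<close> would exceed the norm at a complex multiple of \<open>u\<close>.
\<close>

lemma supporting_functional_imaginary:
  assumes f: "linear f" "f u = norm u" "\<And>x. \<bar>f x\<bar> \<le> norm x" and i: "\<i> \<in> scalars A"
  shows "f (\<i> \<cdot> u) = 0"
proof (cases "u = 0")
  case True
  then show ?thesis using i f(1) by (simp add: linear_0)
next
  case False
  have C: "scalars A = UNIV" using i by (cases rule: scalar_cases) auto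
  define s where "s = f (\<i> \<cdot> u)"
  define n where "n = norm u"
  have n: "n > 0" using False by (simp add: n_def)
  have "n\<^sup>2 + s\<^sup>2 = f (Complex n s \<cdot> u)"
    by (subst scal_Complex[OF C])
      (simp add: linear_add[OF f(1)] linear_scale[OF f(1)] f(2) s_def n_def power2_eq_square)
  also have "\<dots> \<le> sqrt (n\<^sup>2 + s\<^sup>2) * n"
    using f(3)[of "Complex n s \<cdot> u"] by (simp add: norm_smul C n_def complex_norm)
  finally have "sqrt (n\<^sup>2 + s\<^sup>2) * sqrt (n\<^sup>2 + s\<^sup>2) \<le> sqrt (n\<^sup>2 + s\<^sup>2) * n" by simp
  moreover have "sqrt (n\<^sup>2 + s\<^sup>2) > 0" using n by (simp add: add_pos_nonneg)
  ultimately have "sqrt (n\<^sup>2 + s\<^sup>2) \<le> n" by (rule mult_left_le_imp_le)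
  then have "n\<^sup>2 + s\<^sup>2 \<le> n\<^sup>2" by (rule sqrt_le_D)
  then show ?thesis by (simp add: s_def)
qed

lemma orth_decomposition:
  assumes "u \<noteq> 0"
  shows "\<exists>c\<in>scalars A. bj_orth A u (w - c \<cdot> u)"
proof -
  obtain f where f: "linear f" "f u = norm u" "\<And>x. \<bar>f x\<bar> \<le> norm x"
    using supporting_functional[OF assms] by blast
  have "\<exists>c\<in>scalars A. \<forall>d\<in>scalars A. f (d \<cdot> (w - c \<cdot> u)) = 0"
    using f assms supporting_functional_imaginary by (intro kernel_decompose) auto
  then show ?thesis using bj_orth_if_functional[OF f] by blast
qed

section \<open>Minimal projections and their columns\<close>

lemma minimal_projectionD:
  assumes "minimal_projection A p"
  shows "projection A p" "p\<^sup>\<star> = p" "p * p = p" "p \<noteq> 0"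
    "(x * p)\<^sup>\<star> * (x * p) = (norm (x * p))\<^sup>2 *\<^sub>R p"
  using assms by (auto simp: minimal_projection_def projection_def)

lemma norm_projection_le: "projection A p \<Longrightarrow> norm p \<le> 1"
  using cstar_identity[of p] power2_eq_square[of "norm p"]
  by (cases "p = 0") (auto simp: projection_def)

lemma norm_minimal_projection: "minimal_projection A p \<Longrightarrow> norm p = 1"
  using cstar_identity[of p] minimal_projectionD[of p] by (simp add: power2_eq_square)

lemma norm_mult_projection_le: "projection A p \<Longrightarrow> norm (x * p) \<le> norm x"
  using norm_mult_ineq[of x p] norm_projection_le[of p]
  by (meson mult_left_le norm_ge_zero order_trans)

text \<open>
  \<open>z z\<^sup>\<star>\<close> is the sum of the contributions of the two columns of \<open>z\<close>.
\<close>

lemma norm_split: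
  assumes p: "projection A p"
  shows "(norm z)\<^sup>2 \<le> (norm (z * p))\<^sup>2 + (norm (z - z * p))\<^sup>2"
proof -
  have pp: "z * p * p = z * p" for z using p by (simp add: projection_def mult.assoc)
  have adj: "(z * p)\<^sup>\<star> = p * z\<^sup>\<star>" using p by (simp add: projection_def star_mult)
  have "z * z\<^sup>\<star> = (z * p) * (z * p)\<^sup>\<star> + (z - z * p) * (z - z * p)\<^sup>\<star>"
    by (simp add: adj adj_diff algebra_simps pp flip: mult.assoc)
  then have "(norm z)\<^sup>2 = norm ((z * p) * (z * p)\<^sup>\<star> + (z - z * p) * (z - z * p)\<^sup>\<star>)"
    by (simp flip: cstar_identity')
  also have "\<dots> \<le> (norm (z * p))\<^sup>2 + (norm (z - z * p))\<^sup>2"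
    by (simp flip: cstar_identity' add: norm_triangle_ineq)
  finally show ?thesis .
qed

lemma column_inner_commute: "column_inner p x y = column_inner p y x"
  by (simp add: column_inner_def add.commute)

lemma norm_column_add:
  "(norm ((x + y) * p))\<^sup>2 = (norm (x * p))\<^sup>2 + 2 * column_inner p x y + (norm (y * p))\<^sup>2"
  by (simp add: column_inner_def field_simps)

context
  fixes p assumes p: "minimal_projection A p"
begin

lemma column_inner_eq:
  "(x * p)\<^sup>\<star> * (y * p) + (y * p)\<^sup>\<star> * (x * p) = (2 * column_inner p x y) *\<^sub>R p"
proof -
  have "(x * p)\<^sup>\<star> * (y * p) + (y * p)\<^sup>\<star> * (x * p)
      = ((x + y) * p)\<^sup>\<star> * ((x + y) * p) - (x * p)\<^sup>\<star> * (x * p) - (y * p)\<^sup>\<star> * (y * p)"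
    by (simp add: algebra_simps star_add)
  also have "\<dots> = (2 * column_inner p x y) *\<^sub>R p"
    by (simp add: minimal_projectionD[OF p] norm_column_add scaleR_add_left)
  finally show ?thesis .
qed

lemma column_inner_unique:
  assumes "(x * p)\<^sup>\<star> * (y * p) + (y * p)\<^sup>\<star> * (x * p) = (2 * t) *\<^sub>R p"
  shows "column_inner p x y = t"
  using assms minimal_projectionD(4)[OF p] by (simp add: column_inner_eq)

lemma mult_pp: "x * p * p = x * p"
  by (simp add: minimal_projectionD[OF p] mult.assoc)

lemma column_inner_mult_right: "column_inner p x (y * p) = column_inner p x y"
  by (simp add: column_inner_def distrib_right mult_pp)

lemma column_inner_mult_left: "column_inner p (x * p) y = column_inner p x y"
  by (simp add: column_inner_def distrib_right mult_pp)

lemma linear_column_inner: "linear (column_inner p x)"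
proof (rule linearI)
  fix y z :: 'a and r :: real
  have "(x * p)\<^sup>\<star> * ((y + z) * p) + ((y + z) * p)\<^sup>\<star> * (x * p)
    = ((x * p)\<^sup>\<star> * (y * p) + (y * p)\<^sup>\<star> * (x * p)) + ((x * p)\<^sup>\<star> * (z * p) + (z * p)\<^sup>\<star> * (x * p))"
    by (simp add: algebra_simps star_add)
  then show "column_inner p x (y + z) = column_inner p x y + column_inner p x z"
    by (intro column_inner_unique) (simp add: column_inner_eq algebra_simps)
  have "(x * p)\<^sup>\<star> * (r *\<^sub>R y * p) + (r *\<^sub>R y * p)\<^sup>\<star> * (x * p)
    = r *\<^sub>R ((x * p)\<^sup>\<star> * (y * p) + (y * p)\<^sup>\<star> * (x * p))"
    by (simp add: scaleR_add_right)
  then show "column_inner p x (r *\<^sub>R y) = r *\<^sub>R column_inner p x y"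
    by (intro column_inner_unique) (simp add: column_inner_eq)
qed

lemma column_inner_self: "column_inner p x x = (norm (x * p))\<^sup>2"
  by (rule column_inner_unique) (simp add: minimal_projectionD[OF p] flip: scaleR_add_left)

lemma column_inner_scal:
  assumes "c \<in> scalars A"
  shows "column_inner p (c \<cdot> x) y = column_inner p x (cnj c \<cdot> y)"
proof (rule column_inner_unique)
  have "((c \<cdot> x) * p)\<^sup>\<star> * (y * p) + (y * p)\<^sup>\<star> * ((c \<cdot> x) * p)
    = (x * p)\<^sup>\<star> * ((cnj c \<cdot> y) * p) + ((cnj c \<cdot> y) * p)\<^sup>\<star> * (x * p)"
    using assms by (simp add: smul_mult_left smul_mult_right star_smul)
  then show "((c \<cdot> x) * p)\<^sup>\<star> * (y * p) + (y * p)\<^sup>\<star> * ((c \<cdot> x) * p)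
    = (2 * column_inner p x (cnj c \<cdot> y)) *\<^sub>R p"
    by (simp add: column_inner_eq)
qed

lemma column_inner_imaginary: "\<i> \<in> scalars A \<Longrightarrow> column_inner p x (\<i> \<cdot> x) = 0"
  using column_inner_scal[of "\<i>" x x] column_inner_commute[of p "\<i> \<cdot> x" x]
  by (simp add: scal_minus_left linear_neg[OF linear_column_inner])

lemma column_decompose:
  assumes "u * p \<noteq> 0"
  shows "\<exists>c\<in>scalars A. \<forall>d\<in>scalars A. column_inner p u (d \<cdot> (w - c \<cdot> u)) = 0"
  using assms by (intro kernel_decompose linear_column_inner column_inner_imaginary)
    (simp add: column_inner_self)

lemma bj_orth_if_norm_attained:
  assumes "norm (v * p) = norm v" "\<And>d. d \<in> scalars A \<Longrightarrow> column_inner p v (d \<cdot> w) = 0"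
  shows "bj_orth A v w"
  unfolding bj_orth_def
proof
  fix c assume c: "c \<in> scalars A"
  have "(norm v)\<^sup>2 \<le> (norm ((v + c \<cdot> w) * p))\<^sup>2"
    using assms c by (simp add: norm_column_add)
  then have "norm v \<le> norm ((v + c \<cdot> w) * p)" by (rule power2_le_imp_le) simp
  also have "\<dots> \<le> norm (v + c \<cdot> w)"
    by (rule norm_mult_projection_le[OF minimal_projectionD(1)[OF p]])
  finally show "norm v \<le> norm (v + c \<cdot> w)" .
qed

text \<open>
  The entries of \<open>w\<close> outside the column of \<open>p\<close> influence the norm of \<open>u + t w\<close> only to second order in
  \<open>t\<close>, while the inner product is the derivative at \<open>t = 0\<close>.
\<close>

lemma column_bj_orth_iff:
  assumes u: "u * p = u"
  shows "bj_orth A u w \<longleftrightarrow> (\<forall>d\<in>scalars A. column_inner p u (d \<cdot> w) = 0)"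
proof
  assume orth: "bj_orth A u w"
  show "\<forall>d\<in>scalars A. column_inner p u (d \<cdot> w) = 0"
  proof
    fix d assume d: "d \<in> scalars A"
    define z where "z = d \<cdot> w"
    have "0 \<le> 2 * t * column_inner p u z + t\<^sup>2 * ((norm (z * p))\<^sup>2 + (norm (z - z * p))\<^sup>2)" for t
    proof -
      have "norm u \<le> norm (u + t *\<^sub>R z)"
        using bj_orthD[OF orth, of "of_real t * d"] d
        by (simp add: z_def flip: smul_smul smul_of_real)
      then have "(norm u)\<^sup>2 \<le> (norm (u + t *\<^sub>R z))\<^sup>2" by (simp add: power_mono)
      also have "\<dots> \<le> (norm ((u + t *\<^sub>R z) * p))\<^sup>2 + (norm ((u + t *\<^sub>R z) - (u + t *\<^sub>R z) * p))\<^sup>2"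
        by (rule norm_split[OF minimal_projectionD(1)[OF p]])
      also have "(u + t *\<^sub>R z) - (u + t *\<^sub>R z) * p = t *\<^sub>R (z - z * p)"
        by (simp add: algebra_simps u)
      finally show ?thesis
        by (simp add: norm_column_add u linear_scale[OF linear_column_inner] power_mult_distrib
            distrib_left mult.commute mult.left_commute)
    qed
    from zero_if_quadratic_nonneg[OF this] show "column_inner p u (d \<cdot> w) = 0"
      by (simp add: z_def)
  qed
next
  assume "\<forall>d\<in>scalars A. column_inner p u (d \<cdot> w) = 0"
  then show "bj_orth A u w" by (intro bj_orth_if_norm_attained) (simp_all add: u)
qed

lemma column_orth_set_subset:
  assumes eq: "norm (v * p) = norm v"
  shows "orth_set A (v * p) \<subseteq> orth_set A v"
proof
  fix w assume "w \<in> orth_set A (v * p)"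
  then have "\<forall>d\<in>scalars A. column_inner p v (d \<cdot> w) = 0"
    using column_bj_orth_iff[of "v * p"] by (simp add: mult_pp orth_set_def column_inner_mult_left)
  then show "w \<in> orth_set A v" using bj_orth_if_norm_attained[OF eq] by (simp add: orth_set_def)
qed

text \<open>
  Write \<open>w = c u + b\<close> with \<open>b\<close> in \<open>O(u)\<close>.  Then \<open>b\<close> is in \<open>O(w)\<close>, which bounds the norm of \<open>w\<close> by that of
  \<open>c u\<close>; by Pythagoras in the column of \<open>p\<close> nothing is left for \<open>b p\<close>.
\<close>

lemma column_component:
  assumes u: "u * p = u" "u \<noteq> 0" and sub: "orth_set A u \<subseteq> orth_set A w"
  shows "\<exists>c\<in>scalars A. w * p = c \<cdot> u \<and> norm (w * p) = norm w"
proof -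
  obtain c where c: "c \<in> scalars A"
    and b: "\<And>d. d \<in> scalars A \<Longrightarrow> column_inner p u (d \<cdot> (w - c \<cdot> u)) = 0"
    using column_decompose[of u w] u by auto
  define b where "b = w - c \<cdot> u"
  have "bj_orth A u b" using b by (simp add: column_bj_orth_iff[OF u(1)] b_def)
  then have "bj_orth A w b" using sub by (auto simp: orth_set_def)
  from bj_orthD[OF this, of "-1"] have le: "norm w \<le> norm (c \<cdot> u)"
    by (simp add: scal_uminus_one b_def)
  have "column_inner p (c \<cdot> u) b = 0"
    using b[of "cnj c"] c by (simp add: column_inner_scal b_def)
  then have "(norm (w * p))\<^sup>2 = (norm (c \<cdot> u))\<^sup>2 + (norm (b * p))\<^sup>2"
    using norm_column_add[of "c \<cdot> u" b p] c u by (simp add: b_def smul_mult_left)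
  moreover have "norm (w * p) \<le> norm w"
    by (rule norm_mult_projection_le[OF minimal_projectionD(1)[OF p]])
  then have wp: "(norm (w * p))\<^sup>2 \<le> (norm w)\<^sup>2" by (simp add: power_mono)
  moreover have "(norm w)\<^sup>2 \<le> (norm (c \<cdot> u))\<^sup>2" using le by (simp add: power_mono)
  ultimately have "(norm (b * p))\<^sup>2 \<le> 0" "(norm (w * p))\<^sup>2 = (norm w)\<^sup>2"
    by (smt (verit) zero_le_power2)+
  then have "w * p = c \<cdot> u" "norm (w * p) = norm w"
    using c u by (simp_all add: b_def algebra_simps smul_mult_left)
  then show ?thesis using c by blast
qed

text \<open>
  \<open>O(u)\<close> is a hyperplane, and \<open>O(v)\<close> together with the line through \<open>v\<close> fills the space for every
  \<open>v \<noteq> 0\<close>, so \<open>O(v)\<close> cannot be properly smaller.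
\<close>

lemma column_smooth:
  assumes u: "u * p = u" "u \<noteq> 0"
  shows "smooth A u"
  unfolding smooth_def
proof (intro conjI allI impI)
  show "u \<noteq> 0" by fact
  fix v assume v: "v \<noteq> 0" and sub: "orth_set A v \<subseteq> orth_set A u"
  have mem: "w \<in> orth_set A u \<longleftrightarrow> (\<forall>d\<in>scalars A. column_inner p u (d \<cdot> w) = 0)" for w
    by (simp add: orth_set_def column_bj_orth_iff[OF u(1)])
  have add: "x + y \<in> orth_set A u" if "x \<in> orth_set A u" "y \<in> orth_set A u" for x y
    using that by (simp add: mem smul_add_right linear_add[OF linear_column_inner])
  have scal: "c \<cdot> x \<in> orth_set A u" if "c \<in> scalars A" "x \<in> orth_set A u" for c x
    using that by (simp add: mem smul_smul)
  have v_notin: "v \<notin> orth_set A u"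
  proof
    assume v_in: "v \<in> orth_set A u"
    obtain c where c: "c \<in> scalars A" "bj_orth A v (u - c \<cdot> v)"
      using orth_decomposition[OF v] by blast
    then have "u - c \<cdot> v \<in> orth_set A u" using sub by (auto simp: orth_set_def)
    from add[OF this scal[OF c(1) v_in]] have "bj_orth A u u" by (simp add: orth_set_def)
    then show False using u by (simp add: bj_orth_self)
  qed
  have "w \<in> orth_set A v" if w: "w \<in> orth_set A u" for w
  proof -
    obtain c where c: "c \<in> scalars A" "bj_orth A v (w - c \<cdot> v)"
      using orth_decomposition[OF v] by blast
    then have "w - c \<cdot> v \<in> orth_set A u" using sub by (auto simp: orth_set_def)
    from add[OF w scal[OF _ this, of "-1"]] have cv: "c \<cdot> v \<in> orth_set A u"
      by (simp add: scal_uminus_one)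
    have "c = 0"
    proof (rule ccontr)
      assume "c \<noteq> 0"
      then have "v = (1 / c) \<cdot> (c \<cdot> v)" using c by (simp add: smul_smul)
      then show False using scal[OF _ cv, of "1 / c"] c v_notin by simp
    qed
    then show ?thesis using c by (simp add: orth_set_def)
  qed
  then show "orth_set A v = orth_set A u" using sub by blast
qed

text \<open>
  \<open>x + y\<close> is the midpoint of \<open>x\<close> and \<open>x + 2 y\<close> and has the same column as \<open>x\<close>.
\<close>

lemma orth_set_perturb:
  assumes x: "x * p = x" and y: "y * p = 0" and le: "norm (x + 2 *\<^sub>R y) \<le> norm x"
  shows "orth_set A (x + y) = orth_set A x"
proof
  have xyp: "(x + y) * p = x" by (simp add: distrib_right x y)
  have ge: "norm x \<le> norm (x + y)"
    using norm_mult_projection_le[OF minimal_projectionD(1)[OF p], of "x + y"] by (simp add: xyp)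
  show "orth_set A (x + y) \<subseteq> orth_set A x"
    using ge le by (intro orth_set_midpoint_subset[where w = "x + 2 *\<^sub>R y"])
      (simp_all add: algebra_simps scaleR_2)
  have "2 * norm (x + y) = norm (2 *\<^sub>R (x + y))" by simp
  also have "2 *\<^sub>R (x + y) = x + (x + 2 *\<^sub>R y)" by (simp add: scaleR_2)
  also have "norm \<dots> \<le> 2 * norm x" using norm_triangle_ineq[of x "x + 2 *\<^sub>R y"] le by simp
  finally have eq: "norm (x + y) = norm x" using ge by simp
  then show "orth_set A x \<subseteq> orth_set A (x + y)"
    using column_orth_set_subset[of "x + y"] by (simp add: xyp)
qed

end

end

section \<open>Real polynomials in an algebra element\<close>

text \<open>Evaluation at \<open>h\<close> in an algebra without a global unit: \<open>p\<close> takes the place of \<open>1\<close>.\<close>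

definition poly_at :: "'a::real_algebra \<Rightarrow> 'a \<Rightarrow> real poly \<Rightarrow> 'a" where
  "poly_at p h q = fold_coeffs (\<lambda>a x. a *\<^sub>R p + h * x) q 0"

lemma poly_at_0 [simp]: "poly_at p h 0 = 0"
  by (simp add: poly_at_def)

lemma poly_at_pCons [simp]: "poly_at p h (pCons a q) = a *\<^sub>R p + h * poly_at p h q"
  by (cases "a = 0 \<and> q = 0") (auto simp: poly_at_def)

lemma poly_at_add: "poly_at p h (q + r) = poly_at p h q + poly_at p h r"
proof (induct q arbitrary: r)
  case (pCons a q)
  show ?case
    by (cases r) (simp add: pCons(2) distrib_left scaleR_add_left)
qed simp

lemma poly_at_smult: "poly_at p h (smult c q) = c *\<^sub>R poly_at p h q"
  by (induct q) (simp_all add: scaleR_add_right)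

lemma poly_at_sum: "poly_at p h (\<Sum>i\<in>I. q i) = (\<Sum>i\<in>I. poly_at p h (q i))"
  by (induct I rule: infinite_finite_induct) (simp_all add: poly_at_add)

lemma poly_at_corner:
  assumes "p * p = p" "p * h = h" "h * p = h"
  shows "p * poly_at p h q = poly_at p h q" "poly_at p h q * p = poly_at p h q"
  using assms by (induct q) (simp_all add: distrib_left distrib_right mult.assoc flip: mult.assoc[of p])

lemma poly_at_mult:
  assumes "p * p = p" "p * h = h" "h * p = h"
  shows "poly_at p h (q * r) = poly_at p h q * poly_at p h r"
proof (induct q)
  case (pCons a q)
  then show ?case
    by (simp add: poly_at_add poly_at_smult distrib_right poly_at_corner[OF assms] mult.assoc)
qed simp

text \<open>
  Otherwise the powers of \<open>h\<close> would be linearly independent.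
\<close>

lemma poly_at_annihilated:
  fixes B :: "'a::real_algebra set"
  assumes B: "finite B" "span B = UNIV"
  shows "\<exists>q. q \<noteq> 0 \<and> poly_at p (h::'a) q = 0"
proof (rule ccontr)
  assume contra: "\<nexists>q. q \<noteq> 0 \<and> poly_at p h q = 0"
  define pw where "pw i = poly_at p h (monom 1 i)" for i
  have inj: "inj pw"
  proof (rule injI)
    fix i j assume "pw i = pw j"
    then have "poly_at p h (monom 1 i + smult (-1) (monom 1 j)) = 0"
      by (simp only: poly_at_add poly_at_smult pw_def) simp
    then have "monom 1 i + smult (-1) (monom 1 j) = (0 :: real poly)" using contra by blast
    then show "i = j" by (simp add: monom_eq_iff')
  qed
  have "independent (pw ` {..card B})"
  proof (rule independent_if_scalars_zero)
    show "finite (pw ` {..card B})" by simp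
    fix f x assume sum: "(\<Sum>x\<in>pw ` {..card B}. f x *\<^sub>R x) = 0" and "x \<in> pw ` {..card B}"
    then obtain k where k: "k \<le> card B" "x = pw k" by auto
    define q where "q = (\<Sum>i\<le>card B. smult (f (pw i)) (monom 1 i))"
    have "poly_at p h q = (\<Sum>i\<le>card B. f (pw i) *\<^sub>R pw i)"
      by (simp add: q_def poly_at_sum poly_at_smult pw_def)
    also have "\<dots> = 0"
      using sum inj by (simp add: sum.reindex inj_on_def inj_def)
    finally have "q = 0" using contra by blast
    then have "coeff q k = 0" by simp
    then show "f x = 0" using k
      by (simp add: q_def coeff_sum smult_monom coeff_monom)
  qed
  then have "card (pw ` {..card B}) \<le> card B"
    using independent_span_bound[of B "pw ` {..card B}"] B by simp
  then show False using inj by (simp add: card_image inj_on_def inj_def)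
qed

lemma map_poly_of_real_mult:
  "map_poly complex_of_real (q * r) = map_poly of_real q * map_poly of_real r"
  by (rule poly_eqI) (simp add: coeff_map_poly coeff_mult)

lemma map_poly_of_real_add:
  "map_poly complex_of_real (q + r) = map_poly of_real q + map_poly of_real r"
  by (rule poly_eqI) (simp add: coeff_map_poly)

lemma real_poly_factor:
  fixes q :: "real poly"
  assumes "degree q > 0"
  obtains a s where "q = [:- a, 1:] * s"
  | a b s where "q = [:a\<^sup>2 + b\<^sup>2, - 2 * a, 1:] * s"
proof -
  define e where "e r z = poly (map_poly complex_of_real r) z" for r z
  have "degree (map_poly complex_of_real q) > 0" using assms by (simp add: degree_map_poly)
  then obtain z where z: "e q z = 0"
    using fundamental_theorem_of_algebra[of "map_poly complex_of_real q"]
    by (auto simp: constant_degree e_def)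
  define a b where "a = Re z" and "b = Im z"
  have zab: "z = Complex a b" by (simp add: a_def b_def)
  show thesis
  proof (cases "b = 0")
    case True
    then have "z = of_real a" by (simp add: zab complex_eq_iff)
    then have "complex_of_real (poly q a) = 0"
      using z by (simp add: e_def poly_altdef degree_map_poly coeff_map_poly)
    then have "poly q a = 0" by simp
    then show thesis using that(1) by (auto simp: poly_eq_0_iff_dvd elim!: dvdE)
  next
    case False
    define Q where "Q = [:a\<^sup>2 + b\<^sup>2, - 2 * a, 1:]"
    define r where "r = q mod Q"
    have "degree r < 2" using degree_mod_less'[of Q q] by (cases "r = 0") (auto simp: r_def Q_def)
    then have r: "r = [:coeff r 0, coeff r 1:]"
      by (intro poly_eqI) (auto simp: coeff_pCons coeff_eq_0 split: nat.split)
    have "e Q z = 0"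
      by (simp add: e_def Q_def map_poly_pCons zab complex_eq_iff power2_eq_square)
    moreover have "q = Q * (q div Q) + r" by (simp add: r_def)
    then have "e q z = e Q z * e (q div Q) z + e r z"
      unfolding e_def by (metis map_poly_of_real_mult map_poly_of_real_add poly_add poly_mult)
    ultimately have "e r z = 0" using z by simp
    then have "of_real (coeff r 0) + z * of_real (coeff r 1) = 0"
      unfolding e_def by (subst (asm) r) (simp add: map_poly_pCons)
    then have "coeff r 1 = 0" "coeff r 0 = 0" using False by (auto simp: zab complex_eq_iff)
    then have "r = 0" by (subst r) simp
    then have "q = Q * (q div Q)" using \<open>q = Q * (q div Q) + r\<close> by simp
    then show thesis using that(2) unfolding Q_def by blast
  qed
qed

text \<open>
  \<open>h\<close> is a root of a real polynomial, hence, without zero divisors, of an irreducible one, which has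
  degree at most two.
\<close>

lemma shifted_square_nonpos:
  fixes p h :: "'a::real_algebra"
  assumes fin: "finite (B :: 'a set)" "span B = UNIV"
    and p: "p \<noteq> 0" "p * p = p" and h: "p * h = h" "h * p = h"
    and nz: "\<And>x y. p * x = x \<Longrightarrow> x * p = x \<Longrightarrow> p * y = y \<Longrightarrow> y * p = y \<Longrightarrow> x * y = 0 \<Longrightarrow>
      x = 0 \<or> y = 0"
  shows "\<exists>a b. (h - a *\<^sub>R p) * (h - a *\<^sub>R p) = - (b\<^sup>2 *\<^sub>R p)"
proof -
  note corner = poly_at_corner[OF p(2) h]
  have nz': "poly_at p h q = 0 \<or> poly_at p h r = 0" if "poly_at p h (q * r) = 0" for q r
    using that by (intro nz corner) (simp add: poly_at_mult[OF p(2) h])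
  have "\<exists>a b. (h - a *\<^sub>R p) * (h - a *\<^sub>R p) = - (b\<^sup>2 *\<^sub>R p)"
    if "q \<noteq> 0" "poly_at p h q = 0" for q
    using that
  proof (induct "degree q" arbitrary: q rule: less_induct)
    case less
    have "degree q > 0"
    proof (rule ccontr)
      assume "\<not> degree q > 0"
      then obtain c where "q = [:c:]" by (metis degree_eq_zeroE neq0_conv)
      then show False using less.prems p by simp
    qed
    then show ?case
    proof (cases q rule: real_poly_factor)
      case (1 a s)
      then have "s \<noteq> 0" using less.prems by auto
      then have "degree s < degree q"
        using degree_mult_eq[of "[:- a, 1:]" s] 1 by (simp del: mult_pCons_left)
      moreover from 1 have "poly_at p h [:- a, 1:] = 0 \<or> poly_at p h s = 0"
        using nz' less.prems by blast
      moreover have "?thesis" if "poly_at p h [:- a, 1:] = 0"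
        using that h by (intro exI[of _ a] exI[of _ "0::real"]) simp
      ultimately show ?thesis using less.hyps[of s] \<open>s \<noteq> 0\<close> by blast
    next
      case (2 a b s)
      then have "s \<noteq> 0" using less.prems by auto
      then have "degree s < degree q"
        using degree_mult_eq[of "[:a\<^sup>2 + b\<^sup>2, - 2 * a, 1:]" s] 2 by (simp del: mult_pCons_left)
      moreover from 2 have "poly_at p h [:a\<^sup>2 + b\<^sup>2, - 2 * a, 1:] = 0 \<or> poly_at p h s = 0"
        using nz' less.prems by blast
      moreover have "?thesis" if zero: "poly_at p h [:a\<^sup>2 + b\<^sup>2, - 2 * a, 1:] = 0"
      proof (intro exI)
        have "(h - a *\<^sub>R p) * (h - a *\<^sub>R p) = (a\<^sup>2) *\<^sub>R p + h * ((- 2 * a) *\<^sub>R p + h * p)"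
          using h p by (simp add: algebra_simps power2_eq_square)
            (simp flip: scaleR_add_left)
        then show "(h - a *\<^sub>R p) * (h - a *\<^sub>R p) = - (b\<^sup>2 *\<^sub>R p)"
          using zero by (simp add: scaleR_add_left eq_neg_iff_add_eq_0 add_ac)
      qed
      ultimately show ?thesis using less.hyps[of s] \<open>s \<noteq> 0\<close> by blast
    qed
  qed
  then show ?thesis using poly_at_annihilated[OF fin, of p h] by blast
qed

text \<open>
  The descending chain condition, which stands in for inductions on the dimension.
\<close>

lemma minimal_subspace:
  fixes B :: "'a::real_vector set" and \<S> :: "'a set set"
  assumes B: "finite B" "span B = UNIV"
    and "S0 \<in> \<S>" and sub: "\<And>S. S \<in> \<S> \<Longrightarrow> subspace S"
  obtains S where "S \<in> \<S>" "\<And>T. T \<in> \<S> \<Longrightarrow> T \<subseteq> S \<Longrightarrow> T = S"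
proof -
  obtain S where S: "S \<in> \<S>" and min: "\<And>T. T \<in> \<S> \<Longrightarrow> dim S \<le> dim T"
    using ex_has_least_nat[of "\<lambda>S. S \<in> \<S>" S0 dim] \<open>S0 \<in> \<S>\<close> by blast
  have "T = S" if T: "T \<in> \<S>" "T \<subseteq> S" for T
  proof (rule ccontr)
    assume "T \<noteq> S"
    then obtain x where x: "x \<in> S" "x \<notin> T" using T by blast
    obtain I where I: "I \<subseteq> T" "independent I" "T \<subseteq> span I" "card I = dim T"
      by (rule basis_exists)
    have "span I \<subseteq> T" using I(1) sub[OF T(1)] by (simp add: span_minimal)
    then have "x \<notin> span I" using x by blast
    then have ind: "independent (insert x I)" using I(2) by (rule independent_insertI)
    have "finite I" using independent_span_bound[OF B(1) I(2)] B(2) by simp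
    have "x \<notin> I" using \<open>x \<notin> span I\<close> span_base by blast
    obtain J where J: "J \<subseteq> S" "independent J" "S \<subseteq> span J" "card J = dim S"
      by (rule basis_exists)
    have "finite J" using independent_span_bound[OF B(1) J(2)] B(2) by simp
    have "insert x I \<subseteq> span J" using I(1) T(2) x(1) J(3) by blast
    from independent_span_bound[OF \<open>finite J\<close> ind this]
    have "Suc (card I) \<le> card J" using \<open>finite I\<close> \<open>x \<notin> I\<close> by simp
    then show False using min[OF T(1)] I(4) J(4) by simp
  qed
  then show thesis using S that by blast
qed

section \<open>Minimal projections in finite dimension\<close>

definition right_ideal :: "'a::real_normed_algebra set \<Rightarrow> bool" where
  "right_ideal R \<longleftrightarrow> subspace R \<and> (\<forall>x\<in>R. \<forall>a. x * a \<in> R)"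

lemma right_ideal_image:
  assumes "right_ideal R"
  shows "right_ideal ((*) y ` R)"
proof -
  have "linear ((*) y)" by (rule linearI) (simp_all add: distrib_left)
  then have "subspace ((*) y ` R)"
    using assms linear_subspace_image[of "(*) y" R] by (simp add: right_ideal_def)
  then show ?thesis using assms by (auto simp: right_ideal_def mult.assoc)
qed

lemma right_ideal_annihilator:
  assumes "right_ideal R"
  shows "right_ideal {r \<in> R. y * r = 0}"
  using assms
  by (auto simp: right_ideal_def subspace_def distrib_left simp flip: mult.assoc)

context cstar_algebra
begin

lemma adj_sum: "(\<Sum>i\<in>I. f i)\<^sup>\<star> = (\<Sum>i\<in>I. (f i)\<^sup>\<star>)"
  by (induct I rule: infinite_finite_induct) (simp_all add: star_add)

lemma projectionD: "projection A p \<Longrightarrow> p\<^sup>\<star> = p" "projection A p \<Longrightarrow> p * p = p"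
  by (simp_all add: projection_def)

text \<open>
  Over the reals this is excluded by the axiom \<open>symmetric\<close>.  Over the complex numbers
  \<open>(w + \<i> r)\<^sup>\<star> (w + \<i> r) = w\<^sup>2 + r = 0\<close>, so that \<open>w = - \<i> r\<close> is not self-adjoint unless \<open>r = 0\<close>.
\<close>

lemma selfadjoint_square_neq_minus_projection:
  assumes w: "w\<^sup>\<star> = w" "w * r = w" "w * w = - r" and r: "projection A r"
  shows "r = 0"
proof (cases rule: scalar_cases)
  case real
  obtain y where y: "w\<^sup>\<star> * w + y + w\<^sup>\<star> * w * y = 0" using symmetric[OF real(1), of w] by blast
  have "r * (w\<^sup>\<star> * w + y + w\<^sup>\<star> * w * y) = - r"
    using w projectionD[OF r]
    by (simp add: distrib_left right_diff_distrib flip: mult.assoc)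
  then show ?thesis using y by simp
next
  case complex
  have rw: "r * w = w" using w(1,2) projectionD(1)[OF r] star_mult[of w r] by simp
  have i: "(\<i> \<cdot> r)\<^sup>\<star> = - (\<i> \<cdot> r)"
    using complex projectionD(1)[OF r] by (simp add: star_smul scal_minus_left)
  have "(w + \<i> \<cdot> r)\<^sup>\<star> * (w + \<i> \<cdot> r) = 0"
    using complex w rw projectionD(2)[OF r]
    by (simp add: star_add i algebra_simps smul_mult_left smul_mult_right smul_smul scal_uminus_one)
  then have "w = - (\<i> \<cdot> r)" by (simp add: adj_mult_self_eq_0 eq_neg_iff_add_eq_0)
  moreover from this have "w = \<i> \<cdot> r" using w(1) i by simp
  ultimately have "\<i> \<cdot> r = 0" by (metis equal_neg_zero real_vector.scale_eq_0_iff
        scaleR_2 add_eq_0_iff zero_neq_numeral)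
  then show ?thesis using complex by (simp add: scal_eq_0)
qed

text \<open>
  The positivity of \<open>x\<^sup>\<star> x\<close> in a special case.  Over the complex numbers \<open>x\<close> is first made
  off-diagonal with respect to \<open>p\<close>; then a multiple of \<open>x + x\<^sup>\<star>\<close> is self-adjoint and squares to the
  negative of a projection.
\<close>

lemma adj_mult_self_neq_minus_projection:
  assumes p: "projection A p"
    and sa: "\<And>h. h\<^sup>\<star> = h \<Longrightarrow> p * h = h \<Longrightarrow> h * p = h \<Longrightarrow> \<exists>t. h = t *\<^sub>R p"
    and x: "x * p = x" "x\<^sup>\<star> * x = - p"
  shows "p = 0"
proof (cases rule: scalar_cases)
  case real
  obtain y where y: "x\<^sup>\<star> * x + y + x\<^sup>\<star> * x * y = 0" using symmetric[OF real(1), of x] by blast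
  have "p * (x\<^sup>\<star> * x + y + x\<^sup>\<star> * x * y) = - p"
    using x projectionD[OF p]
    by (simp add: distrib_left right_diff_distrib flip: mult.assoc)
  then show ?thesis using y by simp
next
  case complex
  note pD = projectionD[OF p]
  have pp: "a * p * p = a * p" for a by (simp add: mult.assoc pD)
  have px: "p * (p * a) = p * a" for a by (simp add: pD flip: mult.assoc)
  have px': "p * x\<^sup>\<star> = x\<^sup>\<star>" using x(1) pD(1) star_mult[of x p] by simp
  define y where "y = p * x"
  have py: "p * y = y" and yp: "y * p = y" using x by (simp_all add: y_def px mult.assoc)
  have py': "p * y\<^sup>\<star> = y\<^sup>\<star>" and yp': "y\<^sup>\<star> * p = y\<^sup>\<star>"
    using arg_cong[OF yp, of "star A"] arg_cong[OF py, of "star A"] pD(1) by (simp_all add: star_mult)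
  \<comment> \<open>The corner \<open>p A p\<close> consists of complex multiples of \<open>p\<close>, so the claim is clear for \<open>y\<close>.\<close>
  obtain a where a: "y + y\<^sup>\<star> = a *\<^sub>R p"
    using sa[of "y + y\<^sup>\<star>"] py yp py' yp'
    by (auto simp: star_add star_star add.commute distrib_left distrib_right)
  have "(\<i> \<cdot> (y - y\<^sup>\<star>))\<^sup>\<star> = \<i> \<cdot> (y - y\<^sup>\<star>)"
    using complex by (simp add: star_smul adj_diff star_star scal_minus_left scal_diff_right)
  then obtain b where b: "\<i> \<cdot> (y - y\<^sup>\<star>) = b *\<^sub>R p"
    using sa[of "\<i> \<cdot> (y - y\<^sup>\<star>)"] py yp py' yp' complex
    by (auto simp: smul_mult_left smul_mult_right left_diff_distrib right_diff_distrib)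
  have "y - y\<^sup>\<star> = (- \<i>) \<cdot> (\<i> \<cdot> (y - y\<^sup>\<star>))" using complex by (simp add: smul_smul)
  also have "\<dots> = (- \<i> * of_real b) \<cdot> p" using complex by (simp add: b smul_smul flip: smul_of_real)
  finally have d: "y - y\<^sup>\<star> = (- \<i> * of_real b) \<cdot> p" .
  have "2 *\<^sub>R y = (y + y\<^sup>\<star>) + (y - y\<^sup>\<star>)" by (simp add: scaleR_2)
  also have "\<dots> = a *\<^sub>R p + (- \<i> * of_real b) \<cdot> p" by (simp only: a d)
  also have "\<dots> = (of_real a - \<i> * of_real b) \<cdot> p"
    using complex smul_add_left[of "of_real a" "- \<i> * of_real b" p] by (simp add: smul_of_real)
  finally have "(1/2) *\<^sub>R (2 *\<^sub>R y) = (1/2) *\<^sub>R ((of_real a - \<i> * of_real b) \<cdot> p)" by simp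
  then have "y = of_real (1/2) \<cdot> (of_real a - \<i> * of_real b) \<cdot> p"
    by (simp only: smul_of_real) simp
  then obtain c where c: "y = c \<cdot> p"
    using smul_smul[of "of_real (1/2)" "of_real a - \<i> * of_real b" p] complex
    by (metis UNIV_I)
  define m where "m = 1 + (cmod c)\<^sup>2"
  have m: "m > 0" by (simp add: m_def add_pos_nonneg)
  have yy: "y\<^sup>\<star> * y = (cmod c)\<^sup>2 *\<^sub>R p"
  proof -
    have "y\<^sup>\<star> * y = (cnj c * c) \<cdot> p"
      using complex by (simp add: c star_smul smul_mult_left smul_mult_right smul_smul pD mult.commute)
    also have "cnj c * c = of_real ((cmod c)\<^sup>2)" by (simp only: complex_norm_square mult.commute[of "cnj c"])
    finally show ?thesis by (simp only: smul_of_real)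
  qed
  define z where "z = x - y"
  have pz: "p * z = 0" by (simp add: z_def y_def right_diff_distrib px)
  have zp: "z * p = z" using x yp by (simp add: z_def left_diff_distrib)
  have zp': "z\<^sup>\<star> * p = 0" and pz': "p * z\<^sup>\<star> = z\<^sup>\<star>"
    using arg_cong[OF pz, of "star A"] arg_cong[OF zp, of "star A"] by (simp_all add: star_mult pD)
  have "x\<^sup>\<star> * y = y\<^sup>\<star> * y" using pD by (simp add: y_def star_mult mult.assoc px)
  moreover have "y\<^sup>\<star> * x = y\<^sup>\<star> * y" using pD by (simp add: y_def star_mult mult.assoc px)
  ultimately have "z\<^sup>\<star> * z = x\<^sup>\<star> * x - y\<^sup>\<star> * y"
    by (simp add: z_def adj_diff algebra_simps)
  then have zz: "z\<^sup>\<star> * z = - (m *\<^sub>R p)" by (simp add: x yy m_def scaleR_add_left)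
  have z2: "z * z = 0" by (metis zp pz mult.assoc mult_zero_right)
  then have z2': "z\<^sup>\<star> * z\<^sup>\<star> = 0" by (simp flip: star_mult)
  \<comment> \<open>\<open>z\<close> and its adjoint span an algebra of two-by-two matrices with an indefinite involution.\<close>
  define q where "q = - ((1 / m) *\<^sub>R (z * z\<^sup>\<star>))"
  have zzz: "z * (z\<^sup>\<star> * z) = - (m *\<^sub>R z)" "z\<^sup>\<star> * z * z\<^sup>\<star> = - (m *\<^sub>R z\<^sup>\<star>)"
    by (simp_all add: zz zp pz')
  have qz: "q * z = z" and zq: "z\<^sup>\<star> * q = z\<^sup>\<star>"
    using m zzz by (simp_all add: q_def mult.assoc[of z] flip: mult.assoc[of "z\<^sup>\<star>"])
  have qz': "q * z\<^sup>\<star> = 0" and zq': "z * q = 0"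
    by (simp_all add: q_def mult.assoc z2', simp add: z2 flip: mult.assoc)
  have qadj: "q\<^sup>\<star> = q" by (simp add: q_def star_mult star_star)
  have qq: "q * q = q"
  proof -
    have "q * (z * z\<^sup>\<star>) = z * z\<^sup>\<star>" by (simp add: qz flip: mult.assoc)
    then have "q * (- ((1 / m) *\<^sub>R (z * z\<^sup>\<star>))) = - ((1 / m) *\<^sub>R (z * z\<^sup>\<star>))" by simp
    then show ?thesis by (simp only: q_def[symmetric])
  qed
  have pq: "p * q = 0" "q * p = 0"
    by (simp add: q_def pz flip: mult.assoc, simp add: q_def zp' mult.assoc)
  define r where "r = p + q"
  define w where "w = (1 / sqrt m) *\<^sub>R (z + z\<^sup>\<star>)"
  have "projection A r"
    by (simp add: projection_def r_def star_add qadj pD algebra_simps qq pq)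
  moreover have "w\<^sup>\<star> = w" by (simp add: w_def star_add star_star add.commute)
  moreover have "w * r = w"
    by (simp add: w_def r_def distrib_left distrib_right zp zp' zq zq' scaleR_add_right)
  moreover have "w * w = - r"
  proof -
    have "(z + z\<^sup>\<star>) * (z + z\<^sup>\<star>) = z * z\<^sup>\<star> + z\<^sup>\<star> * z"
      by (simp add: distrib_left distrib_right z2 z2' add.commute)
    then have "w * w = (1 / m) *\<^sub>R (z * z\<^sup>\<star> + z\<^sup>\<star> * z)" using m by (simp add: w_def)
    also have "\<dots> = - r" using m by (simp add: zz r_def q_def scaleR_diff_right)
    finally show ?thesis .
  qed
  ultimately have "r = 0" by (intro selfadjoint_square_neq_minus_projection)
  then have "p * r = 0" by simp
  then show ?thesis by (simp add: r_def distrib_left pq pD)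
qed

lemma minimal_projection_if_real_corner:
  assumes p: "projection A p" "p \<noteq> 0"
    and sa: "\<And>h. h\<^sup>\<star> = h \<Longrightarrow> p * h = h \<Longrightarrow> h * p = h \<Longrightarrow> \<exists>t. h = t *\<^sub>R p"
  shows "minimal_projection A p"
  unfolding minimal_projection_def
proof (intro conjI allI p)
  fix a
  define x where "x = a * p"
  have xp: "x * p = x" using projectionD(2)[OF p(1)] by (simp add: x_def mult.assoc)
  have px: "p * x\<^sup>\<star> = x\<^sup>\<star>" using xp projectionD(1)[OF p(1)] star_mult[of x p] by simp
  obtain t where t: "x\<^sup>\<star> * x = t *\<^sub>R p"
    using sa[of "x\<^sup>\<star> * x"] xp px by (auto simp: star_mult star_star mult.assoc)
      (metis mult.assoc)
  have "norm p = 1"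
    using cstar_identity[of p] projectionD[OF p(1)] p(2) by (simp add: power2_eq_square)
  then have abs_t: "(norm x)\<^sup>2 = \<bar>t\<bar>" using cstar_identity[of x] t by simp
  have "t \<ge> 0"
  proof (rule ccontr)
    assume "\<not> t \<ge> 0"
    then have t_neg: "t < 0" by simp
    define y where "y = (1 / sqrt (- t)) *\<^sub>R x"
    have "y\<^sup>\<star> * y = - p" using t_neg by (simp add: y_def t real_sqrt_mult_self field_simps)
    moreover have "y * p = y" by (simp add: y_def xp)
    ultimately show False using adj_mult_self_neq_minus_projection[OF p(1) sa] p(2) by blast
  qed
  then show "(a * p)\<^sup>\<star> * (a * p) = (norm (a * p))\<^sup>2 *\<^sub>R p"
    using t abs_t by (simp flip: x_def)
qed

text \<open>
  Brauer's lemma with an involution.  For a nonzero \<open>x\<close> in a minimal right ideal \<open>R\<close>, multiplication by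
  \<open>h = x x\<^sup>\<star>\<close> is a bijection of \<open>R\<close>, and the solution \<open>p\<close> of \<open>h p = h\<close> is a left unit of \<open>R\<close>.  Minimality
  of \<open>R\<close> makes \<open>p A p\<close> a skew-field, whose self-adjoint elements are real multiples of \<open>p\<close> by
  \<open>shifted_square_nonpos\<close>.
\<close>

lemma minimal_projection_in_right_ideal:
  assumes fin: "finite (B :: 'a set)" "span B = UNIV" and N: "right_ideal N" "N \<noteq> {0}"
  shows "\<exists>p\<in>N. minimal_projection A p"
proof -
  obtain R where R: "right_ideal R" "R \<subseteq> N" "R \<noteq> {0}"
    and Rmin: "\<And>T. right_ideal T \<Longrightarrow> T \<subseteq> R \<Longrightarrow> T = {0} \<or> T = R"
  proof -
    let ?S = "{R. right_ideal R \<and> R \<subseteq> N \<and> R \<noteq> {0}}"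
    obtain R where "R \<in> ?S" "\<And>T. T \<in> ?S \<Longrightarrow> T \<subseteq> R \<Longrightarrow> T = R"
      by (rule minimal_subspace[OF fin, of N ?S]) (use N in \<open>auto simp: right_ideal_def\<close>)
    then show thesis using that[of R] by blast
  qed
  have mult_R: "r * a \<in> R" if "r \<in> R" for r a using R(1) that by (simp add: right_ideal_def)
  have sub_R: "subspace R" using R(1) by (simp add: right_ideal_def)
  obtain x where x: "x \<in> R" "x \<noteq> 0" using R(3) subspace_0[OF sub_R] by blast
  define h where "h = x * x\<^sup>\<star>"
  have h: "h \<in> R" "h\<^sup>\<star> = h" using x mult_R by (simp_all add: h_def star_mult star_star)
  have "h \<noteq> 0" using x by (simp add: h_def mult_adj_self_eq_0)
  then have hh: "h * h \<noteq> 0" using adj_mult_self_eq_0[of h] h by simp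
  have img: "(*) y ` R = R" if "y \<in> R" "r \<in> R" "y * r \<noteq> 0" for y r
  proof -
    have "(*) y ` R \<subseteq> R" using that mult_R by blast
    moreover have "(*) y ` R \<noteq> {0}" using that by blast
    ultimately show ?thesis using Rmin[OF right_ideal_image[OF R(1)]] by blast
  qed
  have hR: "(*) h ` R = R" using img[OF h(1) h(1) hh] .
  then obtain p where p: "p \<in> R" "h * p = h" using h(1) by (metis imageE)
  have "{r \<in> R. h * r = 0} = {0}"
    using Rmin[OF right_ideal_annihilator[OF R(1), of h]] h(1) hh by blast
  then have cancel: "r = 0" if "r \<in> R" "h * r = 0" for r using that by blast
  have pr: "p * r = r" if "r \<in> R" for r
  proof -
    have "p * r - r \<in> R" using that p mult_R sub_R by (simp add: subspace_diff)
    moreover have "h * (p * r - r) = 0" using p by (simp add: right_diff_distrib flip: mult.assoc)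
    ultimately show ?thesis using cancel by fastforce
  qed
  obtain a where a: "p = h * a" using p(1) hR by (metis imageE)
  have "p\<^sup>\<star> * h = h" using arg_cong[OF p(2), of "star A"] h by (simp add: star_mult)
  then have "p\<^sup>\<star> * (h * a) = h * a" by (simp flip: mult.assoc)
  then have pp: "p\<^sup>\<star> * p = p" by (simp only: a[symmetric])
  have "(p\<^sup>\<star> * p)\<^sup>\<star> = p\<^sup>\<star> * p" by (simp only: star_mult star_star)
  then have "p\<^sup>\<star> = p" by (simp only: pp)
  then have proj: "projection A p" using pp by (simp add: projection_def)
  have p0: "p \<noteq> 0" using p \<open>h \<noteq> 0\<close> by auto
  have nz: "y = 0 \<or> z = 0" if "p * y = y" "y * p = y" "p * z = z" "z * p = z" "y * z = 0" for y z
  proof (rule ccontr)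
    assume "\<not> (y = 0 \<or> z = 0)"
    moreover have "z \<in> R" using mult_R[OF p(1), of z] that by simp
    ultimately have "(*) z ` R = R" using img[of z p] p that by simp
    then obtain r where "z * r = p" using p(1) by (metis imageE)
    then have "y * z * r = y" using that(2) by (simp only: mult.assoc)
    then show False using that(5) \<open>\<not> (y = 0 \<or> z = 0)\<close> by simp
  qed
  have "minimal_projection A p"
  proof (rule minimal_projection_if_real_corner[OF proj p0])
    fix h assume h: "h\<^sup>\<star> = h" "p * h = h" "h * p = h"
    obtain a b where ab: "(h - a *\<^sub>R p) * (h - a *\<^sub>R p) = - (b\<^sup>2 *\<^sub>R p)"
      using shifted_square_nonpos[OF fin p0 projectionD(2)[OF proj] h(2,3) nz] by blast
    define w where "w = h - a *\<^sub>R p"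
    have w: "w\<^sup>\<star> = w" "w * p = w"
      using h projectionD[OF proj] by (simp_all add: w_def adj_diff left_diff_distrib)
    have "b = 0"
    proof (rule ccontr)
      assume "b \<noteq> 0"
      then have "((1 / b) *\<^sub>R w) * ((1 / b) *\<^sub>R w) = - p"
        using ab by (simp add: power2_eq_square flip: w_def)
      then have "p = 0"
        by (rule selfadjoint_square_neq_minus_projection[OF _ _ _ proj, rotated 2]) (simp_all add: w)
      then show False using p0 by simp
    qed
    then have "w\<^sup>\<star> * w = 0" using ab w by (simp flip: w_def)
    then show "\<exists>t. h = t *\<^sub>R p" by (auto simp: adj_mult_self_eq_0 w_def)
  qed
  then show ?thesis using p(1) R(2) by blast
qed

text \<open>
  Take an orthogonal family of minimal projections whose right annihilator is as small as possible.
  Were the annihilator nonzero, it would contain one more minimal projection.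
\<close>

lemma projection_decomposition:
  assumes fin: "finite (B :: 'a set)" "span B = UNIV"
  obtains P where "finite P" "\<And>p. p \<in> P \<Longrightarrow> minimal_projection A p"
    "\<And>p q. p \<in> P \<Longrightarrow> q \<in> P \<Longrightarrow> p \<noteq> q \<Longrightarrow> p * q = 0" "\<And>x. (\<Sum>p\<in>P. x * p) = x"
proof -
  define F where "F = {P. finite P \<and> (\<forall>p\<in>P. minimal_projection A p) \<and>
    (\<forall>p\<in>P. \<forall>q\<in>P. p \<noteq> q \<longrightarrow> p * q = 0)}"
  define N where "N P = {x. \<forall>p\<in>P. p * x = 0}" for P :: "'a set"
  have ideal: "right_ideal (N P)" for P
    by (auto simp: right_ideal_def N_def subspace_def distrib_left simp flip: mult.assoc)
  have "{} \<in> F" by (simp add: F_def)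
  obtain S where "S \<in> N ` F" and min: "\<And>T. T \<in> N ` F \<Longrightarrow> T \<subseteq> S \<Longrightarrow> T = S"
    by (rule minimal_subspace[OF fin, of "N {}" "N ` F"])
      (use \<open>{} \<in> F\<close> ideal in \<open>auto simp: right_ideal_def\<close>)
  then obtain P where P: "P \<in> F" and S: "S = N P" by blast
  have "N P = {0}"
  proof (rule ccontr)
    assume "N P \<noteq> {0}"
    then obtain p where p: "p \<in> N P" "minimal_projection A p"
      using minimal_projection_in_right_ideal[OF fin ideal] by blast
    have qp: "q * p = 0" if "q \<in> P" for q using p that by (simp add: N_def)
    have pq: "p * q = 0" if "q \<in> P" for q
      using arg_cong[OF qp[OF that], of "star A"] minimal_projectionD(2) p(2) P that
      by (simp add: star_mult F_def)
    have "insert p P \<in> F" using P p(2) qp pq by (auto simp: F_def)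
    moreover have "N (insert p P) \<subseteq> N P" by (auto simp: N_def)
    ultimately have "N (insert p P) = N P" using min S by blast
    then have "p * p = 0" using p(1) by (auto simp: N_def)
    then show False using minimal_projectionD[OF p(2)] by simp
  qed
  have "(\<Sum>p\<in>P. p * x) = x" for x
  proof -
    have "q * (x - (\<Sum>p\<in>P. p * x)) = 0" if q: "q \<in> P" for q
    proof -
      have "q * (\<Sum>p\<in>P. p * x) = (\<Sum>p\<in>P. if p = q then q * x else 0)"
        unfolding sum_distrib_left using q P minimal_projectionD(3)
        by (intro sum.cong) (auto simp: F_def simp flip: mult.assoc)
      also have "\<dots> = q * x" using q P by (simp add: F_def)
      finally show ?thesis by (simp add: right_diff_distrib)
    qed
    then have "x - (\<Sum>p\<in>P. p * x) \<in> N P" by (simp add: N_def)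
    then show ?thesis using \<open>N P = {0}\<close> by simp
  qed
  then have "(\<Sum>p\<in>P. p * x\<^sup>\<star>)\<^sup>\<star> = x" for x by (simp add: star_star)
  moreover have "(\<Sum>p\<in>P. p * x\<^sup>\<star>)\<^sup>\<star> = (\<Sum>p\<in>P. x * p)" for x
    using P minimal_projectionD(2)
    by (auto simp: adj_sum star_mult star_star F_def intro!: sum.cong)
  ultimately have sum: "(\<Sum>p\<in>P. x * p) = x" for x by simp
  show thesis
  proof (rule that[of P])
    show "finite P" "\<And>p. p \<in> P \<Longrightarrow> minimal_projection A p"
      "\<And>p q. p \<in> P \<Longrightarrow> q \<in> P \<Longrightarrow> p \<noteq> q \<Longrightarrow> p * q = 0"
      using P by (simp_all add: F_def)
  qed (rule sum)
qed

end

section \<open>Algebras whose blocks have size one\<close>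

locale block_decomposition = cstar_algebra A
  for A :: "'a::{real_normed_algebra, banach} cstar_structure" +
  fixes P :: "'a set"
  assumes finite_blocks: "finite P"
    and minimal: "p \<in> P \<Longrightarrow> minimal_projection A p"
    and central: "p \<in> P \<Longrightarrow> x * p = p * x"
    and distinct_blocks: "p \<in> P \<Longrightarrow> q \<in> P \<Longrightarrow> p \<noteq> q \<Longrightarrow> p * q = 0"
    and sum_blocks: "(\<Sum>p\<in>P. x * p) = x"

text \<open>
  Other components of \<open>v\<close> may be nonzero, as long as they do not affect \<open>O(v)\<close>.
\<close>

definition in_block :: "'a::{real_normed_algebra, banach} cstar_structure \<Rightarrow> 'a \<Rightarrow> 'a \<Rightarrow> bool" where
  "in_block A p v \<longleftrightarrow> v * p \<noteq> 0 \<and> orth_set A v = orth_set A (v * p)"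

lemma smooth_cong: "orth_set A v = orth_set A w \<Longrightarrow> v \<noteq> 0 \<Longrightarrow> smooth A w \<Longrightarrow> smooth A v"
  by (simp add: smooth_def)

context block_decomposition
begin

lemma block_mult: "p \<in> P \<Longrightarrow> q \<in> P \<Longrightarrow> x * p * q = (if p = q then x * p else 0)"
  using minimal_projectionD(3)[OF minimal] distinct_blocks by (auto simp: mult.assoc)

lemma block_idem: "p \<in> P \<Longrightarrow> p * p = p"
  using minimal_projectionD(3)[OF minimal] .

lemma block_product: "p \<in> P \<Longrightarrow> (x * p) * (y * p) = x * y * p"
  by (metis block_idem central mult.assoc)

lemma adj_block: "p \<in> P \<Longrightarrow> (x * p)\<^sup>\<star> = x\<^sup>\<star> * p"
  using minimal_projectionD(2)[OF minimal] central by (simp add: star_mult)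

lemma block_ext: "(\<And>p. p \<in> P \<Longrightarrow> x * p = y * p) \<Longrightarrow> x = y"
  using sum_blocks[of x] sum_blocks[of y] by (metis (no_types, lifting) sum.cong)

lemma norm_block_le: "p \<in> P \<Longrightarrow> norm (x * p) \<le> norm x"
  using norm_mult_projection_le minimal_projectionD(1)[OF minimal] by blast

text \<open>
  Repeated squaring \<open>x \<mapsto> x\<^sup>\<star> x\<close> turns the crude bound by the number of blocks into the bound by the
  maximum.
\<close>

lemma norm_le_if_blocks_le_1:
  assumes "\<And>p. p \<in> P \<Longrightarrow> norm (x * p) \<le> 1"
  shows "norm x \<le> 1"
proof (rule ccontr)
  assume "\<not> norm x \<le> 1"
  then have gt: "norm x > 1" by simp
  have bound: "norm x ^ (2 ^ n) \<le> card P" if "\<And>p. p \<in> P \<Longrightarrow> norm (x * p) \<le> 1" for n x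
    using that
  proof (induct n arbitrary: x)
    case 0
    have "norm (\<Sum>p\<in>P. x * p) \<le> (\<Sum>p\<in>P. 1)" using 0 by (intro sum_norm_le) auto
    then show ?case by (simp add: sum_blocks)
  next
    case (Suc n)
    have "norm (x\<^sup>\<star> * x * p) \<le> 1" if p: "p \<in> P" for p
    proof -
      have "x\<^sup>\<star> * x * p = (norm (x * p))\<^sup>2 *\<^sub>R p"
        using minimal_projectionD(5)[OF minimal[OF p], of x] p
        by (simp add: adj_block block_product)
      then show ?thesis
        using Suc.prems[OF p] norm_minimal_projection[OF minimal[OF p]]
        by (simp add: power_le_one)
    qed
    from Suc.hyps[OF this] show ?case
      by (simp only: cstar_identity power_mult[symmetric] power_Suc)
  qed
  obtain n where "real (card P) < norm x ^ n" using real_arch_pow[OF gt] by blast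
  also have "norm x ^ n \<le> norm x ^ (2 ^ n)"
    using gt by (intro power_increasing less_imp_le[OF less_exp]) simp
  also have "\<dots> \<le> card P" using bound assms by blast
  finally show False by simp
qed

lemma norm_le_if_blocks_le:
  assumes "\<And>p. p \<in> P \<Longrightarrow> norm (x * p) \<le> m" and "0 \<le> m"
  shows "norm x \<le> m"
proof (cases "m = 0")
  case True
  have "x * p = 0 * p" if "p \<in> P" for p using assms(1)[OF that] True by simp
  then have "x = 0" by (rule block_ext)
  then show ?thesis using True by simp
next
  case False
  then have m: "m > 0" using assms(2) by simp
  have "norm ((1 / m) *\<^sub>R x * p) \<le> 1" if "p \<in> P" for p
    using assms(1)[OF that] m by (simp add: divide_le_eq)
  then have "norm ((1 / m) *\<^sub>R x) \<le> 1" by (rule norm_le_if_blocks_le_1)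
  then show ?thesis using False assms(2) by (simp add: divide_le_eq)
qed

lemma norm_attained:
  assumes "x \<noteq> 0"
  obtains p where "p \<in> P" "norm (x * p) = norm x"
proof -
  have ne: "P \<noteq> {}" using sum_blocks[of x] assms by auto
  let ?m = "Max ((\<lambda>p. norm (x * p)) ` P)"
  have "?m \<in> (\<lambda>p. norm (x * p)) ` P" using ne finite_blocks by (intro Max_in) auto
  then obtain p where p: "p \<in> P" "?m = norm (x * p)" by blast
  have "norm x \<le> ?m"
  proof (rule norm_le_if_blocks_le)
    show "norm (x * q) \<le> ?m" if "q \<in> P" for q using that finite_blocks by (intro Max_ge) auto
    show "0 \<le> ?m" using p by simp
  qed
  then have "norm (x * p) = norm x" using p norm_block_le[OF p(1), of x] by simp
  then show thesis using that p by blast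
qed

lemma column_inner_block:
  assumes "p \<in> P" "q \<in> P" "p \<noteq> q"
  shows "column_inner p v (w * q) = 0"
proof -
  have "w * q * p = 0" using assms block_mult by simp
  then show ?thesis
    using column_inner_mult_right[OF minimal[OF assms(1)], of v "w * q"]
    by (simp add: linear_0[OF linear_column_inner[OF minimal[OF assms(1)]]])
qed

lemma in_block_orth_iff:
  assumes "p \<in> P" "in_block A p v"
  shows "bj_orth A v w \<longleftrightarrow> (\<forall>d\<in>scalars A. column_inner p v (d \<cdot> w) = 0)"
proof -
  have "bj_orth A v w \<longleftrightarrow> bj_orth A (v * p) w"
    using assms(2) by (auto simp: in_block_def orth_set_def)
  then show ?thesis
    using column_bj_orth_iff[OF minimal[OF assms(1)], of "v * p" w] block_mult[OF assms(1,1)]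
    by (simp add: column_inner_mult_left[OF minimal[OF assms(1)]])
qed

lemma in_block_self: "p \<in> P \<Longrightarrow> x * p = x \<Longrightarrow> x \<noteq> 0 \<Longrightarrow> in_block A p x"
  by (simp add: in_block_def)

text \<open>
  For a block \<open>p\<close> in which \<open>v\<close> attains its norm, \<open>O(v p)\<close> is contained in \<open>O(v)\<close>.
\<close>

lemma smooth_in_block:
  assumes v: "smooth A v"
  obtains p where "p \<in> P" "in_block A p v"
proof -
  have "v \<noteq> 0" using v by (simp add: smooth_def)
  then obtain p where p: "p \<in> P" "norm (v * p) = norm v" using norm_attained by blast
  have nz: "v * p \<noteq> 0" using p(2) \<open>v \<noteq> 0\<close> by auto
  have "orth_set A (v * p) \<subseteq> orth_set A v"
    by (rule column_orth_set_subset[OF minimal[OF p(1)] p(2)])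
  then have "in_block A p v" using v nz by (auto simp: smooth_def in_block_def)
  then show thesis using that p(1) by blast
qed

lemma in_block_smooth:
  assumes "p \<in> P" "in_block A p v"
  shows "smooth A v"
proof (rule smooth_cong)
  show "orth_set A v = orth_set A (v * p)" "v \<noteq> 0" using assms by (auto simp: in_block_def)
  show "smooth A (v * p)"
    using assms block_mult[OF assms(1,1)]
    by (intro column_smooth[OF minimal[OF assms(1)]]) (auto simp: in_block_def)
qed

text \<open>
  Within a block \<open>O(w)\<close> determines the component of \<open>w\<close> up to a scalar, which does not matter for
  orthogonality.  For different blocks a small multiple of \<open>v p\<close> can be added to \<open>w q\<close> without changing
  \<open>O(w q)\<close>; it destroys the orthogonality of \<open>v\<close> to \<open>w q\<close>.
\<close>

lemma linked_iff:
  assumes p: "p \<in> P" "in_block A p v" and q: "q \<in> P" "in_block A q w"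
  shows "linked A v w \<longleftrightarrow> p = q"
proof
  assume "p = q"
  show "linked A v w"
    unfolding linked_def
  proof (intro allI impI)
    fix w' assume w': "orth_set A w' = orth_set A w"
    have wq: "w * q * q = w * q" "w * q \<noteq> 0" using q block_mult by (simp_all add: in_block_def)
    have w'_eq: "orth_set A (w * q) = orth_set A w'" using w' q(2) by (simp add: in_block_def)
    have "w' \<noteq> 0" using w'_eq wq orth_set_zero_eq_UNIV by metis
    obtain c where c: "c \<in> scalars A" "w' * q = c \<cdot> (w * q)" "norm (w' * q) = norm w'"
      using column_component[OF minimal[OF q(1)] wq, of w'] w'_eq by auto
    have "c \<noteq> 0" using c \<open>w' \<noteq> 0\<close> by auto
    have eq: "column_inner p v (d \<cdot> w') = column_inner p v ((d * c) \<cdot> w)" if d: "d \<in> scalars A" for d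
    proof -
      have "(d \<cdot> w') * p = ((d * c) \<cdot> w) * p"
        using c d \<open>p = q\<close> by (simp add: smul_mult_left smul_smul)
      then show ?thesis by (metis column_inner_mult_right minimal p(1))
    qed
    show "bj_orth A v w' \<longleftrightarrow> bj_orth A v w"
    proof
      assume "bj_orth A v w"
      then show "bj_orth A v w'" using c(1) by (simp add: in_block_orth_iff[OF p] eq)
    next
      assume w': "bj_orth A v w'"
      show "bj_orth A v w"
        unfolding in_block_orth_iff[OF p]
      proof
        fix d assume "d \<in> scalars A"
        then have "d / c \<in> scalars A" using c(1) by simp
        moreover have "d = d / c * c" using \<open>c \<noteq> 0\<close> by simp
        ultimately show "column_inner p v (d \<cdot> w) = 0" using w' eq[of "d / c"] in_block_orth_iff[OF p]
          by metis
      qed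
    qed
  qed
next
  assume l: "linked A v w"
  show "p = q"
  proof (rule ccontr)
    assume "p \<noteq> q"
    define x where "x = w * q"
    define k where "k = norm x / (2 * norm (v * p))"
    define y where "y = k *\<^sub>R (v * p)"
    have vp: "v * p \<noteq> 0" and x0: "x \<noteq> 0" using p q by (auto simp: in_block_def x_def)
    have k: "k > 0" using vp x0 by (simp add: k_def)
    have xq: "x * q = x" using q block_mult by (simp add: x_def)
    have yq: "y * q = 0" using p(1) q(1) \<open>p \<noteq> q\<close> block_mult by (simp add: y_def)
    have "norm ((x + 2 *\<^sub>R y) * r) \<le> norm x" if r: "r \<in> P" for r
    proof -
      have "(x + 2 *\<^sub>R y) * r = (if r = q then x else 0) + (if r = p then 2 *\<^sub>R y else 0)"
        using block_mult r p(1) q(1) \<open>p \<noteq> q\<close> by (simp add: x_def y_def distrib_right)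
      moreover have "norm (2 *\<^sub>R y) = norm x" using vp by (simp add: y_def k_def)
      ultimately show ?thesis using \<open>p \<noteq> q\<close> by auto
    qed
    then have "norm (x + 2 *\<^sub>R y) \<le> norm x" by (rule norm_le_if_blocks_le[OF _ norm_ge_zero])
    from orth_set_perturb[OF minimal[OF q(1)] xq yq this]
    have "orth_set A (x + y) = orth_set A w" "orth_set A x = orth_set A w"
      using q(2) by (simp_all add: in_block_def x_def)
    then have "bj_orth A v (x + y) \<longleftrightarrow> bj_orth A v x" using l unfolding linked_def by blast
    moreover have ip_x: "column_inner p v (d \<cdot> x) = 0" if "d \<in> scalars A" for d
      using column_inner_block[OF p(1) q(1) \<open>p \<noteq> q\<close>, of v "d \<cdot> w"] that
      by (simp add: x_def smul_mult_left)
    then have "bj_orth A v x" by (simp add: in_block_orth_iff[OF p])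
    ultimately have "\<forall>d\<in>scalars A. column_inner p v (d \<cdot> (x + y)) = 0"
      using in_block_orth_iff[OF p, of "x + y"] by simp
    then have "column_inner p v (1 \<cdot> (x + y)) = 0" by (rule bspec) simp
    then have "column_inner p v y = 0"
      using ip_x[of 1] by (simp add: linear_add[OF linear_column_inner[OF minimal[OF p(1)]]])
    then have "k * column_inner p v v = 0"
      using linear_scale[OF linear_column_inner[OF minimal[OF p(1)]], of v k "v * p"]
        column_inner_mult_right[OF minimal[OF p(1)], of v v]
      by (simp add: y_def)
    then show False using k vp by (simp add: column_inner_self[OF minimal[OF p(1)]])
  qed
qed

lemma linked_trans:
  assumes "smooth A u" "smooth A v" "smooth A w" "linked A u v" "linked A v w"
  shows "linked A u w"
proof -
  obtain p where p: "p \<in> P" "in_block A p u" using smooth_in_block[OF assms(1)] .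
  obtain q where q: "q \<in> P" "in_block A q v" using smooth_in_block[OF assms(2)] .
  obtain r where r: "r \<in> P" "in_block A r w" using smooth_in_block[OF assms(3)] .
  show ?thesis using assms(4,5) linked_iff[OF p q] linked_iff[OF q r] linked_iff[OF p r] by simp
qed

lemma in_block_unique:
  assumes "p \<in> P" "in_block A p v" "q \<in> P" "in_block A q v"
  shows "p = q"
  using linked_iff[OF assms(1,2,1,2)] linked_iff[OF assms] by simp

text \<open>
  Multiplying a spanning set by the blocks gives spanning sets of all columns.
\<close>

lemma finite_separating_set:
  assumes fin: "finite B" "span B = (UNIV :: 'a set)"
  obtains V where "finite V" "0 \<notin> V" "\<And>w. (\<And>v. v \<in> V \<Longrightarrow> bj_orth A v w) \<Longrightarrow> w = 0"
proof (rule that)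
  let ?V = "(\<lambda>(b, p). b * p) ` (B \<times> P) - {0}"
  show "finite ?V" using fin finite_blocks by simp
  show "0 \<notin> ?V" by simp
  fix w assume w: "\<And>v. v \<in> ?V \<Longrightarrow> bj_orth A v w"
  have "w * p = 0" if p: "p \<in> P" for p
  proof -
    have "column_inner p b w = 0" if b: "b \<in> B" for b
    proof (cases "b * p = 0")
      case True
      then show ?thesis using column_inner_mult_left[OF minimal[OF p], of b w]
          linear_0[OF linear_column_inner[OF minimal[OF p], of w]] column_inner_commute by metis
    next
      case False
      then have "bj_orth A (b * p) w" using w b p by force
      then have "\<forall>d\<in>scalars A. column_inner p (b * p) (d \<cdot> w) = 0"
        using column_bj_orth_iff[OF minimal[OF p], of "b * p" w] block_mult[OF p p, of b] by simp
      then have "column_inner p (b * p) (1 \<cdot> w) = 0" by (rule bspec) simp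
      then show ?thesis by (simp add: column_inner_mult_left[OF minimal[OF p]])
    qed
    then have z: "column_inner p w b = 0" if "b \<in> B" for b
      using that column_inner_commute by metis
    have "column_inner p w x = 0" for x
      using fin(2) linear_eq_0_on_span[OF linear_column_inner[OF minimal[OF p]], of B w x] z by auto
    then show ?thesis using column_inner_self[OF minimal[OF p], of w] by simp
  qed
  then have "w * p = 0 * p" if "p \<in> P" for p using that by simp
  then show "w = 0" by (rule block_ext)
qed

end

section \<open>Finite dimension\<close>

lemma finite_span_if_separated:
  fixes G :: "('a::real_vector \<Rightarrow> real) set"
  assumes "finite G" "\<And>g. g \<in> G \<Longrightarrow> linear g" "subspace W"
    and "\<And>x. x \<in> W \<Longrightarrow> (\<And>g. g \<in> G \<Longrightarrow> g x = 0) \<Longrightarrow> x = 0"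
  shows "\<exists>B. finite B \<and> W \<subseteq> span B"
  using assms
proof (induct G arbitrary: W rule: finite_induct)
  case empty
  then have "W \<subseteq> span {}" by auto
  then show ?case by blast
next
  case (insert g G)
  have g: "linear g" using insert.prems by simp
  have sub: "subspace {x \<in> W. g x = 0}"
    using insert.prems(2) g
    by (auto simp: subspace_def linear_0 linear_add linear_scale)
  have sep: "x = 0" if "x \<in> {x \<in> W. g x = 0}" "\<And>h. h \<in> G \<Longrightarrow> h x = 0" for x
    using that by (intro insert.prems(3)) auto
  have lin: "linear h" if "h \<in> G" for h using insert.prems(1) that by simp
  obtain B where B: "finite B" "{x \<in> W. g x = 0} \<subseteq> span B"
    using insert.hyps(3)[OF lin sub sep] by blast
  show ?case
  proof (cases "\<exists>z\<in>W. g z \<noteq> 0")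
    case True
    then obtain z where z: "z \<in> W" "g z \<noteq> 0" by blast
    have "x \<in> span (insert z B)" if x: "x \<in> W" for x
    proof -
      have "x - (g x / g z) *\<^sub>R z \<in> {x \<in> W. g x = 0}"
        using x z insert.prems(2) g by (simp add: subspace_diff subspace_scale linear_diff linear_scale)
      then have "x - (g x / g z) *\<^sub>R z \<in> span B" using B by blast
      then show ?thesis by (auto simp: span_insert)
    qed
    then show ?thesis using B(1) by (intro exI[of _ "insert z B"]) auto
  qed (use B in auto)
qed

context cstar_algebra
begin

text \<open>
  The supporting functionals at the members of \<open>V\<close>, over the complex numbers together with their
  compositions with multiplication by \<open>\<i>\<close>, have no common nonzero zero.
\<close>

lemma finite_span_if_orth_separated:
  assumes V: "finite V" "0 \<notin> V" "\<And>w. (\<And>v. v \<in> V \<Longrightarrow> bj_orth A v w) \<Longrightarrow> w = 0"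
  shows "\<exists>B. finite B \<and> span B = (UNIV :: 'a set)"
proof -
  have "\<exists>f. linear f \<and> f v = norm v \<and> (\<forall>x. \<bar>f x\<bar> \<le> norm x)" if "v \<in> V" for v :: 'a
    using supporting_functional[of v] V(2) that by metis
  then obtain f where f: "\<And>v. v \<in> V \<Longrightarrow> linear (f v)" "\<And>v. v \<in> V \<Longrightarrow> f v v = norm v"
    "\<And>v x. v \<in> V \<Longrightarrow> \<bar>f v x\<bar> \<le> norm x" by metis
  define j :: complex where "j = (if \<i> \<in> scalars A then \<i> else 0)"
  have j: "j \<in> scalars A" by (simp add: j_def)
  define G where "G = f ` V \<union> (\<lambda>v x. f v (j \<cdot> x)) ` V"
  have "\<exists>B. finite B \<and> (UNIV :: 'a set) \<subseteq> span B"
  proof (rule finite_span_if_separated)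
    show "finite G" using V by (simp add: G_def)
    show "linear g" if "g \<in> G" for g
      using that f(1) linear_compose[OF scal_linear[OF j]] by (auto simp: G_def o_def)
    show "subspace (UNIV :: 'a set)" by (rule subspace_UNIV)
    fix x assume G: "\<And>g. g \<in> G \<Longrightarrow> g x = 0"
    show "x = 0"
    proof (rule V(3))
      fix v assume v: "v \<in> V"
      have z: "f v x = 0" "f v (j \<cdot> x) = 0" using G v by (auto simp: G_def)
      have "f v (d \<cdot> x) = 0" if "d \<in> scalars A" for d
      proof (cases rule: scalar_cases)
        case real
        then show ?thesis using that z by (simp add: scal_real linear_scale[OF f(1)[OF v]])
      next
        case complex
        then show ?thesis using z
          by (subst scal_Complex)
            (simp_all add: linear_add[OF f(1)[OF v]] linear_scale[OF f(1)[OF v]] j_def)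
      qed
      then show "bj_orth A v x" using bj_orth_if_functional[OF f[OF v]] by blast
    qed
  qed
  then show ?thesis by auto
qed

lemma finite_real_span:
  assumes "finite_dimensional A"
  shows "\<exists>B. finite B \<and> span B = (UNIV :: 'a set)"
proof -
  obtain B where B: "finite B"
    "(if scalars A = \<real> then span B else module.span (smul A) B) = UNIV"
    using assms by (auto simp: finite_dimensional_def)
  show ?thesis
  proof (cases rule: scalar_cases)
    case real
    then show ?thesis using B by auto
  next
    case complex
    interpret V: vector_space "smul A" by (rule vector_space_smul[OF complex])
    have "UNIV \<noteq> (\<real> :: complex set)" using i_not_in_Reals by blast
    then have sp: "V.span B = UNIV" using B complex by simp
    let ?S = "span (B \<union> (\<lambda>b. \<i> \<cdot> b) ` B)"
    have "\<i> \<cdot> x \<in> ?S" if "x \<in> ?S" for x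
    proof -
      have "(\<lambda>x. \<i> \<cdot> x) ` ?S = span ((\<lambda>x. \<i> \<cdot> x) ` (B \<union> (\<lambda>b. \<i> \<cdot> b) ` B))"
        using complex by (intro linear_span_image[symmetric] scal_linear) simp
      also have "\<dots> \<subseteq> ?S"
      proof (rule span_minimal)
        show "(\<lambda>x. \<i> \<cdot> x) ` (B \<union> (\<lambda>b. \<i> \<cdot> b) ` B) \<subseteq> ?S"
          using complex
          by (auto simp: smul_smul scal_uminus_one image_Un intro!: span_neg[OF span_base] intro: span_base)
      qed (rule subspace_span)
      finally show ?thesis using that by blast
    qed
    then have "c \<cdot> x \<in> ?S" if "x \<in> ?S" for c x
      unfolding scal_Complex[OF complex, of c x] using that by (intro span_add span_scale)
    then have "V.subspace ?S"
      unfolding V.subspace_def by (blast intro: span_zero span_add)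
    moreover have "B \<subseteq> ?S" using span_superset by blast
    ultimately have "V.span B \<subseteq> ?S" by (rule V.span_minimal[rotated])
    then have "?S = UNIV" unfolding sp by (rule top.extremum_uniqueI)
    then show ?thesis using B(1) by (intro exI[of _ "B \<union> (\<lambda>b. \<i> \<cdot> b) ` B"] conjI) simp_all
  qed
qed

lemma finite_dimensional_if_real_span:
  assumes "finite B" "span B = (UNIV :: 'a set)"
  shows "finite_dimensional A"
proof (cases rule: scalar_cases)
  case real
  then show ?thesis using assms by (auto simp: finite_dimensional_def)
next
  case complex
  interpret V: vector_space "smul A" by (rule vector_space_smul[OF complex])
  have "UNIV \<noteq> (\<real> :: complex set)" using i_not_in_Reals by blast
  have "subspace (V.span B)"
    unfolding subspace_def smul_of_real[symmetric]
    by (auto intro: V.span_zero V.span_add V.span_scale)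
  then have "span B \<subseteq> V.span B" using V.span_superset by (intro span_minimal)
  then show ?thesis using assms complex \<open>UNIV \<noteq> \<real>\<close> by (auto simp: finite_dimensional_def)
qed

lemma block_decomposition_exists:
  assumes fin: "finite B" "span B = (UNIV :: 'a set)"
    and comm: "\<And>p x. minimal_projection A p \<Longrightarrow> x * p = p * x * p"
  obtains P where "block_decomposition A P"
proof -
  obtain P where P: "finite P" "\<And>p. p \<in> P \<Longrightarrow> minimal_projection A p"
    "\<And>p q. p \<in> P \<Longrightarrow> q \<in> P \<Longrightarrow> p \<noteq> q \<Longrightarrow> p * q = 0" "\<And>x. (\<Sum>p\<in>P. x * p) = x"
    using projection_decomposition[OF fin] by blast
  have "x * p = p * x" if p: "p \<in> P" for p x
  proof -
    have "p * x = (x\<^sup>\<star> * p)\<^sup>\<star>" using minimal_projectionD(2)[OF P(2)[OF p]]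
      by (simp add: star_mult star_star)
    also have "\<dots> = (p * x\<^sup>\<star> * p)\<^sup>\<star>" using comm[OF P(2)[OF p], of "x\<^sup>\<star>"] by simp
    also have "\<dots> = p * x * p"
      using minimal_projectionD(2)[OF P(2)[OF p]] by (simp add: star_mult star_star mult.assoc)
    finally show ?thesis using comm[OF P(2)[OF p], of x] by simp
  qed
  then have "block_decomposition A P" using P by unfold_locales auto
  then show thesis using that by blast
qed

text \<open>
  \<open>p\<close>, \<open>u\<close> and \<open>q = u u\<^sup>\<star>\<close> are the matrix units \<open>e\<^sub>1\<^sub>1\<close>, \<open>e\<^sub>2\<^sub>1\<close>, \<open>e\<^sub>2\<^sub>2\<close>.  If \<open>O(w) = O(u)\<close>, then the
  column \<open>w p\<close> is a multiple of \<open>u\<close>, so \<open>p w p = 0\<close>; if \<open>O(w) = O(q)\<close>, then (by passing to adjoints) the row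
  \<open>q w\<close> is a multiple of \<open>q\<close>, so \<open>u\<^sup>\<star> w p = 0\<close>.  Hence all such \<open>w\<close> are orthogonal alike.  For \<open>p\<close> and
  \<open>q\<close> the vector \<open>w = q + p/2\<close> is the exception.
\<close>

lemma non_central_projection_breaks_transitivity:
  assumes p: "minimal_projection A p" and x: "x * p \<noteq> p * x * p"
  obtains u q where "smooth A p" "smooth A u" "smooth A q" "linked A p u" "linked A u q"
    "\<not> linked A p q"
proof -
  note pD = minimal_projectionD[OF p]
  define y where "y = x * p - p * x * p"
  have y: "y * p = y" "p * y = 0" "y \<noteq> 0"
    using x pD by (simp_all add: y_def algebra_simps) (simp flip: mult.assoc)
  define u where "u = (1 / norm y) *\<^sub>R y"
  have u: "u * p = u" "p * u = 0" "u \<noteq> 0" using y by (simp_all add: u_def)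
  have uu: "u\<^sup>\<star> * u = p" using pD(5)[of u] y by (simp add: u) (simp add: u_def)
  have u': "p * u\<^sup>\<star> = u\<^sup>\<star>" "u\<^sup>\<star> * p = 0"
    using arg_cong[OF u(1), of "star A"] arg_cong[OF u(2), of "star A"] pD by (simp_all add: star_mult)
  define q where "q = u * u\<^sup>\<star>"
  have qu: "q * u = u" using uu u by (simp add: q_def mult.assoc)
  have uq: "u\<^sup>\<star> * q = u\<^sup>\<star>" using uu u' by (simp add: q_def flip: mult.assoc)
  have q0: "q \<noteq> 0" using qu u(3) by auto
  have q_adj: "q\<^sup>\<star> = q" by (simp add: q_def star_mult star_star)
  have qq: "q * q = q" using qu by (metis mult.assoc q_def)
  have pq: "p * q = 0" and qp: "q * p = 0"
    by (simp add: q_def u flip: mult.assoc, simp add: q_def u' mult.assoc)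
  have proj_q: "projection A q" using q_adj qq by (simp add: projection_def)
  have "norm q = 1" using cstar_identity[of q] q_adj qq q0 by (simp add: power2_eq_square)
  have q: "minimal_projection A q"
    unfolding minimal_projection_def
  proof (intro conjI allI proj_q q0)
    fix a
    have "(a * q)\<^sup>\<star> * (a * q) = u * ((a * u)\<^sup>\<star> * (a * u)) * u\<^sup>\<star>"
      by (simp add: q_def star_mult star_star mult.assoc)
    also have "(a * u)\<^sup>\<star> * (a * u) = (norm (a * u))\<^sup>2 *\<^sub>R p"
      using pD(5)[of "a * u"] by (simp add: mult.assoc u)
    finally have eq: "(a * q)\<^sup>\<star> * (a * q) = (norm (a * u))\<^sup>2 *\<^sub>R q" by (simp add: u q_def)
    have "(norm (a * q))\<^sup>2 = (norm (a * u))\<^sup>2"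
      using cstar_identity[of "a * q"] \<open>norm q = 1\<close> by (simp add: eq)
    then show "(a * q)\<^sup>\<star> * (a * q) = (norm (a * q))\<^sup>2 *\<^sub>R q" using eq by simp
  qed
  have zero: "column_inner p v w = 0" if "(v * p)\<^sup>\<star> * (w * p) = 0" for v w
  proof (rule column_inner_unique[OF p])
    have "(w * p)\<^sup>\<star> * (v * p) = 0"
      using arg_cong[OF that, of "star A"] by (simp add: star_mult star_star)
    then show "(v * p)\<^sup>\<star> * (w * p) + (w * p)\<^sup>\<star> * (v * p) = (2 * 0) *\<^sub>R p" using that by simp
  qed
  have "linked A p u"
  proof -
    have "bj_orth A p w" if w: "orth_set A w = orth_set A u" for w
    proof -
      obtain c where c: "c \<in> scalars A" "w * p = c \<cdot> u"
        using column_component[OF p u(1,3), of w] w by auto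
      have "column_inner p p (d \<cdot> w) = 0" if "d \<in> scalars A" for d
        using c that pD u by (intro zero) (simp add: smul_mult_left smul_mult_right)
      then show ?thesis using column_bj_orth_iff[OF p pD(3)] by blast
    qed
    then show ?thesis by (auto simp: linked_def)
  qed
  moreover have "linked A u q"
  proof -
    have "bj_orth A u w" if w: "orth_set A w = orth_set A q" for w
    proof -
      have "orth_set A (w\<^sup>\<star>) = orth_set A q" using orth_set_adj_eq[OF w] by (simp add: q_adj)
      then obtain c where c: "c \<in> scalars A" "w\<^sup>\<star> * q = c \<cdot> q"
        using column_component[OF q qq q0, of "w\<^sup>\<star>"] by auto
      have "q * w = cnj c \<cdot> q"
        using arg_cong[OF c(2), of "star A"] c(1) by (simp add: star_mult star_star star_smul q_adj)
      then have "u\<^sup>\<star> * (q * w) * p = 0" using c(1) by (simp add: smul_mult_left smul_mult_right uq u')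
      then have uw: "u\<^sup>\<star> * w * p = 0" by (simp add: uq flip: mult.assoc)
      have "column_inner p u (d \<cdot> w) = 0" if "d \<in> scalars A" for d
        using that uw by (intro zero) (simp add: u smul_mult_left smul_mult_right mult.assoc)
      then show ?thesis using column_bj_orth_iff[OF p u(1)] by blast
    qed
    then show ?thesis by (auto simp: linked_def)
  qed
  moreover have "\<not> linked A p q"
  proof
    assume l: "linked A p q"
    have "projection A (q + p)"
      using pD(2,3) by (simp add: projection_def star_add q_adj algebra_simps qq pq qp)
    then have "norm (q + p) \<le> 1" by (rule norm_projection_le)
    then have "orth_set A (q + (1/2) *\<^sub>R p) = orth_set A q"
      using \<open>norm q = 1\<close> by (intro orth_set_perturb[OF q qq]) (simp_all add: pq)
    then have "bj_orth A p (q + (1/2) *\<^sub>R p) \<longleftrightarrow> bj_orth A p q" using l unfolding linked_def by blast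
    moreover have "column_inner p p (d \<cdot> q) = 0" if "d \<in> scalars A" for d
      using that by (intro zero) (simp add: smul_mult_left qp)
    then have "bj_orth A p q" using column_bj_orth_iff[OF p pD(3)] by blast
    ultimately have "\<forall>d\<in>scalars A. column_inner p p (d \<cdot> (q + (1/2) *\<^sub>R p)) = 0"
      using column_bj_orth_iff[OF p pD(3), of "q + (1/2) *\<^sub>R p"] by simp
    then have "column_inner p p (1 \<cdot> (q + (1/2) *\<^sub>R p)) = 0" by (rule bspec) simp
    moreover have "column_inner p p q = 0" by (intro zero) (simp add: qp)
    ultimately show False
      using norm_minimal_projection[OF p] pD(3)
      by (simp add: linear_add[OF linear_column_inner[OF p]] column_inner_self[OF p]
          linear_scale[OF linear_column_inner[OF p]])
  qed
  ultimately show thesis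
    using that column_smooth[OF p pD(3,4)] column_smooth[OF p u(1,3)] column_smooth[OF q qq q0]
    by blast
qed

text \<open>
  Distinct minimal ideals annihilate each other, so multiplication by the unit of one of them extracts
  the corresponding component, and a skew-field has no nonzero nilpotent elements.
\<close>

lemma pseudo_abelian_reduced:
  fixes x :: 'a
  assumes "pseudo_abelian A" and x: "x * x = 0"
  shows "x = 0"
proof -
  have "x \<in> pseudo_abelian_summand A" using assms by (simp add: pseudo_abelian_def)
  then obtain S f where S: "finite S" "x = (\<Sum>I\<in>S. f I)"
    and I: "\<And>I. I \<in> S \<Longrightarrow> minimal_ideal A I" "\<And>I. I \<in> S \<Longrightarrow> skew_field I" "\<And>I. I \<in> S \<Longrightarrow> f I \<in> I"
    by (auto simp: pseudo_abelian_summand_def)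
  have "f J = 0" if J: "J \<in> S" for J
  proof -
    obtain e where e: "e \<in> J" "\<And>y. y \<in> J \<Longrightarrow> e * y = y" "\<And>y. y \<in> J \<Longrightarrow> y * e = y"
      and inv: "\<And>y. y \<in> J \<Longrightarrow> y \<noteq> 0 \<Longrightarrow> \<exists>z\<in>J. y * z = e"
      using I(2)[OF J] unfolding skew_field_def by blast
    have ideal: "two_sided_ideal A K" if "K \<in> S" for K
      using I(1)[OF that] by (simp add: minimal_ideal_def)
    have disjoint: "K \<inter> J = {0}" if K: "K \<in> S" "K \<noteq> J" for K
    proof -
      have "two_sided_ideal A (K \<inter> J)"
        using ideal[OF K(1)] ideal[OF J] by (auto simp: two_sided_ideal_def)
      then show ?thesis using I(1)[OF K(1)] I(1)[OF J] K(2) unfolding minimal_ideal_def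
        by (metis inf_le1 inf_le2)
    qed
    have zero: "f K * e = 0" "e * f K = 0" if K: "K \<in> S" "K \<noteq> J" for K
      using ideal[OF K(1)] ideal[OF J] I(3)[OF K(1)] e(1) disjoint[OF K]
      by (auto simp: two_sided_ideal_def)
    have "x * e = (\<Sum>K\<in>S. if K = J then f J * e else 0)"
      unfolding S(2) sum_distrib_right by (intro sum.cong) (auto simp: zero)
    then have xe: "x * e = f J" using S(1) J e(3) I(3)[OF J] by simp
    have "e * x = (\<Sum>K\<in>S. if K = J then e * f J else 0)"
      unfolding S(2) sum_distrib_left by (intro sum.cong) (auto simp: zero)
    then have ex: "e * x = f J" using S(1) J e(2) I(3)[OF J] by simp
    have "f J * f J = e * (x * x) * e" unfolding mult.assoc xe by (simp add: ex flip: mult.assoc)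
    then have sq: "f J * f J = 0" using x by simp
    show "f J = 0"
    proof (rule ccontr)
      assume "f J \<noteq> 0"
      then obtain z where "f J * z = e" using inv I(3)[OF J] by blast
      then have "f J * f J * z = f J" using e(3) I(3)[OF J] by (simp add: mult.assoc)
      then show False using sq \<open>f J \<noteq> 0\<close> by simp
    qed
  qed
  then show ?thesis using S(2) by simp
qed

lemma pseudo_abelian_block_decomposition:
  assumes "pseudo_abelian A" "finite_dimensional A"
  obtains P where "block_decomposition A P"
proof -
  obtain B where B: "finite B" "span B = (UNIV :: 'a set)" using finite_real_span[OF assms(2)] by blast
  have "x * p = p * x * p" if p: "minimal_projection A p" for p x
  proof -
    have pp: "p * p = p" by (rule minimal_projectionD[OF p])
    have "(x * p - p * x * p) * (x * p - p * x * p) = 0"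
      using pp by (simp add: left_diff_distrib right_diff_distrib mult.assoc) (metis mult.assoc)
    then have "x * p - p * x * p = 0" by (rule pseudo_abelian_reduced[OF assms(1)])
    then show ?thesis by simp
  qed
  then show thesis using block_decomposition_exists[OF B] that by blast
qed

end

section \<open>Maps preserving orthogonality\<close>

definition bj_map ::
  "'a::{real_normed_algebra, banach} cstar_structure \<Rightarrow>
   'b::{real_normed_algebra, banach} cstar_structure \<Rightarrow> ('a \<Rightarrow> 'b) \<Rightarrow> bool" where
  "bj_map A B \<phi> \<longleftrightarrow> bij \<phi> \<and> (\<forall>v w. bj_orth A v w \<longleftrightarrow> bj_orth B (\<phi> v) (\<phi> w))"

lemma bj_map_inv:
  assumes "bj_map A B \<phi>"
  shows "bj_map B A (inv \<phi>)"
  using assms by (simp add: bj_map_def bij_imp_bij_inv bij_inv_eq_iff bij_is_surj surj_f_inv_f)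

lemma bj_map_surj: "bj_map A B \<phi> \<Longrightarrow> \<exists>x. \<phi> x = y"
  unfolding bj_map_def by (metis bij_pointE)

lemma bj_map_orth: "bj_map A B \<phi> \<Longrightarrow> bj_orth B (\<phi> v) (\<phi> w) \<longleftrightarrow> bj_orth A v w"
  by (simp add: bj_map_def)

lemma bj_map_orth_set_subset:
  assumes "bj_map A B \<phi>"
  shows "orth_set B (\<phi> v) \<subseteq> orth_set B (\<phi> w) \<longleftrightarrow> orth_set A v \<subseteq> orth_set A w"
proof
  assume l: "orth_set B (\<phi> v) \<subseteq> orth_set B (\<phi> w)"
  show "orth_set A v \<subseteq> orth_set A w"
    using l bj_map_orth[OF assms] unfolding orth_set_def by blast
next
  assume r: "orth_set A v \<subseteq> orth_set A w"
  show "orth_set B (\<phi> v) \<subseteq> orth_set B (\<phi> w)"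
  proof
    fix y assume y: "y \<in> orth_set B (\<phi> v)"
    obtain x where x: "\<phi> x = y" using bj_map_surj[OF assms] by blast
    then show "y \<in> orth_set B (\<phi> w)"
      using y r bj_map_orth[OF assms] unfolding orth_set_def by blast
  qed
qed

lemma bj_map_orth_set_eq:
  assumes "bj_map A B \<phi>"
  shows "orth_set B (\<phi> v) = orth_set B (\<phi> w) \<longleftrightarrow> orth_set A v = orth_set A w"
  using bj_map_orth_set_subset[OF assms] by blast

lemma bj_map_eq_0:
  assumes "bj_map A B \<phi>" "cstar_algebra A" "cstar_algebra B"
  shows "\<phi> v = 0 \<longleftrightarrow> v = 0"
  using bj_map_orth[OF assms(1), of v v] cstar_algebra.bj_orth_self[OF assms(2)]
    cstar_algebra.bj_orth_self[OF assms(3)] by metis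

lemma bj_map_smooth:
  assumes "bj_map A B \<phi>" "cstar_algebra A" "cstar_algebra B"
  shows "smooth B (\<phi> v) \<longleftrightarrow> smooth A v"
proof
  assume "smooth B (\<phi> v)"
  then show "smooth A v"
    unfolding smooth_def
    using bj_map_eq_0[OF assms] bj_map_orth_set_subset[OF assms(1)] bj_map_orth_set_eq[OF assms(1)]
    by metis
next
  assume v: "smooth A v"
  show "smooth B (\<phi> v)"
    unfolding smooth_def
  proof (intro conjI allI impI)
    show "\<phi> v \<noteq> 0" using v bj_map_eq_0[OF assms] by (simp add: smooth_def)
    fix y assume y: "y \<noteq> 0" "orth_set B y \<subseteq> orth_set B (\<phi> v)"
    obtain x where x: "\<phi> x = y" using bj_map_surj[OF assms(1)] by blast
    then show "orth_set B y = orth_set B (\<phi> v)"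
      using v y bj_map_eq_0[OF assms] bj_map_orth_set_subset[OF assms(1)]
        bj_map_orth_set_eq[OF assms(1)] unfolding smooth_def by metis
  qed
qed

lemma bj_map_linked:
  assumes "bj_map A B \<phi>"
  shows "linked B (\<phi> v) (\<phi> w) \<longleftrightarrow> linked A v w"
proof
  assume "linked B (\<phi> v) (\<phi> w)"
  then show "linked A v w"
    unfolding linked_def using bj_map_orth_set_eq[OF assms] bj_map_orth[OF assms] by metis
next
  assume l: "linked A v w"
  show "linked B (\<phi> v) (\<phi> w)"
    unfolding linked_def
  proof (intro allI impI)
    fix y assume y: "orth_set B y = orth_set B (\<phi> w)"
    obtain x where x: "\<phi> x = y" using bj_map_surj[OF assms(1)] by blast
    then show "bj_orth B (\<phi> v) y \<longleftrightarrow> bj_orth B (\<phi> v) (\<phi> w)"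
      using l y bj_map_orth_set_eq[OF assms] bj_map_orth[OF assms] unfolding linked_def by metis
  qed
qed

text \<open>
  A finite separating set is carried over by \<open>\<phi>\<close>, and so is the transitivity of links, which excludes
  larger blocks.
\<close>

lemma bj_map_block_decomposition:
  fixes A1 :: "'a::{real_normed_algebra, banach} cstar_structure"
    and A2 :: "'b::{real_normed_algebra, banach} cstar_structure"
  assumes bj: "bj_map A1 A2 \<phi>" and A1: "block_decomposition A1 P" "finite_dimensional A1"
    and A2: "cstar_algebra A2"
  obtains Q where "block_decomposition A2 Q" "finite_dimensional A2"
proof -
  interpret A1: block_decomposition A1 P by fact
  interpret A2: cstar_algebra A2 by fact
  have C1: "cstar_algebra A1" by unfold_locales
  let ?\<psi> = "inv \<phi>"
  note inv = bj_map_inv[OF bj]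
  obtain B where B: "finite B" "span B = (UNIV :: 'a set)" using A1.finite_real_span[OF A1(2)] by blast
  obtain V where V: "finite V" "0 \<notin> V" "\<And>w. (\<And>v. v \<in> V \<Longrightarrow> bj_orth A1 v w) \<Longrightarrow> w = 0"
    using A1.finite_separating_set[OF B] by blast
  have "w = 0" if w: "\<And>v. v \<in> \<phi> ` V \<Longrightarrow> bj_orth A2 v w" for w
  proof -
    obtain x where x: "\<phi> x = w" using bj_map_surj[OF bj] by blast
    have "bj_orth A1 v x" if "v \<in> V" for v
      using w[of "\<phi> v"] that bj_map_orth[OF bj, of v x] x by simp
    then have "x = 0" by (rule V(3))
    then show "w = 0" using bj_map_eq_0[OF bj C1 A2] x by metis
  qed
  moreover have "0 \<notin> \<phi> ` V" using V(2) bj_map_eq_0[OF bj C1 A2] by force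
  ultimately obtain B2 where B2: "finite B2" "span B2 = (UNIV :: 'b set)"
    using A2.finite_span_if_orth_separated[of "\<phi> ` V"] V(1) by blast
  have "x * p = p * x * p" if p: "minimal_projection A2 p" for p x
  proof (rule ccontr)
    assume x: "x * p \<noteq> p * x * p"
    obtain u q where "smooth A2 p" "smooth A2 u" "smooth A2 q" "linked A2 p u" "linked A2 u q"
      "\<not> linked A2 p q"
      by (rule A2.non_central_projection_breaks_transitivity[OF p x])
    then show False
      using A1.linked_trans[of "?\<psi> p" "?\<psi> u" "?\<psi> q"] bj_map_smooth[OF inv A2 C1]
        bj_map_linked[OF inv] by simp
  qed
  then obtain Q where "block_decomposition A2 Q" using A2.block_decomposition_exists[OF B2] by blast
  then show thesis using that A2.finite_dimensional_if_real_span[OF B2] by blast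
qed

section \<open>The base field\<close>

context block_decomposition
begin

text \<open>
  The component \<open>y\<close> of \<open>x p\<close> orthogonal to \<open>p\<close> is skew-adjoint, and so is \<open>\<i> y\<close>; hence \<open>y = 0\<close>.
\<close>

lemma complex_block:
  assumes C: "scalars A = UNIV" and p: "p \<in> P"
  obtains c where "x * p = c \<cdot> p"
proof -
  note pm = minimal[OF p]
  have "p * p \<noteq> 0" using minimal_projectionD(3,4)[OF pm] by simp
  then obtain c where c: "\<And>d. column_inner p p (d \<cdot> (x - c \<cdot> p)) = 0"
    using column_decompose[OF pm, of p x] C by auto
  define y where "y = (x - c \<cdot> p) * p"
  have yp: "y * p = y" by (simp add: y_def mult_pp[OF pm])
  have py: "p * y = y" using central[OF p] yp by metis
  have skew: "z + z\<^sup>\<star> = 0" if z: "z * p = z" "column_inner p p z = 0" for z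
  proof -
    have "z\<^sup>\<star> * p = z\<^sup>\<star>" using adj_block[OF p, of z] z by simp
    moreover have "p * z = z" using central[OF p, of z] z by simp
    ultimately show ?thesis
      using column_inner_eq[OF pm, of p z] z minimal_projectionD(2,3)[OF pm] by simp
  qed
  have ip: "column_inner p p (d \<cdot> y) = 0" for d
    using column_inner_mult_right[OF pm, of p "d \<cdot> (x - c \<cdot> p)"] c C
    by (simp add: y_def smul_mult_left)
  have "y + y\<^sup>\<star> = 0" using skew[OF yp] ip[of 1] by simp
  moreover have "\<i> \<cdot> y + (\<i> \<cdot> y)\<^sup>\<star> = 0" using skew[of "\<i> \<cdot> y"] ip[of \<i>] C yp by (simp add: smul_mult_left)
  then have "\<i> \<cdot> (y - y\<^sup>\<star>) = 0" using C by (simp add: star_smul scal_minus_left scal_diff_right)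
  then have "y - y\<^sup>\<star> = 0" using C by (simp add: scal_eq_0)
  ultimately have "2 *\<^sub>R y = 0" by (simp add: scaleR_2)
  then have "x * p = c \<cdot> p"
    using C minimal_projectionD(3)[OF pm] by (simp add: y_def left_diff_distrib smul_mult_left)
  then show thesis using that by blast
qed

lemma orth_pair_if_dim_ge_2:
  assumes "cstar_dim A \<ge> 2"
  obtains v w where "v \<noteq> 0" "w \<noteq> 0" "bj_orth A v w"
proof -
  have "\<exists>x::'a. x \<noteq> 0"
  proof (rule ccontr)
    assume "\<nexists>x::'a. x \<noteq> 0"
    then have U: "UNIV = {0::'a}" by auto
    show False
    proof (cases rule: scalar_cases)
      case real
      then show ?thesis using assms dim_le_card'[of "{0::'a}"] by (simp add: cstar_dim_def U)
    next
      case complex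
      interpret V: vector_space "smul A" by (rule vector_space_smul[OF complex])
      have "UNIV \<noteq> (\<real> :: complex set)" using i_not_in_Reals by blast
      then show ?thesis using assms complex V.dim_le_card'[of "{0::'a}"] by (simp add: cstar_dim_def U)
    qed
  qed
  then obtain x :: 'a where x: "x \<noteq> 0" by blast
  then obtain p where p: "p \<in> P" using norm_attained[of x] by blast
  note pm = minimal[OF p]
  have pp: "p * p = p" "p \<noteq> 0" using minimal_projectionD[OF pm] by auto
  have "\<exists>a. \<forall>c\<in>scalars A. a \<noteq> c \<cdot> p"
  proof (rule ccontr)
    assume contra: "\<nexists>a. \<forall>c\<in>scalars A. a \<noteq> c \<cdot> p"
    show False
    proof (cases rule: scalar_cases)
      case real
      have "a \<in> span {p}" for a
      proof -
        obtain c where c: "c \<in> scalars A" "a = c \<cdot> p" using contra by blast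
        show ?thesis unfolding c(2) scal_real[OF real(1) c(1)] by (intro span_scale span_base) simp
      qed
      then have "dim (UNIV :: 'a set) \<le> card {p}" by (intro dim_le_card) auto
      then show ?thesis using assms real by (simp add: cstar_dim_def)
    next
      case complex
      interpret V: vector_space "smul A" by (rule vector_space_smul[OF complex])
      have "UNIV \<noteq> (\<real> :: complex set)" using i_not_in_Reals by blast
      have "a \<in> V.span {p}" for a
      proof -
        obtain c where c: "a = c \<cdot> p" using contra by blast
        show ?thesis unfolding c by (intro V.span_scale V.span_base) simp
      qed
      then have "V.dim UNIV \<le> card {p}" by (intro V.dim_le_card) auto
      then show ?thesis using assms complex \<open>UNIV \<noteq> \<real>\<close> by (simp add: cstar_dim_def)
    qed
  qed
  then obtain a where a: "\<And>c. c \<in> scalars A \<Longrightarrow> a \<noteq> c \<cdot> p" by blast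
  obtain c where c: "c \<in> scalars A" "\<forall>d\<in>scalars A. column_inner p p (d \<cdot> (a - c \<cdot> p)) = 0"
    using column_decompose[OF pm, of p a] pp by auto
  then have "bj_orth A p (a - c \<cdot> p)" using column_bj_orth_iff[OF pm pp(1)] by blast
  moreover have "a - c \<cdot> p \<noteq> 0" using a[OF c(1)] by simp
  ultimately show thesis using that pp(2) by blast
qed

lemma two_blocks_if_orth_pair:
  assumes C: "scalars A = UNIV" and vw: "v \<noteq> 0" "w \<noteq> 0" "bj_orth A v w"
  obtains p q where "p \<in> P" "q \<in> P" "p \<noteq> q"
proof -
  obtain p where p: "p \<in> P" using norm_attained[OF vw(1)] by blast
  have "\<exists>q\<in>P. p \<noteq> q"
  proof (rule ccontr)
    assume "\<not> (\<exists>q\<in>P. p \<noteq> q)"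
    then have "r \<in> P \<longleftrightarrow> r \<in> {p}" for r using p by (metis singleton_iff)
    then have P: "P = {p}" by (rule set_eqI)
    obtain c where c: "v * p = c \<cdot> p" using complex_block[OF C p] .
    obtain d where d: "w * p = d \<cdot> p" using complex_block[OF C p] .
    have v: "v = c \<cdot> p" and w: "w = d \<cdot> p" using sum_blocks[of v] sum_blocks[of w] c d P by simp_all
    have d0: "d \<noteq> 0" using w vw(2) by auto
    have "v + (- (c / d)) \<cdot> w = 0"
      using d0 C smul_add_left[of c "- c" p] by (simp add: v w smul_smul)
    then show False using bj_orthD[OF vw(3), of "- (c / d)"] C vw(1) by simp
  qed
  then show thesis using that p by blast
qed

context
  fixes p q
  assumes C: "scalars A = UNIV" and pq: "p \<in> P" "q \<in> P" "p \<noteq> q"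
begin

lemma two_block_sum_mult:
  assumes "r \<in> P"
  shows "(a \<cdot> p + b \<cdot> q) * r = (if r = p then a \<cdot> p else 0) + (if r = q then b \<cdot> q else 0)"
  using pq assms C block_idem distinct_blocks by (auto simp: distrib_right smul_mult_left)

lemma norm_two_block_sum: "norm (a \<cdot> p + b \<cdot> q) = max (cmod a) (cmod b)"
proof (rule antisym)
  have n: "norm (a \<cdot> p) = cmod a" "norm (b \<cdot> q) = cmod b" for a b
    using C norm_minimal_projection[OF minimal[OF pq(1)]] norm_minimal_projection[OF minimal[OF pq(2)]]
    by (simp_all add: norm_smul)
  show "norm (a \<cdot> p + b \<cdot> q) \<le> max (cmod a) (cmod b)"
  proof (rule norm_le_if_blocks_le)
    show "norm ((a \<cdot> p + b \<cdot> q) * r) \<le> max (cmod a) (cmod b)" if "r \<in> P" for r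
      unfolding two_block_sum_mult[OF that] using pq(3) n by (simp add: le_max_iff_disj)
    show "0 \<le> max (cmod a) (cmod b)" by (simp add: le_max_iff_disj)
  qed
  show "max (cmod a) (cmod b) \<le> norm (a \<cdot> p + b \<cdot> q)"
    using norm_block_le[OF pq(1), of "a \<cdot> p + b \<cdot> q"] norm_block_le[OF pq(2), of "a \<cdot> p + b \<cdot> q"]
      pq n by (simp add: two_block_sum_mult)
qed

lemma phase_detected:
  assumes l: "cmod l = 1" and m: "cmod m = 1"
    and orth: "bj_orth A (1 \<cdot> p + l \<cdot> q) (1 \<cdot> p + (- m) \<cdot> q)"
  shows "l = m"
proof (rule ccontr)
  assume "l \<noteq> m"
  define k where "k = cnj l * m"
  have k: "cmod k = 1" using l m by (simp add: k_def norm_mult)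
  have ll: "l * cnj l = 1" "cnj l * l = 1" using l by (simp_all add: complex_norm_square[symmetric] mult.commute)
  have lk: "l * k = m" using ll by (simp add: k_def flip: mult.assoc)
  then have "k \<noteq> 1" using \<open>l \<noteq> m\<close> by auto
  have kk: "cnj k * k = 1" using k by (simp add: complex_norm_square[symmetric] mult.commute)
  \<comment> \<open>With this choice both components get the modulus \<open>\<bar>1 + k\<bar> / 2\<close>, which is less than \<open>1\<close>.\<close>
  define c where "c = - ((1 - cnj k) / 2)"
  have "norm (1 \<cdot> p + l \<cdot> q + c \<cdot> (1 \<cdot> p + (- m) \<cdot> q)) = norm ((1 + c) \<cdot> p + (l - c * m) \<cdot> q)"
    using C smul_add_left[of 1 c p] smul_add_left[of l "- (c * m)" q]
    by (simp add: smul_add_right smul_smul algebra_simps)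
  also have "\<dots> = max (cmod (1 + c)) (cmod (l - c * m))" by (rule norm_two_block_sum)
  also have "1 + c = cnj ((1 + k) / 2)" by (simp add: c_def field_simps)
  also have "l - c * m = l * ((1 + k) / 2)"
  proof -
    have "c * m = l * (c * k)" using lk by (simp add: mult.left_commute)
    moreover have "c * k = (1 - k) / 2" using kk by (simp add: c_def field_simps)
    ultimately have "l - c * m = l * (1 - (1 - k) / 2)" by (simp add: algebra_simps)
    then show ?thesis by (simp add: field_simps)
  qed
  also have "cmod (cnj ((1 + k) / 2)) = cmod ((1 + k) / 2)" by (rule complex_mod_cnj)
  finally have "norm (1 \<cdot> p + l \<cdot> q + c \<cdot> (1 \<cdot> p + (- m) \<cdot> q)) = cmod ((1 + k) / 2)"
    using l by (simp add: norm_mult)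
  moreover have "norm (1 \<cdot> p + l \<cdot> q) = 1" using l norm_two_block_sum[of 1 l] by simp
  ultimately have "1 \<le> cmod ((1 + k) / 2)" using bj_orthD[OF orth, of c] C by simp
  then have "2 \<le> cmod (1 + k)" by (simp add: norm_divide)
  then have "4 \<le> (cmod (1 + k))\<^sup>2" using power_mono[of 2 "cmod (1 + k)" 2] by simp
  moreover have k2: "(Re k)\<^sup>2 + (Im k)\<^sup>2 = 1" using k by (simp add: cmod_def)
  ultimately have "Re k \<ge> 1" by (simp add: cmod_power2 power2_sum)
  then have "Re k = 1" "Im k = 0"
    using k2 one_le_power[of "Re k" 2] abs_Re_le_cmod[of k] k by auto
  then show False using \<open>k \<noteq> 1\<close> by (simp add: complex_eq_iff)
qed

text \<open>
  \<open>v\<close> attains its norm in both blocks, and \<open>m\<close> is the ratio of its components there.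
\<close>

lemma phase_exists:
  assumes v: "v \<noteq> 0" "orth_set A p \<subseteq> orth_set A v" "orth_set A q \<subseteq> orth_set A v"
  obtains m where "cmod m = 1" "bj_orth A v (1 \<cdot> p + (- m) \<cdot> q)"
proof -
  note pm = minimal[OF pq(1)] and qm = minimal[OF pq(2)]
  note pD = minimal_projectionD[OF pm] and qD = minimal_projectionD[OF qm]
  obtain c where c: "v * p = c \<cdot> p" "norm (v * p) = norm v"
    using column_component[OF pm pD(3,4) v(2)] by blast
  obtain d where d: "v * q = d \<cdot> q" "norm (v * q) = norm v"
    using column_component[OF qm qD(3,4) v(3)] by blast
  have nc: "cmod c = norm v" "cmod d = norm v"
    using c d C norm_minimal_projection[OF pm] norm_minimal_projection[OF qm]
    by (simp_all add: norm_smul)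
  have c0: "c \<noteq> 0" using nc v(1) by auto
  define m where "m = d / c"
  have m: "cmod m = 1" using nc v(1) by (simp add: m_def norm_divide)
  have dm: "d = c * m" using c0 by (simp add: m_def)
  have "bj_orth A v (1 \<cdot> p + (- m) \<cdot> q)"
    unfolding bj_orth_def
  proof
    fix t
    let ?z = "v + t \<cdot> (1 \<cdot> p + (- m) \<cdot> q)"
    have t1: "t \<cdot> (1 \<cdot> p + (- m) \<cdot> q) = t \<cdot> p + (- t * m) \<cdot> q"
      using C by (simp add: smul_add_right smul_smul)
    have "?z * p = (c + t) \<cdot> p"
      unfolding t1 distrib_right[of v] two_block_sum_mult[OF pq(1)] c(1)
      using C pq(3) by (simp add: smul_add_left)
    moreover have "?z * q = (c * m - t * m) \<cdot> q"
      unfolding t1 distrib_right[of v] two_block_sum_mult[OF pq(2)] d(1)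
      using C pq(3) smul_add_left[of "c * m" "- (t * m)" q] by (simp add: dm)
    ultimately have "cmod (c + t) \<le> norm ?z" "cmod ((c - t) * m) \<le> norm ?z"
      using norm_block_le[OF pq(1), of ?z] norm_block_le[OF pq(2), of ?z] C
        norm_minimal_projection[OF pm] norm_minimal_projection[OF qm]
      by (simp_all add: norm_smul left_diff_distrib)
    moreover have "2 * cmod c \<le> cmod (c + t) + cmod (c - t)"
      using norm_triangle_ineq[of "c + t" "c - t"] by (simp flip: mult_2 add: norm_mult)
    ultimately show "norm v \<le> norm ?z" using m nc by (simp add: norm_mult)
  qed
  then show thesis using that m by blast
qed

end

end

text \<open>
  By \<open>phase_detected\<close> the vector \<open>v l = p + l q\<close> with \<open>\<bar>l\<bar> = 1\<close> is orthogonal to \<open>p - m q\<close> with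
  \<open>\<bar>m\<bar> = 1\<close> only for \<open>m = l\<close>.  The image of \<open>v l\<close> can be scaled to have a fixed component in the
  image block of \<open>p\<close>, and then its component in the image block of \<open>q\<close> is fixed up to a sign \<open>s l\<close>.  If
  the signs for \<open>l\<close> and \<open>k\<close> agree, the midpoint \<open>M\<close> of the two images satisfies
  \<open>O(M) \<subseteq> O(\<phi> (v l)) \<inter> O(\<phi> (v k))\<close>, and \<open>O(M)\<close> contains \<open>O(\<phi> p)\<close> and \<open>O(\<phi> q)\<close>.  By \<open>phase_exists\<close>
  the preimage of \<open>M\<close> is orthogonal to some \<open>p - m q\<close>, so \<open>l = m = k\<close>.  Among three values of \<open>l\<close> two have
  the same sign.
\<close>

lemma not_bj_map_complex_real:
  assumes A: "block_decomposition A P" "scalars A = UNIV" and pq: "p \<in> P" "q \<in> P" "p \<noteq> q"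
    and B: "block_decomposition B Q" "scalars B = \<real>" and bj: "bj_map A B \<phi>"
  shows False
proof -
  interpret A: block_decomposition A P by fact
  interpret B: block_decomposition B Q by fact
  have CA: "cstar_algebra A" and CB: "cstar_algebra B" by unfold_locales
  note phase_detected = A.phase_detected[OF A(2) pq] and phase_exists = A.phase_exists[OF A(2) pq]
  note A_norm = A.norm_two_block_sum[OF A(2) pq] and A_mult = A.two_block_sum_mult[OF A(2) pq]
  define v where "v l = smul A 1 p + smul A l q" for l
  have v_mult: "v l * p = p" "v l * q = smul A l q" for l
    using A_mult[OF pq(1), of 1 l] A_mult[OF pq(2), of 1 l] pq(3) by (simp_all add: v_def)
  have v_norm: "norm (v l) = 1" if "cmod l = 1" for l
    using A_norm[of 1 l] that by (simp add: v_def)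
  have v_sub: "orth_set A p \<subseteq> orth_set A (v l)" "orth_set A q \<subseteq> orth_set A (v l)"
    if l: "cmod l = 1" for l
  proof -
    note np = A.norm_minimal_projection[OF A.minimal[OF pq(1)]]
      and nq = A.norm_minimal_projection[OF A.minimal[OF pq(2)]]
    show "orth_set A p \<subseteq> orth_set A (v l)"
      using A.column_orth_set_subset[OF A.minimal[OF pq(1)], of "v l"] np v_norm[OF l] by (simp add: v_mult)
    have "orth_set A (smul A l q) = orth_set A q"
      using A(2) l by (intro A.orth_set_scal) auto
    then show "orth_set A q \<subseteq> orth_set A (v l)"
      using A.column_orth_set_subset[OF A.minimal[OF pq(2)], of "v l"] nq v_norm[OF l] A(2) l
      by (simp add: v_mult A.norm_smul)
  qed
  have "smooth A p" "smooth A q"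
    using A.in_block_smooth A.in_block_self A.block_idem A.minimal_projectionD(4)[OF A.minimal] pq
    by blast+
  then have "smooth B (\<phi> p)" "smooth B (\<phi> q)" using bj_map_smooth[OF bj CA CB] by auto
  obtain b where b: "b \<in> Q" "in_block B b (\<phi> p)" using B.smooth_in_block[OF \<open>smooth B (\<phi> p)\<close>] .
  obtain b' where b': "b' \<in> Q" "in_block B b' (\<phi> q)" using B.smooth_in_block[OF \<open>smooth B (\<phi> q)\<close>] .
  note bm = B.minimal[OF b(1)] and bm' = B.minimal[OF b'(1)]
  define u where "u = \<phi> p * b"
  define u' where "u' = \<phi> q * b'"
  have u: "u * b = u" "u \<noteq> 0" "orth_set B (\<phi> p) = orth_set B u"
    using b B.mult_pp[OF bm] by (simp_all add: u_def in_block_def)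
  have u': "u' * b' = u'" "u' \<noteq> 0" "orth_set B (\<phi> q) = orth_set B u'"
    using b' B.mult_pp[OF bm'] by (simp_all add: u'_def in_block_def)
  define \<rho> where "\<rho> = norm u / norm u'"
  have \<rho>: "\<rho> > 0" using u u' by (simp add: \<rho>_def)
  have "\<exists>s X. \<bar>s\<bar> = \<rho> \<and> orth_set B X = orth_set B (\<phi> (v l)) \<and> X * b = u \<and> norm X = norm u \<and>
    X * b' = s *\<^sub>R u'" if l: "cmod l = 1" for l
  proof -
    let ?V = "\<phi> (v l)"
    have "v l \<noteq> 0" using v_norm[OF l] by auto
    then have V0: "?V \<noteq> 0" using bj_map_eq_0[OF bj CA CB] by simp
    have sub: "orth_set B u \<subseteq> orth_set B ?V" "orth_set B u' \<subseteq> orth_set B ?V"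
      using v_sub[OF l] bj_map_orth_set_subset[OF bj] u(3) u'(3) by metis+
    obtain c where c: "?V * b = c *\<^sub>R u" "norm (?V * b) = norm ?V"
      using B.column_component[OF bm u(1,2) sub(1)] B.scal_real[OF B(2)] by metis
    obtain c' where c': "?V * b' = c' *\<^sub>R u'" "norm (?V * b') = norm ?V"
      using B.column_component[OF bm' u'(1,2) sub(2)] B.scal_real[OF B(2)] by metis
    have c0: "c \<noteq> 0" using c V0 by auto
    have n: "\<bar>c\<bar> * norm u = norm ?V" "\<bar>c'\<bar> * norm u' = norm ?V" using c c' by simp_all
    define X where "X = (1 / c) *\<^sub>R ?V"
    have "X = smul B (of_real (1 / c)) ?V" by (simp only: X_def B.smul_of_real)
    moreover have "orth_set B (smul B (of_real (1 / c)) ?V) = orth_set B ?V"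
      by (rule B.orth_set_scal[OF B.of_real_scalar]) (use c0 in simp)
    ultimately have "orth_set B X = orth_set B ?V" by simp
    moreover have "X * b = u" using c c0 by (simp add: X_def)
    moreover have "X * b' = (c' / c) *\<^sub>R u'" using c' by (simp add: X_def)
    moreover have "norm X = norm u" using n(1) c0 by (simp add: X_def field_simps)
    moreover have "\<bar>c' / c\<bar> = \<rho>" using n c0 u'(2) by (simp add: \<rho>_def field_simps)
    ultimately show ?thesis by blast
  qed
  then obtain s X where s: "\<And>l. cmod l = 1 \<Longrightarrow> \<bar>s l\<bar> = \<rho>"
    and X: "\<And>l. cmod l = 1 \<Longrightarrow> orth_set B (X l) = orth_set B (\<phi> (v l))"
      "\<And>l. cmod l = 1 \<Longrightarrow> X l * b = u" "\<And>l. cmod l = 1 \<Longrightarrow> norm (X l) = norm u"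
      "\<And>l. cmod l = 1 \<Longrightarrow> X l * b' = s l *\<^sub>R u'"
    by metis
  have inj: "l = k" if l: "cmod l = 1" and k: "cmod k = 1" and eq: "s l = s k" for l k
  proof -
    define M where "M = (1/2) *\<^sub>R (X l + X k)"
    have Mb: "M * b = u"
      using X(2)[OF l] X(2)[OF k] by (simp add: M_def distrib_right flip: scaleR_2)
    have Mb': "M * b' = s l *\<^sub>R u'"
      using X(4)[OF l] X(4)[OF k] eq by (simp add: M_def distrib_right flip: scaleR_2)
    have "norm M \<le> norm u"
      using norm_triangle_ineq[of "X l" "X k"] X(3)[OF l] X(3)[OF k] by (simp add: M_def)
    moreover have "norm u \<le> norm M" using B.norm_block_le[OF b(1), of M] by (simp add: Mb)
    ultimately have nM: "norm M = norm u" by simp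
    have sub_l: "orth_set B M \<subseteq> orth_set B (X l)"
      using nM X(3)[OF l] X(3)[OF k]
      by (intro B.orth_set_midpoint_subset[where w = "X k"]) (simp_all add: M_def)
    have sub_k: "orth_set B M \<subseteq> orth_set B (X k)"
      using nM X(3)[OF l] X(3)[OF k]
      by (intro B.orth_set_midpoint_subset[where w = "X l"]) (simp_all add: M_def add.commute)
    have "orth_set B u \<subseteq> orth_set B M"
      using B.column_orth_set_subset[OF bm, of M] nM by (simp add: Mb)
    moreover have "orth_set B u' \<subseteq> orth_set B M"
    proof -
      have "norm (M * b') = norm M" using s[OF l] u'(2) by (simp add: Mb' nM \<rho>_def)
      then have "orth_set B (s l *\<^sub>R u') \<subseteq> orth_set B M"
        using B.column_orth_set_subset[OF bm', of M] by (simp add: Mb')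
      moreover have "orth_set B (s l *\<^sub>R u') = orth_set B u'"
        using B.orth_set_scal[of "of_real (s l)" u'] s[OF l] \<rho> by (simp add: B.smul_of_real)
      ultimately show ?thesis by simp
    qed
    moreover obtain w where w: "\<phi> w = M" using bj_map_surj[OF bj] by blast
    ultimately have "orth_set A p \<subseteq> orth_set A w" "orth_set A q \<subseteq> orth_set A w"
      using bj_map_orth_set_subset[OF bj] u(3) u'(3) by metis+
    moreover have "M \<noteq> 0" using nM u(2) by auto
    then have "w \<noteq> 0" using w bj_map_eq_0[OF bj CA CB] by blast
    ultimately obtain m where m: "cmod m = 1" "bj_orth A w (smul A 1 p + smul A (- m) q)"
      using phase_exists by blast
    have "orth_set A w \<subseteq> orth_set A (v l)" "orth_set A w \<subseteq> orth_set A (v k)"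
      using sub_l sub_k X(1)[OF l] X(1)[OF k] w bj_map_orth_set_subset[OF bj] by metis+
    then have "bj_orth A (v l) (smul A 1 p + smul A (- m) q)"
      "bj_orth A (v k) (smul A 1 p + smul A (- m) q)"
      using m(2) by (auto simp: orth_set_def)
    then have "l = m" "k = m" using phase_detected l k m(1) by (simp_all add: v_def)
    then show ?thesis by simp
  qed
  have "\<bar>s 1\<bar> = \<rho>" "\<bar>s \<i>\<bar> = \<rho>" "\<bar>s (-1)\<bar> = \<rho>" using s by simp_all
  then have "s 1 = s \<i> \<or> s 1 = s (-1) \<or> s \<i> = s (-1)" by linarith
  then show False
    using inj[of 1 \<i>] inj[of 1 "-1"] inj[of \<i> "-1"] by (auto simp: complex_eq_iff)
qed

lemma bj_map_scalars_eq:
  assumes A: "block_decomposition A P" and B: "block_decomposition B Q" and bj: "bj_map A B \<phi>"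
    and dim: "cstar_dim A \<ge> 2"
  shows "scalars A = scalars B"
proof -
  interpret A: block_decomposition A P by fact
  interpret B: block_decomposition B Q by fact
  have CA: "cstar_algebra A" and CB: "cstar_algebra B" by unfold_locales
  obtain v w where vw: "v \<noteq> 0" "w \<noteq> 0" "bj_orth A v w" using A.orth_pair_if_dim_ge_2[OF dim] .
  have vw': "\<phi> v \<noteq> 0" "\<phi> w \<noteq> 0" "bj_orth B (\<phi> v) (\<phi> w)"
    using vw bj_map_eq_0[OF bj CA CB] bj_map_orth[OF bj] by auto
  have "\<not> (scalars A = UNIV \<and> scalars B = \<real>)"
    using A.two_blocks_if_orth_pair[OF _ vw] not_bj_map_complex_real[OF A _ _ _ _ B _ bj] by metis
  moreover have "\<not> (scalars B = UNIV \<and> scalars A = \<real>)"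
    using B.two_blocks_if_orth_pair[OF _ vw'] not_bj_map_complex_real[OF B _ _ _ _ A _ bj_map_inv[OF bj]]
    by metis
  ultimately show ?thesis using A.scalars B.scalars by metis
qed

section \<open>Matching the blocks\<close>

lemma bj_map_blocks:
  assumes A: "block_decomposition A P" and B: "block_decomposition B Q" and bj: "bj_map A B \<phi>"
  obtains \<sigma> where "bij_betw \<sigma> P Q" "\<And>p v. p \<in> P \<Longrightarrow> in_block B (\<sigma> p) (\<phi> v) \<longleftrightarrow> in_block A p v"
proof -
  interpret A: block_decomposition A P by fact
  interpret B: block_decomposition B Q by fact
  have CA: "cstar_algebra A" and CB: "cstar_algebra B" by unfold_locales
  note smooth_iff = bj_map_smooth[OF bj CA CB] and linked_iff = bj_map_linked[OF bj]
  have self: "in_block A p p" if "p \<in> P" for p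
    using A.in_block_self[OF that A.block_idem[OF that]] A.minimal_projectionD(4)[OF A.minimal[OF that]] .
  have "\<exists>q. q \<in> Q \<and> in_block B q (\<phi> p)" if p: "p \<in> P" for p
  proof -
    have "smooth B (\<phi> p)" using A.in_block_smooth[OF p self[OF p]] smooth_iff by simp
    then show ?thesis using B.smooth_in_block by blast
  qed
  then obtain \<sigma> where \<sigma>: "\<And>p. p \<in> P \<Longrightarrow> \<sigma> p \<in> Q" "\<And>p. p \<in> P \<Longrightarrow> in_block B (\<sigma> p) (\<phi> p)"
    by metis
  have iff: "in_block B (\<sigma> p) (\<phi> v) \<longleftrightarrow> in_block A p v" if p: "p \<in> P" for p v
  proof
    assume v: "in_block A p v"
    then have "smooth B (\<phi> v)" using A.in_block_smooth[OF p] smooth_iff by simp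
    then obtain q where q: "q \<in> Q" "in_block B q (\<phi> v)" using B.smooth_in_block by blast
    have "linked B (\<phi> p) (\<phi> v)" using A.linked_iff[OF p self[OF p] p v] linked_iff by simp
    then show "in_block B (\<sigma> p) (\<phi> v)"
      using B.linked_iff[OF \<sigma>(1)[OF p] \<sigma>(2)[OF p] q] q by simp
  next
    assume v: "in_block B (\<sigma> p) (\<phi> v)"
    then have "smooth B (\<phi> v)" by (rule B.in_block_smooth[OF \<sigma>(1)[OF p]])
    then have "smooth A v" using smooth_iff by simp
    then obtain r where r: "r \<in> P" "in_block A r v" using A.smooth_in_block by blast
    have "linked A p v"
      using B.linked_iff[OF \<sigma>(1)[OF p] \<sigma>(2)[OF p] \<sigma>(1)[OF p] v] linked_iff by simp
    then show "in_block A p v" using A.linked_iff[OF p self[OF p] r] r by simp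
  qed
  have "inj_on \<sigma> P"
    using iff self \<sigma>(2) A.in_block_unique by (intro inj_onI) metis
  moreover have "q \<in> \<sigma> ` P" if q: "q \<in> Q" for q
  proof -
    have qq: "in_block B q q"
      using B.in_block_self[OF q B.block_idem[OF q]] B.minimal_projectionD(4)[OF B.minimal[OF q]] .
    obtain x where x: "\<phi> x = q" using bj_map_surj[OF bj] by blast
    then have "smooth A x" using B.in_block_smooth[OF q qq] smooth_iff by metis
    then obtain p where p: "p \<in> P" "in_block A p x" using A.smooth_in_block by blast
    then have "in_block B (\<sigma> p) q" using iff x by blast
    then have "\<sigma> p = q" using B.in_block_unique[OF \<sigma>(1)[OF p(1)] _ q qq] by blast
    then show ?thesis using p by blast
  qed
  ultimately have "bij_betw \<sigma> P Q" using \<sigma>(1) by (auto simp: bij_betw_def)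
  then show thesis using that iff by blast
qed

section \<open>The skew-field in a block\<close>

definition quaternion_comb :: "'a::real_normed_algebra \<Rightarrow> 'a \<Rightarrow> 'a \<Rightarrow> real \<Rightarrow> real \<Rightarrow> real \<Rightarrow> real \<Rightarrow> 'a"
  where "quaternion_comb p i j a b c d = a *\<^sub>R p + b *\<^sub>R i + c *\<^sub>R j + d *\<^sub>R (i * j)"

text \<open>
  The parameters are the negatives of the squares of \<open>i\<close> and \<open>j\<close>.  The value \<open>0\<close> forces the generator to
  vanish, so that the reals, the complex numbers and the quaternions are the cases \<open>(0, 0)\<close>, \<open>(1, 0)\<close>
  and \<open>(1, 1)\<close> of one set of laws.
\<close>

definition quaternion_laws ::
  "'a::{real_normed_algebra, banach} cstar_structure \<Rightarrow> 'a \<Rightarrow> 'a \<Rightarrow> 'a \<Rightarrow> real \<Rightarrow> real \<Rightarrow> bool" where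
  "quaternion_laws A p i j \<alpha> \<beta> \<longleftrightarrow> \<alpha> \<in> {0, 1} \<and> \<beta> \<in> {0, 1} \<and> i * p = i \<and> j * p = j \<and>
     star A i = - i \<and> star A j = - j \<and> i * i = - (\<alpha> *\<^sub>R p) \<and> j * j = - (\<beta> *\<^sub>R p) \<and> j * i = - (i * j)"

definition quaternion_frame ::
  "'a::{real_normed_algebra, banach} cstar_structure \<Rightarrow> 'a \<Rightarrow> 'a \<Rightarrow> 'a \<Rightarrow> real \<Rightarrow> real \<Rightarrow> bool" where
  "quaternion_frame A p i j \<alpha> \<beta> \<longleftrightarrow> quaternion_laws A p i j \<alpha> \<beta> \<and>
     (\<forall>x. \<exists>a b c d. x * p = quaternion_comb p i j a b c d)"

text \<open>
  Together with \<open>orth_triple\<close> this distinguishes real blocks of dimensions one, two and four.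
\<close>

definition orth_pair :: "'a::{real_normed_algebra, banach} cstar_structure \<Rightarrow> 'a \<Rightarrow> bool" where
  "orth_pair A p \<longleftrightarrow> (\<exists>v w. in_block A p v \<and> in_block A p w \<and> bj_orth A v w)"

definition orth_triple :: "'a::{real_normed_algebra, banach} cstar_structure \<Rightarrow> 'a \<Rightarrow> bool" where
  "orth_triple A p \<longleftrightarrow> (\<exists>u v w. in_block A p u \<and> in_block A p v \<and> in_block A p w \<and>
     bj_orth A u v \<and> bj_orth A u w \<and> bj_orth A v w)"

lemma quaternion_comb_add:
  "quaternion_comb p i j a b c d + quaternion_comb p i j a' b' c' d' =
   quaternion_comb p i j (a + a') (b + b') (c + c') (d + d')"
  by (simp add: quaternion_comb_def scaleR_add_left)

lemma quaternion_comb_scaleR: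
  "r *\<^sub>R quaternion_comb p i j a b c d = quaternion_comb p i j (r * a) (r * b) (r * c) (r * d)"
  by (simp add: quaternion_comb_def scaleR_add_right)

context block_decomposition
begin

context
  fixes p assumes p: "p \<in> P"
begin

lemma block_unit_left: "x * p = x \<Longrightarrow> p * x = x"
  using central[OF p, of x] by simp

context
  fixes i j \<alpha> \<beta> assumes laws: "quaternion_laws A p i j \<alpha> \<beta>"
begin

lemma quaternion_products:
  "p * p = p" "i * p = i" "p * i = i" "j * p = j" "p * j = j"
  "i * j * p = i * j" "p * (i * j) = i * j"
  "i * i = - (\<alpha> *\<^sub>R p)" "j * j = - (\<beta> *\<^sub>R p)" "j * i = - (i * j)"
  "i * (i * j) = - (\<alpha> *\<^sub>R j)" "i * j * i = \<alpha> *\<^sub>R j"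
  "j * (i * j) = \<beta> *\<^sub>R i" "i * j * j = - (\<beta> *\<^sub>R i)"
  "i * j * (i * j) = - ((\<alpha> * \<beta>) *\<^sub>R p)"
proof -
  have l: "i * p = i" "j * p = j" "i * i = - (\<alpha> *\<^sub>R p)" "j * j = - (\<beta> *\<^sub>R p)" "j * i = - (i * j)"
    using laws by (simp_all add: quaternion_laws_def)
  show pp: "p * p = p" by (rule block_idem[OF p])
  show pi: "p * i = i" and pj: "p * j = j" using block_unit_left l by simp_all
  show "i * p = i" "j * p = j" "i * i = - (\<alpha> *\<^sub>R p)" "j * j = - (\<beta> *\<^sub>R p)" "j * i = - (i * j)"
    using l by simp_all
  show "i * j * p = i * j" by (simp add: mult.assoc l)
  show "p * (i * j) = i * j" by (simp add: pi flip: mult.assoc)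
  show iij: "i * (i * j) = - (\<alpha> *\<^sub>R j)" by (simp add: l pj flip: mult.assoc)
  show "i * j * i = \<alpha> *\<^sub>R j" by (simp add: mult.assoc l iij)
  show ijj: "i * j * j = - (\<beta> *\<^sub>R i)" by (simp add: mult.assoc l)
  show "j * (i * j) = \<beta> *\<^sub>R i" by (simp add: l ijj flip: mult.assoc)
  have "i * j * (i * j) = i * (j * i) * j" by (simp add: mult.assoc)
  also have "\<dots> = - (i * (i * j) * j)" by (simp add: l)
  also have "\<dots> = - ((\<alpha> * \<beta>) *\<^sub>R p)" by (simp only: iij) (simp add: l)
  finally show "i * j * (i * j) = - ((\<alpha> * \<beta>) *\<^sub>R p)" .
qed

lemma quaternion_comb_mult:
  "quaternion_comb p i j a b c d * quaternion_comb p i j a' b' c' d' = quaternion_comb p i j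
    (a * a' - \<alpha> * b * b' - \<beta> * c * c' - \<alpha> * \<beta> * d * d')
    (a * b' + b * a' + \<beta> * (c * d' - d * c'))
    (a * c' + c * a' + \<alpha> * (d * b' - b * d'))
    (a * d' + d * a' + b * c' - c * b')"
proof -
  define k where "k = i * j"
  note table = quaternion_products[folded k_def]
  show ?thesis
    unfolding quaternion_comb_def k_def[symmetric]
    by (simp add: distrib_left distrib_right table k_def[symmetric])
      (simp add: scaleR_add_left scaleR_diff_left algebra_simps)
qed

lemma quaternion_comb_adj:
  "(quaternion_comb p i j a b c d)\<^sup>\<star> = quaternion_comb p i j a (- b) (- c) (- d)"
  using laws minimal_projectionD(2)[OF minimal[OF p]]
  by (simp add: quaternion_comb_def star_add star_mult quaternion_laws_def)

lemma quaternion_comb_block: "quaternion_comb p i j a b c d * p = quaternion_comb p i j a b c d"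
  by (simp add: quaternion_comb_def distrib_right quaternion_products)

lemma column_inner_quaternion_comb:
  "column_inner p (quaternion_comb p i j a b c d) (quaternion_comb p i j a' b' c' d') =
    a * a' + \<alpha> * b * b' + \<beta> * c * c' + \<alpha> * \<beta> * d * d'"
proof (rule column_inner_unique[OF minimal[OF p]])
  have "r *\<^sub>R p = quaternion_comb p i j r 0 0 0" for r by (simp add: quaternion_comb_def)
  then show "(quaternion_comb p i j a b c d * p)\<^sup>\<star> * (quaternion_comb p i j a' b' c' d' * p) +
     (quaternion_comb p i j a' b' c' d' * p)\<^sup>\<star> * (quaternion_comb p i j a b c d * p) =
     (2 * (a * a' + \<alpha> * b * b' + \<beta> * c * c' + \<alpha> * \<beta> * d * d')) *\<^sub>R p"
    by (simp add: quaternion_comb_block quaternion_comb_adj quaternion_comb_mult quaternion_comb_add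
        algebra_simps)
qed

lemma quaternion_comb_basis:
  "p = quaternion_comb p i j 1 0 0 0" "i = quaternion_comb p i j 0 1 0 0"
  "j = quaternion_comb p i j 0 0 1 0" "i * j = quaternion_comb p i j 0 0 0 1"
  by (simp_all add: quaternion_comb_def)

lemma column_inner_basis:
  "column_inner p p (quaternion_comb p i j a b c d) = a"
  "column_inner p i (quaternion_comb p i j a b c d) = \<alpha> * b"
  "column_inner p j (quaternion_comb p i j a b c d) = \<beta> * c"
  "column_inner p (i * j) (quaternion_comb p i j a b c d) = \<alpha> * \<beta> * d"
  using column_inner_quaternion_comb[of 1 0 0 0 a b c d] column_inner_quaternion_comb[of 0 1 0 0 a b c d]
    column_inner_quaternion_comb[of 0 0 1 0 a b c d] column_inner_quaternion_comb[of 0 0 0 1 a b c d]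
  by (simp_all flip: quaternion_comb_basis)

lemma quaternion_degenerate:
  "\<alpha> *\<^sub>R i = i" "\<beta> *\<^sub>R j = j" "(\<alpha> * \<beta>) *\<^sub>R (i * j) = i * j"
proof -
  have i: "i = 0" if "\<alpha> = 0"
    using that laws adj_mult_self_eq_0[of i] by (simp add: quaternion_laws_def)
  have j: "j = 0" if "\<beta> = 0"
    using that laws adj_mult_self_eq_0[of j] by (simp add: quaternion_laws_def)
  have "\<alpha> = 0 \<or> \<alpha> = 1" "\<beta> = 0 \<or> \<beta> = 1" using laws by (auto simp: quaternion_laws_def)
  then show "\<alpha> *\<^sub>R i = i" "\<beta> *\<^sub>R j = j" "(\<alpha> * \<beta>) *\<^sub>R (i * j) = i * j"
    using i j by auto
qed

lemma quaternion_comb_degenerate: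
  "quaternion_comb p i j a (\<alpha> * b) (\<beta> * c) (\<alpha> * \<beta> * d) = quaternion_comb p i j a b c d"
proof -
  have "(\<alpha> * b) *\<^sub>R i = b *\<^sub>R i" "(\<beta> * c) *\<^sub>R j = c *\<^sub>R j" "(\<alpha> * \<beta> * d) *\<^sub>R (i * j) = d *\<^sub>R (i * j)"
    using quaternion_degenerate by (metis mult.commute scaleR_scaleR)+
  then show ?thesis by (simp only: quaternion_comb_def)
qed

text \<open>
  Subtract the orthogonal projection to the span of \<open>1\<close>, \<open>i\<close>, \<open>j\<close> and \<open>i j\<close>.
\<close>

lemma quaternion_residual:
  obtains a b c d where
    "\<And>e. e \<in> {p, i, j, i * j} \<Longrightarrow> column_inner p e (x * p - quaternion_comb p i j a b c d) = 0"
proof -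
  let ?c = "quaternion_comb p i j (column_inner p p x) (column_inner p i x) (column_inner p j x)
    (column_inner p (i * j) x)"
  note lin = linear_column_inner[OF minimal[OF p]]
  have deg: "\<alpha> * column_inner p i x = column_inner p i x" "\<beta> * column_inner p j x = column_inner p j x"
    "\<alpha> * \<beta> * column_inner p (i * j) x = column_inner p (i * j) x"
    using linear_scale[OF lin[of x], of \<alpha> i] linear_scale[OF lin[of x], of \<beta> j]
      linear_scale[OF lin[of x], of "\<alpha> * \<beta>" "i * j"]
    by (simp_all add: quaternion_degenerate column_inner_commute[of p x])
  have "column_inner p e (x * p - ?c) = 0" if "e \<in> {p, i, j, i * j}" for e
    using that deg
    by (auto simp: linear_diff[OF lin] column_inner_mult_right[OF minimal[OF p]] column_inner_basis)
  then show thesis using that by blast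
qed

end

lemma real_bj_orth_iff:
  assumes "scalars A = \<real>" "in_block A p v"
  shows "bj_orth A v w \<longleftrightarrow> column_inner p v w = 0"
proof
  assume "bj_orth A v w"
  then have "column_inner p v (1 \<cdot> w) = 0" using in_block_orth_iff[OF p assms(2)] one_scalar by blast
  then show "column_inner p v w = 0" by simp
next
  assume "column_inner p v w = 0"
  then show "bj_orth A v w"
    using assms(1)
    by (simp add: in_block_orth_iff[OF p assms(2)] scal_real
        linear_scale[OF linear_column_inner[OF minimal[OF p]]])
qed

lemma normalized_block:
  assumes "in_block A p v"
  defines "x \<equiv> (1 / norm (v * p)) *\<^sub>R (v * p)"
  shows "x * p = x" "x\<^sup>\<star> * x = p" "x * x\<^sup>\<star> = p"
proof -
  have n: "norm (v * p) \<noteq> 0" using assms by (simp add: in_block_def)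
  have vp: "v * p * p = v * p" by (rule mult_pp[OF minimal[OF p]])
  show xp: "x * p = x" by (simp add: x_def vp)
  have nx: "norm x = 1" using n by (simp add: x_def)
  show "x\<^sup>\<star> * x = p" using minimal_projectionD(5)[OF minimal[OF p], of x] nx xp by simp
  have "x\<^sup>\<star> * p = x\<^sup>\<star>" using adj_block[OF p, of x] xp by simp
  then show "x * x\<^sup>\<star> = p"
    using minimal_projectionD(5)[OF minimal[OF p], of "x\<^sup>\<star>"] nx by (simp add: star_star)
qed

lemma normalized_orth:
  assumes "scalars A = \<real>" "in_block A p v" "bj_orth A v w"
  shows "((1 / norm (v * p)) *\<^sub>R (v * p))\<^sup>\<star> * ((1 / norm (w * p)) *\<^sub>R (w * p)) =
    - (((1 / norm (w * p)) *\<^sub>R (w * p))\<^sup>\<star> * ((1 / norm (v * p)) *\<^sub>R (v * p)))"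
proof -
  have "(v * p)\<^sup>\<star> * (w * p) = - ((w * p)\<^sup>\<star> * (v * p))"
    using column_inner_eq[OF minimal[OF p], of v w] real_bj_orth_iff[OF assms(1,2), of w] assms(3)
    by (simp add: eq_neg_iff_add_eq_0)
  then show ?thesis by (simp add: mult.commute)
qed

text \<open>
  Left multiplication by \<open>x\<^sup>\<star>\<close> is a rotation that takes \<open>x\<close> to the unit and hence \<open>y\<close> to an imaginary
  element.
\<close>

lemma imaginary_unit:
  assumes x: "x * p = x" "x\<^sup>\<star> * x = p" "x * x\<^sup>\<star> = p" and y: "y * p = y" "y\<^sup>\<star> * y = p"
    and orth: "x\<^sup>\<star> * y = - (y\<^sup>\<star> * x)"
  shows "(x\<^sup>\<star> * y) * p = x\<^sup>\<star> * y" "(x\<^sup>\<star> * y)\<^sup>\<star> = - (x\<^sup>\<star> * y)" "(x\<^sup>\<star> * y) * (x\<^sup>\<star> * y) = - p"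
proof -
  show "(x\<^sup>\<star> * y) * p = x\<^sup>\<star> * y" by (simp add: mult.assoc y)
  show "(x\<^sup>\<star> * y)\<^sup>\<star> = - (x\<^sup>\<star> * y)" by (simp add: star_mult star_star orth)
  have "(x\<^sup>\<star> * y) * (x\<^sup>\<star> * y) = - (y\<^sup>\<star> * x) * (x\<^sup>\<star> * y)" by (simp only: orth[symmetric])
  also have "\<dots> = - (y\<^sup>\<star> * (x * x\<^sup>\<star>) * y)" by (simp add: mult.assoc)
  also have "\<dots> = - (y\<^sup>\<star> * (p * y))" by (simp only: x mult.assoc)
  also have "\<dots> = - p" using y block_unit_left[OF y(1)] by simp
  finally show "(x\<^sup>\<star> * y) * (x\<^sup>\<star> * y) = - p" .
qed

lemma complex_frame:
  assumes C: "scalars A = UNIV"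
  shows "quaternion_frame A p (\<i> \<cdot> p) 0 1 0"
proof -
  note pD = minimal_projectionD[OF minimal[OF p]]
  have "quaternion_laws A p (\<i> \<cdot> p) 0 1 0"
    using C pD(2,3)
    by (simp add: quaternion_laws_def smul_mult_left smul_mult_right star_smul smul_smul
        scal_uminus_one scal_minus_left)
  moreover have "\<exists>a b c d. x * p = quaternion_comb p (\<i> \<cdot> p) 0 a b c d" for x
  proof -
    obtain z where "x * p = z \<cdot> p" using complex_block[OF C p] .
    then have "x * p = quaternion_comb p (\<i> \<cdot> p) 0 (Re z) (Im z) 0 0"
      using scal_Complex[OF C, of z p] by (simp add: quaternion_comb_def)
    then show ?thesis by blast
  qed
  ultimately show ?thesis by (simp add: quaternion_frame_def)
qed

text \<open>
  Frobenius' theorem on real division algebras: an element \<open>l\<close> orthogonal to \<open>1\<close>, \<open>i\<close>, \<open>j\<close> and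
  \<open>i j\<close> is imaginary and anticommutes with \<open>i\<close>, \<open>j\<close> and \<open>i j\<close>.  By the first two it commutes with \<open>i j\<close>,
  so it vanishes.
\<close>

lemma real_frame_triple:
  assumes R: "scalars A = \<real>" and "orth_triple A p"
  shows "\<exists>i j. quaternion_frame A p i j 1 1"
proof -
  obtain u v w where uvw: "in_block A p u" "in_block A p v" "in_block A p w"
    "bj_orth A u v" "bj_orth A u w" "bj_orth A v w"
    using assms(2) by (auto simp: orth_triple_def)
  define x where "x = (1 / norm (u * p)) *\<^sub>R (u * p)"
  define y where "y = (1 / norm (v * p)) *\<^sub>R (v * p)"
  define z where "z = (1 / norm (w * p)) *\<^sub>R (w * p)"
  note x = normalized_block[OF uvw(1), folded x_def] and y = normalized_block[OF uvw(2), folded y_def]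
    and z = normalized_block[OF uvw(3), folded z_def]
  note xy = normalized_orth[OF R uvw(1,4), folded x_def y_def]
    and xz = normalized_orth[OF R uvw(1,5), folded x_def z_def]
    and yz = normalized_orth[OF R uvw(2,6), folded y_def z_def]
  define i where "i = x\<^sup>\<star> * y"
  define j where "j = x\<^sup>\<star> * z"
  note i = imaginary_unit[OF x y(1,2) xy, folded i_def]
  note j = imaginary_unit[OF x z(1,2) xz, folded j_def]
  have prod: "(y\<^sup>\<star> * x) * (x\<^sup>\<star> * z) = y\<^sup>\<star> * z" if "z * p = z" for y z
  proof -
    have "(y\<^sup>\<star> * x) * (x\<^sup>\<star> * z) = y\<^sup>\<star> * (x * x\<^sup>\<star>) * z" by (simp add: mult.assoc)
    also have "\<dots> = y\<^sup>\<star> * (p * z)" by (simp only: x mult.assoc)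
    finally show ?thesis using block_unit_left[OF that] by simp
  qed
  have "i * j = - (y\<^sup>\<star> * z)" using prod[OF z(1), of y] xy by (simp add: i_def j_def)
  moreover have "j * i = - (z\<^sup>\<star> * y)" using prod[OF y(1), of z] xz by (simp add: i_def j_def)
  ultimately have ji: "j * i = - (i * j)" using yz by simp
  have laws: "quaternion_laws A p i j 1 1" using i j ji by (simp add: quaternion_laws_def)
  note products = quaternion_products[OF laws]
  have "\<exists>a b c d. t * p = quaternion_comb p i j a b c d" for t
  proof -
    obtain a b c d where r: "\<And>e. e \<in> {p, i, j, i * j} \<Longrightarrow>
      column_inner p e (t * p - quaternion_comb p i j a b c d) = 0"
      using quaternion_residual[OF laws, of t] by blast
    define l where "l = t * p - quaternion_comb p i j a b c d"
    have lp: "l * p = l"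
      by (simp add: l_def left_diff_distrib quaternion_comb_block[OF laws] mult_pp[OF minimal[OF p]])
    have zero: "e\<^sup>\<star> * l + l\<^sup>\<star> * e = 0" if "e \<in> {p, i, j, i * j}" for e
    proof -
      have "e * p = e" using that products by auto
      then show ?thesis using column_inner_eq[OF minimal[OF p], of e l] r[OF that] lp by (simp add: l_def)
    qed
    have "l\<^sup>\<star> * p = l\<^sup>\<star>" using adj_block[OF p, of l] lp by simp
    then have ladj: "l\<^sup>\<star> = - l"
      using zero[of p] minimal_projectionD(2)[OF minimal[OF p]] block_unit_left[OF lp]
      by (simp add: eq_neg_iff_add_eq_0 add.commute)
    have li: "l * i = - (i * l)"
      using zero[of i] i ladj by (simp add: eq_neg_iff_add_eq_0 add.commute)
    have lj: "l * j = - (j * l)"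
      using zero[of j] j ladj by (simp add: eq_neg_iff_add_eq_0 add.commute)
    have kadj: "(i * j)\<^sup>\<star> = - (i * j)" using i j ji by (simp add: star_mult)
    have "(i * j)\<^sup>\<star> * l + l\<^sup>\<star> * (i * j) = 0" by (rule zero) simp
    then have "- (i * j * l + l * (i * j)) = 0" unfolding kadj ladj by simp
    then have lk: "l * (i * j) = - (i * j * l)"
      by (simp only: neg_equal_0_iff_equal add_eq_0_iff)
    have "l * (i * j) = - (i * (l * j))" using li by (simp flip: mult.assoc)
    also have "\<dots> = i * j * l" by (simp add: lj mult.assoc)
    finally have "i * j * l = - (i * j * l)" using lk by simp
    then have "2 *\<^sub>R (i * j * l) = 0" unfolding scaleR_2 by (metis add.right_inverse)
    then have "i * j * l = 0" by simp
    then have "i * j * (i * j * l) = 0" by simp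
    then have "(i * j * (i * j)) * l = 0" by (simp only: mult.assoc)
    then have "p * l = 0" using products(15) by simp
    then have "l = 0" using block_unit_left[OF lp] by simp
    then show ?thesis unfolding l_def by (metis eq_iff_diff_eq_0)
  qed
  then show ?thesis using laws by (auto simp: quaternion_frame_def)
qed

lemma in_block_projection: "in_block A p p"
  using in_block_self[OF p block_idem[OF p]] minimal_projectionD(4)[OF minimal[OF p]] .

lemma real_frame_pair:
  assumes R: "scalars A = \<real>" and "orth_pair A p" "\<not> orth_triple A p"
  shows "\<exists>i. quaternion_frame A p i 0 1 0"
proof -
  obtain u v where uv: "in_block A p u" "in_block A p v" "bj_orth A u v"
    using assms(2) by (auto simp: orth_pair_def)
  define x where "x = (1 / norm (u * p)) *\<^sub>R (u * p)"
  define y where "y = (1 / norm (v * p)) *\<^sub>R (v * p)"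
  note x = normalized_block[OF uv(1), folded x_def] and y = normalized_block[OF uv(2), folded y_def]
  note xy = normalized_orth[OF R uv(1,3), folded x_def y_def]
  define i where "i = x\<^sup>\<star> * y"
  note i = imaginary_unit[OF x y(1,2) xy, folded i_def]
  have laws: "quaternion_laws A p i 0 1 0" using i by (simp add: quaternion_laws_def)
  have "i \<noteq> 0" using i(3) minimal_projectionD(4)[OF minimal[OF p]] by auto
  then have ib: "in_block A p i" using in_block_self[OF p i(1)] by simp
  have "\<exists>a b c d. t * p = quaternion_comb p i 0 a b c d" for t
  proof -
    obtain a b c d where r: "\<And>e. e \<in> {p, i, 0, i * 0} \<Longrightarrow>
      column_inner p e (t * p - quaternion_comb p i 0 a b c d) = 0"
      using quaternion_residual[OF laws, of t] by blast
    define l where "l = t * p - quaternion_comb p i 0 a b c d"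
    have lp: "l * p = l"
      by (simp add: l_def left_diff_distrib quaternion_comb_block[OF laws] mult_pp[OF minimal[OF p]])
    have "l = 0"
    proof (rule ccontr)
      assume "l \<noteq> 0"
      then have lb: "in_block A p l" using in_block_self[OF p lp] by simp
      have "column_inner p p i = 0"
        using column_inner_basis(1)[OF laws, of 0 1 0 0] by (simp add: quaternion_comb_def)
      then have "orth_triple A p"
        unfolding orth_triple_def using r in_block_projection ib lb
          real_bj_orth_iff[OF R in_block_projection] real_bj_orth_iff[OF R ib]
        by (intro exI[of _ p] exI[of _ i] exI[of _ l]) (simp add: l_def)
      then show False using assms(3) by simp
    qed
    then show ?thesis unfolding l_def by (metis eq_iff_diff_eq_0)
  qed
  then show ?thesis using laws by (auto simp: quaternion_frame_def)
qed

lemma real_frame_single: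
  assumes R: "scalars A = \<real>" and "\<not> orth_pair A p"
  shows "quaternion_frame A p 0 0 0 0"
proof -
  have laws: "quaternion_laws A p 0 0 0 0" by (simp add: quaternion_laws_def)
  have "\<exists>a b c d. t * p = quaternion_comb p 0 0 a b c d" for t
  proof -
    obtain a b c d where r: "\<And>e. e \<in> {p, 0, 0, 0 * 0} \<Longrightarrow>
      column_inner p e (t * p - quaternion_comb p 0 0 a b c d) = 0"
      using quaternion_residual[OF laws, of t] by blast
    define l where "l = t * p - quaternion_comb p 0 0 a b c d"
    have lp: "l * p = l"
      by (simp add: l_def left_diff_distrib quaternion_comb_block[OF laws] mult_pp[OF minimal[OF p]])
    have "l = 0"
    proof (rule ccontr)
      assume "l \<noteq> 0"
      then have "in_block A p l" using in_block_self[OF p lp] by simp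
      then have "orth_pair A p"
        unfolding orth_pair_def using r in_block_projection
          real_bj_orth_iff[OF R in_block_projection]
        by (intro exI[of _ p] exI[of _ l]) (simp add: l_def)
      then show False using assms(2) by simp
    qed
    then show ?thesis unfolding l_def by (metis eq_iff_diff_eq_0)
  qed
  then show ?thesis using laws by (auto simp: quaternion_frame_def)
qed

end

end

section \<open>Assembling the isomorphism\<close>

text \<open>
  The map is defined on all of \<open>A\<close>, vanishing on the other blocks, so that the isomorphism of the algebras
  is the sum of these maps.
\<close>

definition block_isomorphism ::
  "'a::{real_normed_algebra, banach} cstar_structure \<Rightarrow> 'b::{real_normed_algebra, banach} cstar_structure
    \<Rightarrow> 'a \<Rightarrow> 'b \<Rightarrow> ('a \<Rightarrow> 'b) \<Rightarrow> bool" where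
  "block_isomorphism A B p q g \<longleftrightarrow>
     (\<forall>x y. g (x + y) = g x + g y) \<and> (\<forall>c\<in>scalars A. \<forall>x. g (smul A c x) = smul B c (g x)) \<and>
     (\<forall>x y. g (x * y) = g x * g y) \<and> (\<forall>x. g (star A x) = star B (g x)) \<and>
     (\<forall>x. g (x * p) = g x) \<and> (\<forall>x. g x * q = g x) \<and> (\<forall>x. norm (g x) = norm (x * p)) \<and>
     (\<forall>y. \<exists>x. g x = y * q)"

text \<open>
  The map keeps the coordinates with respect to the two frames; the multiplication table depends on
  the parameters only.
\<close>

lemma block_isomorphism_if_frames:
  assumes A: "block_decomposition A P" and p: "p \<in> P" and B: "block_decomposition B Q" and q: "q \<in> Q"
    and F: "quaternion_frame A p i j \<alpha> \<beta>" and G: "quaternion_frame B q i' j' \<alpha> \<beta>"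
    and eq: "scalars A = scalars B"
    and imag: "scalars A = UNIV \<Longrightarrow> i = smul A \<i> p \<and> i' = smul B \<i> q"
  shows "\<exists>g. block_isomorphism A B p q g"
proof -
  interpret A: block_decomposition A P by fact
  interpret B: block_decomposition B Q by fact
  note pm = A.minimal[OF p] and qm = B.minimal[OF q]
  have FL: "quaternion_laws A p i j \<alpha> \<beta>" and GL: "quaternion_laws B q i' j' \<alpha> \<beta>"
    using F G by (simp_all add: quaternion_frame_def)
  let ?F = "quaternion_comb p i j" and ?G = "quaternion_comb q i' j'"
  note F_mult = A.quaternion_comb_mult[OF p FL] and G_mult = B.quaternion_comb_mult[OF q GL]
  define g where "g x = ?G (column_inner p p x) (column_inner p i x) (column_inner p j x)
    (column_inner p (i * j) x)" for x
  have g_block: "g (x * p) = g x" for x by (simp add: g_def A.column_inner_mult_right[OF pm])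
  have g_comb: "g (?F a b c d) = ?G a b c d" for a b c d
    unfolding g_def A.column_inner_basis[OF p FL]
    by (rule B.quaternion_comb_degenerate[OF q GL])
  have rep: "\<exists>a b c d. x * p = ?F a b c d" for x using F by (simp add: quaternion_frame_def)
  have g_eq: "g x = ?G a b c d" if "x * p = ?F a b c d" for x a b c d
    using g_block[of x] g_comb that by simp
  have add: "g (x + y) = g x + g y" for x y
  proof -
    obtain a b c d where x: "x * p = ?F a b c d" using rep by blast
    obtain a' b' c' d' where y: "y * p = ?F a' b' c' d'" using rep by blast
    have "(x + y) * p = ?F (a + a') (b + b') (c + c') (d + d')"
      by (simp add: distrib_right x y quaternion_comb_add)
    then show ?thesis by (simp add: g_eq[OF x] g_eq[OF y] g_eq quaternion_comb_add)
  qed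
  have scaleR: "g (r *\<^sub>R x) = r *\<^sub>R g x" for r x
  proof -
    obtain a b c d where x: "x * p = ?F a b c d" using rep by blast
    have "(r *\<^sub>R x) * p = ?F (r * a) (r * b) (r * c) (r * d)"
      by (simp add: x quaternion_comb_scaleR)
    then show ?thesis by (simp add: g_eq[OF x] g_eq quaternion_comb_scaleR)
  qed
  have mult: "g (x * y) = g x * g y" for x y
  proof -
    obtain a b c d where x: "x * p = ?F a b c d" using rep by blast
    obtain a' b' c' d' where y: "y * p = ?F a' b' c' d'" using rep by blast
    have "(x * y) * p = ?F a b c d * ?F a' b' c' d'"
      using A.block_product[OF p, of x y] by (simp add: x y)
    then show ?thesis unfolding F_mult by (simp only: g_eq[OF x] g_eq[OF y] g_eq G_mult)
  qed
  have star: "g (star A x) = star B (g x)" for x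
  proof -
    obtain a b c d where x: "x * p = ?F a b c d" using rep by blast
    have "star A x * p = ?F a (- b) (- c) (- d)"
      using A.adj_block[OF p, of x] by (simp add: x A.quaternion_comb_adj[OF p FL])
    then show ?thesis by (simp add: g_eq[OF x] g_eq B.quaternion_comb_adj[OF q GL])
  qed
  have image_block: "g x * q = g x" for x
    by (simp add: g_def B.quaternion_comb_block[OF q GL])
  have norm: "norm (g x) = norm (x * p)" for x
  proof -
    obtain a b c d where x: "x * p = ?F a b c d" using rep by blast
    have "(norm (x * p))\<^sup>2 = column_inner p (x * p) (x * p)"
      by (simp add: A.column_inner_self[OF pm] A.mult_pp[OF pm])
    also have "\<dots> = column_inner q (g x) (g x)"
      unfolding x g_eq[OF x] A.column_inner_quaternion_comb[OF p FL]
        B.column_inner_quaternion_comb[OF q GL] ..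
    also have "\<dots> = (norm (g x))\<^sup>2" by (simp add: B.column_inner_self[OF qm] image_block)
    finally show ?thesis by simp
  qed
  have scal: "g (smul A c x) = smul B c (g x)" if c: "c \<in> scalars A" for c x
  proof (cases rule: A.scalar_cases)
    case real
    then show ?thesis
      using c eq A.scal_real[OF real(1) c, of x] B.scal_real[of c "g x"] by (simp add: scaleR)
  next
    case complex
    have comb: "smul A c p = ?F (Re c) (Im c) 0 0" "smul B c q = ?G (Re c) (Im c) 0 0"
      using A.scal_Complex[of c p] B.scal_Complex[of c q] complex eq imag
      by (simp_all add: quaternion_comb_def)
    have "smul A c x * p = smul A c p * x"
      using A.central[OF p, of x] c by (simp add: A.smul_mult_left)
    then have "g (smul A c x) = g (smul A c p) * g x" by (metis g_block mult)
    also have "\<dots> = smul B c q * g x" by (simp only: comb g_comb)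
    also have "\<dots> = smul B c (g x)"
      using c eq B.block_unit_left[OF q image_block] by (simp add: B.smul_mult_left)
    finally show ?thesis .
  qed
  have surj: "\<exists>x. g x = y * q" for y
  proof -
    obtain a b c d where "y * q = ?G a b c d"
      using G unfolding quaternion_frame_def by blast
    then show ?thesis using g_comb by metis
  qed
  show ?thesis
    unfolding block_isomorphism_def
    using add scal mult star g_block image_block norm surj by (intro exI[of _ g]) blast
qed

lemma cstar_isomorphic_if_block_isomorphisms:
  assumes A: "block_decomposition A P" and B: "block_decomposition B Q"
    and eq: "scalars A = scalars B" and \<sigma>: "bij_betw \<sigma> P Q"
    and g: "\<And>p. p \<in> P \<Longrightarrow> block_isomorphism A B p (\<sigma> p) (g p)"
  shows "cstar_isomorphic A B"
proof -
  interpret A: block_decomposition A P by fact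
  interpret B: block_decomposition B Q by fact
  note g = g[unfolded block_isomorphism_def, rule_format]
  define \<psi> where "\<psi> x = (\<Sum>p\<in>P. g p x)" for x
  have \<sigma>Q: "\<sigma> p \<in> Q" if "p \<in> P" for p using \<sigma> that by (auto simp: bij_betw_def)
  have \<sigma>inj: "\<sigma> p = \<sigma> p' \<longleftrightarrow> p = p'" if "p \<in> P" "p' \<in> P" for p p'
    using \<sigma> that by (auto simp: bij_betw_def inj_on_def)
  have comp: "\<psi> x * \<sigma> p = g p x" if p: "p \<in> P" for p x
  proof -
    have "g p' x * \<sigma> p = (if p = p' then g p x else 0)" if p': "p' \<in> P" for p'
    proof -
      have im: "g r x * \<sigma> r = g r x" if "r \<in> P" for r using g[OF that] by blast
      have "g p' x * \<sigma> p = g p' x * \<sigma> p' * \<sigma> p" by (simp only: im[OF p'])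
      also have "\<dots> = (if \<sigma> p' = \<sigma> p then g p' x * \<sigma> p' else 0)"
        by (rule B.block_mult[OF \<sigma>Q[OF p'] \<sigma>Q[OF p]])
      also have "\<dots> = (if p = p' then g p x else 0)" using im[OF p'] \<sigma>inj[OF p' p] by auto
      finally show ?thesis .
    qed
    then have "\<psi> x * \<sigma> p = (\<Sum>p'\<in>P. if p = p' then g p x else 0)"
      unfolding \<psi>_def sum_distrib_right by (intro sum.cong) auto
    then show ?thesis using p A.finite_blocks by simp
  qed
  have ext: "y = z" if "\<And>p. p \<in> P \<Longrightarrow> y * \<sigma> p = z * \<sigma> p" for y z
  proof (rule B.block_ext)
    fix q assume "q \<in> Q"
    then obtain p where "p \<in> P" "q = \<sigma> p" using \<sigma> by (auto simp: bij_betw_def)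
    then show "y * q = z * q" using that by blast
  qed
  have add: "\<psi> (x + y) = \<psi> x + \<psi> y" for x y
    using g by (simp add: \<psi>_def sum.distrib)
  have scal: "\<psi> (smul A c x) = smul B c (\<psi> x)" if "c \<in> scalars A" for c x
  proof (rule ext)
    fix p assume p: "p \<in> P"
    have "g p (smul A c x) = smul B c (g p x)" using g[OF p] that by blast
    then show "\<psi> (smul A c x) * \<sigma> p = smul B c (\<psi> x) * \<sigma> p"
      using that eq by (simp add: comp[OF p] B.smul_mult_left)
  qed
  have mult: "\<psi> (x * y) = \<psi> x * \<psi> y" for x y
  proof (rule ext)
    fix p assume p: "p \<in> P"
    have "g p (x * y) = g p x * g p y" using g[OF p] by blast
    then show "\<psi> (x * y) * \<sigma> p = \<psi> x * \<psi> y * \<sigma> p"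
      using B.block_product[OF \<sigma>Q[OF p], of "\<psi> x" "\<psi> y"] by (simp add: comp[OF p])
  qed
  have star: "\<psi> (star A x) = star B (\<psi> x)" for x
  proof (rule ext)
    fix p assume p: "p \<in> P"
    have "g p (star A x) = star B (g p x)" using g[OF p] by blast
    then show "\<psi> (star A x) * \<sigma> p = star B (\<psi> x) * \<sigma> p"
      using B.adj_block[OF \<sigma>Q[OF p], of "\<psi> x"] by (simp add: comp[OF p])
  qed
  have norm_comp: "norm (\<psi> x * \<sigma> p) = norm (x * p)" if "p \<in> P" for p x
    using g[OF that] comp[OF that] by simp
  have norm: "norm (\<psi> x) = norm x" for x
  proof (rule antisym)
    show "norm (\<psi> x) \<le> norm x"
    proof (rule B.norm_le_if_blocks_le[OF _ norm_ge_zero])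
      fix q assume "q \<in> Q"
      then obtain p where p: "p \<in> P" "q = \<sigma> p" using \<sigma> by (auto simp: bij_betw_def)
      then show "norm (\<psi> x * q) \<le> norm x" using norm_comp[OF p(1)] A.norm_block_le[OF p(1)] by simp
    qed
    show "norm x \<le> norm (\<psi> x)"
    proof (rule A.norm_le_if_blocks_le[OF _ norm_ge_zero])
      fix p assume p: "p \<in> P"
      show "norm (x * p) \<le> norm (\<psi> x)"
        using norm_comp[OF p, of x] B.norm_block_le[OF \<sigma>Q[OF p], of "\<psi> x"] by simp
    qed
  qed
  have "inj \<psi>"
  proof (rule injI)
    fix x y assume "\<psi> x = \<psi> y"
    moreover have "\<psi> ((x - y) + y) = \<psi> (x - y) + \<psi> y" by (rule add)
    ultimately have "\<psi> (x - y) = 0" by simp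
    then show "x = y" using norm[of "x - y"] by simp
  qed
  moreover have "\<exists>x. \<psi> x = y" for y
  proof -
    have "\<forall>p\<in>P. \<exists>x. g p x = y * \<sigma> p" using g by blast
    then obtain f where f: "\<And>p. p \<in> P \<Longrightarrow> g p (f p) = y * \<sigma> p" by metis
    define x where "x = (\<Sum>p\<in>P. f p * p)"
    have xp: "x * p = f p * p" if p: "p \<in> P" for p
    proof -
      have "x * p = (\<Sum>p'\<in>P. if p' = p then f p * p else 0)"
        unfolding x_def sum_distrib_right using A.block_mult p by (intro sum.cong) auto
      then show ?thesis using p A.finite_blocks by simp
    qed
    have "\<psi> x = y"
    proof (rule ext)
      fix p assume p: "p \<in> P"
      have gp: "g p (z * p) = g p z" for z using g[OF p] by blast
      show "\<psi> x * \<sigma> p = y * \<sigma> p" using gp[of x] gp[of "f p"] f[OF p] by (simp add: comp[OF p] xp[OF p])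
    qed
    then show ?thesis by blast
  qed
  then have "surj \<psi>" by (metis surjI)
  ultimately have "bij \<psi>" by (simp add: bij_def)
  then show ?thesis
    unfolding cstar_isomorphic_def using eq add scal mult star norm by blast
qed

text \<open>
  Orthogonal pairs and triples in the two blocks correspond, so the same one of the three cases
  of Frobenius' theorem applies to both.
\<close>

lemma bj_map_block_isomorphism:
  assumes A: "block_decomposition A P" and B: "block_decomposition B Q" and bj: "bj_map A B \<phi>"
    and eq: "scalars A = scalars B" and p: "p \<in> P" and q: "q \<in> Q"
    and iff: "\<And>v. in_block B q (\<phi> v) \<longleftrightarrow> in_block A p v"
  shows "\<exists>g. block_isomorphism A B p q g"
proof -
  interpret A: block_decomposition A P by fact
  interpret B: block_decomposition B Q by fact
  note iso = block_isomorphism_if_frames[OF A p B q _ _ eq]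
  have surj: "\<exists>v. \<phi> v = w" for w by (rule bj_map_surj[OF bj])
  have "(\<exists>w. R w) \<longleftrightarrow> (\<exists>v. R (\<phi> v))" for R using surj by metis
  then have "orth_pair B q \<longleftrightarrow> orth_pair A p" and "orth_triple B q \<longleftrightarrow> orth_triple A p"
    unfolding orth_pair_def orth_triple_def by (simp_all add: iff bj_map_orth[OF bj])
  moreover have "UNIV \<noteq> (\<real> :: complex set)" using i_not_in_Reals by blast
  moreover note A.real_frame_triple[OF p] B.real_frame_triple[OF q] A.real_frame_pair[OF p]
    B.real_frame_pair[OF q] A.real_frame_single[OF p] B.real_frame_single[OF q]
  ultimately show ?thesis
    using A.scalars A.complex_frame[OF p] B.complex_frame[OF q] eq iso by metis
qed

section \<open>Pseudo-abelian summand and dimension\<close>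

context block_decomposition
begin

text \<open>
  A nonzero \<open>x\<close> in the block generates \<open>x\<^sup>\<star> x\<close>, a nonzero multiple of \<open>p\<close>.
\<close>

lemma block_minimal_ideal:
  assumes p: "p \<in> P"
  shows "minimal_ideal A {x. x * p = x}"
  unfolding minimal_ideal_def
proof (intro conjI allI impI)
  note pD = minimal_projectionD[OF minimal[OF p]]
  show "two_sided_ideal A {x. x * p = x}"
  proof -
    have "a * x * p = a * x" "x * a * p = x * a" if x: "x * p = x" for a x
    proof -
      show "a * x * p = a * x" by (simp only: mult.assoc x)
      have "x * a * p = x * (p * a)" by (simp only: mult.assoc central[OF p, of a])
      then show "x * a * p = x * a" by (simp only: mult.assoc[symmetric] x)
    qed
    then show ?thesis by (simp add: two_sided_ideal_def distrib_right smul_mult_left)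
  qed
  show "{x. x * p = x} \<noteq> {0}" using pD(3,4) by blast
  fix J assume J: "two_sided_ideal A J \<and> J \<subseteq> {x. x * p = x}"
  show "J = {0} \<or> J = {x. x * p = x}"
  proof (cases "J = {0}")
    case False
    then obtain x where x: "x \<in> J" "x \<noteq> 0" using J by (auto simp: two_sided_ideal_def)
    then have "x * p = x" using J by blast
    then have "x\<^sup>\<star> * x = of_real ((norm x)\<^sup>2) \<cdot> p" using pD(5)[of x] by (simp only: smul_of_real)
    then have "p = of_real (1 / (norm x)\<^sup>2) \<cdot> (x\<^sup>\<star> * x)"
      using x(2) by (simp only: smul_of_real) simp
    moreover have "x\<^sup>\<star> * x \<in> J" using J x(1) by (simp add: two_sided_ideal_def)
    ultimately have "p \<in> J" using J of_real_scalar unfolding two_sided_ideal_def by metis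
    then have "y \<in> J" if "y * p = y" for y using J that unfolding two_sided_ideal_def by metis
    then show ?thesis using J by blast
  qed simp
qed

lemma block_skew_field:
  assumes p: "p \<in> P"
  shows "skew_field {x. x * p = x}"
  unfolding skew_field_def
proof (rule bexI[of _ p], intro conjI ballI impI)
  note pD = minimal_projectionD[OF minimal[OF p]]
  show "p \<noteq> 0" "p \<in> {x. x * p = x}" using pD by simp_all
  fix x assume "x \<in> {x. x * p = x}"
  then have xp: "x * p = x" by simp
  then show "x * p = x" "p * x = x" using block_unit_left[OF p] by simp_all
  have xp': "x\<^sup>\<star> * p = x\<^sup>\<star>" using adj_block[OF p, of x] xp by simp
  assume "x \<noteq> 0"
  then show "\<exists>y\<in>{x. x * p = x}. x * y = p \<and> y * x = p"
    using pD(5)[of x] pD(5)[of "x\<^sup>\<star>"] xp xp'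
    by (intro bexI[of _ "(1 / (norm x)\<^sup>2) *\<^sub>R x\<^sup>\<star>"]) (simp_all add: star_star)
qed

lemma pseudo_abelian_if_block_decomposition: "pseudo_abelian A"
proof -
  define I :: "'a \<Rightarrow> 'a set" where "I p = {x. x * p = x}" for p
  have inj: "inj_on I P"
  proof (rule inj_onI)
    fix p q assume pq: "p \<in> P" "q \<in> P" "I p = I q"
    have "p \<in> I p" using block_idem[OF pq(1)] by (simp add: I_def)
    then have "p \<in> I q" by (simp only: pq(3))
    then have "p * q = p" by (simp add: I_def)
    then show "p = q"
      using distinct_blocks[OF pq(1,2)] minimal_projectionD(4)[OF minimal[OF pq(1)]] by force
  qed
  have "x \<in> pseudo_abelian_summand A" for x
  proof -
    define f where "f J = x * inv_into P I J" for J
    have fI: "f (I p) = x * p" if "p \<in> P" for p using that inj by (simp add: f_def inv_into_f_f)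
    have "(\<Sum>J\<in>I ` P. f J) = (\<Sum>p\<in>P. x * p)"
      using fI by (simp add: sum.reindex[OF inj])
    then have "x = (\<Sum>J\<in>I ` P. f J)" by (simp add: sum_blocks)
    moreover have "\<forall>J\<in>I ` P. minimal_ideal A J \<and> skew_field J \<and> f J \<in> J"
      using block_minimal_ideal block_skew_field fI block_mult by (auto simp: I_def)
    ultimately show ?thesis
      using finite_blocks unfolding pseudo_abelian_summand_def by blast
  qed
  then show ?thesis by (auto simp: pseudo_abelian_def)
qed

end

lemma (in vector_space_pair) dim_UNIV_eq_if_linear_bij:
  assumes f: "Vector_Spaces.linear s1 s2 f" "bij f"
  shows "vs1.dim UNIV = vs2.dim UNIV"
proof -
  have inj: "inj_on f X" for X by (rule inj_on_subset[OF bij_is_inj[OF f(2)] subset_UNIV])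
  obtain B where B: "vs1.independent B" "vs1.span B = UNIV"
    using vs1.maximal_independent_subset[of UNIV] by (metis top.extremum_uniqueI)
  have "vs2.independent (f ` B)"
    by (rule linear_independent_injective_image[OF f(1) B(1) inj])
  moreover have "vs2.span (f ` B) = UNIV"
    using linear_span_image[OF f(1), of B] B(2) f(2) by (simp add: bij_def)
  ultimately have "vs2.dim UNIV = card (f ` B)" by (intro vs2.dim_unique[of "f ` B"]) simp_all
  also have "\<dots> = card B" using f(2) by (intro card_image inj)
  also have "\<dots> = vs1.dim UNIV" using B by (intro vs1.dim_unique[symmetric]) simp_all
  finally show ?thesis by simp
qed

lemma cstar_dim_eq_if_isomorphic:
  assumes A: "cstar_algebra A" and B: "cstar_algebra B" and iso: "cstar_isomorphic A B"
  shows "cstar_dim A = cstar_dim B"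
proof -
  interpret A: cstar_algebra A by fact
  interpret B: cstar_algebra B by fact
  obtain \<psi> where eq: "scalars A = scalars B" and \<psi>: "bij \<psi>" "\<And>x y. \<psi> (x + y) = \<psi> x + \<psi> y"
    "\<And>c x. c \<in> scalars A \<Longrightarrow> \<psi> (smul A c x) = smul B c (\<psi> x)"
    using iso by (auto simp: cstar_isomorphic_def)
  show ?thesis
  proof (cases rule: A.scalar_cases)
    case real
    have "linear \<psi>"
      using \<psi>(2) \<psi>(3)[OF A.of_real_scalar] by (intro linearI) (simp_all add: A.smul_of_real B.smul_of_real)
    then show ?thesis
      using real_vector.dim_UNIV_eq_if_linear_bij \<psi>(1) real eq by (simp add: cstar_dim_def)
  next
    case complex
    interpret V: vector_space_pair "smul A" "smul B"
      using A.vector_space_smul[OF complex] B.vector_space_smul complex eq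
      by (simp add: vector_space_pair_def)
    have "Vector_Spaces.linear (smul A) (smul B) \<psi>"
      using \<psi> complex by unfold_locales auto
    moreover have "UNIV \<noteq> (\<real> :: complex set)" using i_not_in_Reals by blast
    ultimately show ?thesis
      using V.dim_UNIV_eq_if_linear_bij \<psi>(1) complex eq by (simp add: cstar_dim_def)
  qed
qed

section \<open>The classification\<close>

theorem theorem1p1:
  fixes A1 :: "'a::{real_normed_algebra, banach} cstar_structure"
    and A2 :: "'b::{real_normed_algebra, banach} cstar_structure"
  assumes "cstar_algebra A1" and "cstar_algebra A2"
    and "bj_isomorphic A1 A2"
    and "finite_dimensional A1" and "pseudo_abelian A1" and "cstar_dim A1 \<ge> 2"
  shows "scalars A1 = scalars A2 \<and>
    cstar_isomorphic A1 A2 \<and>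
    finite_dimensional A2 \<and> pseudo_abelian A2 \<and> cstar_dim A1 = cstar_dim A2"
proof -
  obtain \<phi> where bj: "bj_map A1 A2 \<phi>"
    using assms(3) by (auto simp: bj_isomorphic_def bj_map_def)
  obtain P where P: "block_decomposition A1 P"
    using cstar_algebra.pseudo_abelian_block_decomposition[OF assms(1,5,4)] .
  obtain Q where Q: "block_decomposition A2 Q" and fin: "finite_dimensional A2"
    using bj_map_block_decomposition[OF bj P assms(4,2)] .
  have eq: "scalars A1 = scalars A2" by (rule bj_map_scalars_eq[OF P Q bj assms(6)])
  obtain \<sigma> where \<sigma>: "bij_betw \<sigma> P Q"
    and iff: "\<And>p v. p \<in> P \<Longrightarrow> in_block A2 (\<sigma> p) (\<phi> v) \<longleftrightarrow> in_block A1 p v"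
    using bj_map_blocks[OF P Q bj] by blast
  have "\<exists>g. block_isomorphism A1 A2 p (\<sigma> p) g" if p: "p \<in> P" for p
    using \<sigma> p iff by (intro bj_map_block_isomorphism[OF P Q bj eq p]) (auto simp: bij_betw_def)
  then obtain g where "\<And>p. p \<in> P \<Longrightarrow> block_isomorphism A1 A2 p (\<sigma> p) (g p)" by metis
  then have iso: "cstar_isomorphic A1 A2"
    by (rule cstar_isomorphic_if_block_isomorphisms[OF P Q eq \<sigma>])
  then show ?thesis
    using eq fin block_decomposition.pseudo_abelian_if_block_decomposition[OF Q]
      cstar_dim_eq_if_isomorphic[OF assms(1,2)] by blast
qed

end
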